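(* Let $$X=\sum_{i=1}^p\xi_i(x)\partial_{x_i}+\sum_{\alpha=1}^q\psi_\alpha(x,u)\partial_{u^\alpha}$$ be a $\mathcal G$-$n$-complete generalized vector field with corresponding projectable generalized group action $\Phi$ on $\mathbb R^p\times\mathbb R^q$. Then $$\mathrm{pr}^{(n)}X=X+\sum_{\alpha=1}^q\sum_J\psi_\alpha^J(x,u^{(n)})\,\partial_{u_J^\alpha},$$ where $J=(j_1,\dots,j_k)$ ranges over the (unordered) multi-indices with $1\le j_1,\dots,j_k\le p$, $1\le k\le n$, and $$\psi_\alpha^J(x,u^{(n)})=D_J\Big(\psi_\alpha-\sum_{i=1}^p\xi_iu_i^\alpha\Big)+\sum_{i=1}^p\xi_iu_{J,i}^\alpha.$$
   Context: Let $I=(0,1]$. $\mathcal G(\mathbb R)=\mathcal E_M/\mathcal N$, where $\mathcal E_M$ (resp. $\mathcal N$) consists of $(u_\varepsilon)_{\varepsilon\in I}\in C^\infty(\mathbb R)^I$ such that on each compact set each derivative is $O(\varepsilon^{-r})$ for some $r$ (resp. $O(\varepsilon^s)$ for all $s$) uniformly, as $\varepsilon\to0$. $\mathcal G_\tau(\mathbb R^m)=\mathcal E_\tau(\mathbb R^m)/\mathcal N_\tau(\mathbb R^m)$, where $\mathcal E_\tau$ consists of families $(u_\varepsilon)_{\varepsilon\in I}$ of functions in $\mathcal O_M(\mathbb R^m)$ (smooth functions all of whose derivatives are polynomially bounded) such that $\forall\alpha\,\exists r>0:\ \sup_x(1+|x|)^{-r}|\partial^\alpha u_\varepsilon(x)|=O(\varepsilon^{-r})$,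 and $\mathcal N_\tau$ of those with $\forall\alpha\,\exists r>0\,\forall s>0:\ \sup_x(1+|x|)^{-r}|\partial^\alpha u_\varepsilon(x)|=O(\varepsilon^s)$. $\widetilde{\mathcal G}_\tau(\mathbb R\times\mathbb R^m)$ is defined analogously for families depending on $(\eta,x)$, with estimates uniform for $\eta$ in each compact set $K\subset\mathbb R$ (the exponents may depend on $K$) and weights $(1+|x|)^{-r}$. Compositions and insertions of points are componentwise in $\varepsilon$. $\mathcal R$ is the ring of generalized numbers (families $(r_\varepsilon)$ with $|r_\varepsilon|\le\varepsilon^{-s}$ for some $s$ and small $\varepsilon$, modulo families that are $O(\varepsilon^s)$ for all $s$). A generalized group action on $\mathbb R^m$ is $\Phi\in(\widetilde{\mathcal G}_\tau(\mathbb R\times\mathbb R^m))^m$ with $\Phi(0,\cdot)=\mathrm{id}$ in $(\mathcal G_\tau(\mathbb R^m))^m$ and $\Phi(\eta_1+\eta_2,\cdot)=\Phi(\eta_1,\Phi(\eta_2,\cdot))$ as generalized functions of $(\eta_1,\eta_2,\cdot)\in\mathbb R^{2+m}$. A generalized vector field (with coefficients in $\mathcal G_\tau(\mathbb R^m)$) $\sum\xi_j(x)\partial_{x_j}$ is $\mathcal G$-complete if $\dot x(t)=\xi(x(t))$, $x(t_o)=\widetilde x_o$ is uniquely solvable in $\mathcal G(\mathbb R)^m$ for any $\widetilde x_o\in\mathcal R^m$, $t_o\in\mathbb R$. With $\xi:=\frac{d}{d\eta}\big|_0\Phi(\eta,\cdot)$, if $\sum\xi_j\partial_{x_j}$ is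 $\mathcal G$-complete it is called the infinitesimal generator of $\Phi$, and $\Phi$ is called $\mathcal G$-complete. $\Phi$ on $\mathbb R^p\times\mathbb R^q$ is projectable if $\Phi(\eta,(x,u))=(\Xi_\eta(x),\Psi_\eta(x,u))$ with $\Xi\in(\widetilde{\mathcal G}_\tau(\mathbb R\times\mathbb R^p))^p$, $\Psi\in(\widetilde{\mathcal G}_\tau(\mathbb R\times\mathbb R^{p+q}))^q$. For $U\in(\mathcal G_\tau(\mathbb R^p))^q$, $\Phi_\eta(U)$ is the element $x\mapsto\Psi_\eta(\Xi_{-\eta}(x),U\circ\Xi_{-\eta}(x))$ of $(\mathcal G_\tau(\mathbb R^p))^q$. $(\mathbb R^p\times\mathbb R^q)^{(n)}$ is the $n$-jet space, with coordinates $z=(x,u^{(n)})$, consisting of $x_i$, $u^\alpha$ and the derivative coordinates $u_J^\alpha$ for symmetric multi-indices $J=(j_1,\dots,j_k)$, $1\le k\le n$ ($u_J^\alpha$ stands for $\partial^ku^\alpha/\partial x_{j_1}\cdots\partial x_{j_k}$); $u_i^\alpha=\partial u^\alpha/\partial x_i$, $u_{J,i}^\alpha=\partial u_J^\alpha/\partial x_i$. $D_J=D_{j_1}\cdots D_{j_k}$ where $D_i=\partial_{x_i}+\sum_\alpha u_i^\alpha\partial_{u^\alpha}+\sum_{\alpha,J}u_{J,i}^\alpha\partial_{u_J^\alpha}$ is the total derivative. $\mathrm{pr}^{(n)}h$ collects $h$ and its partial derivatives up to order $n$. The $n$-th prolongation $\mathrm{pr}^{(n)}\Phi$ (a generalized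 group action on $(\mathbb R^p\times\mathbb R^q)^{(n)}$) is defined as follows: for $z$ choose $h\in\mathcal O_M(\mathbb R^p)^q$ with $(z_1,\dots,z_p,\mathrm{pr}^{(n)}h(z_1,\dots,z_p))=z$ (e.g. a Taylor polynomial) and set $\mathrm{pr}^{(n)}\Phi(\eta,z):=(\Xi_\eta(z_1,\dots,z_p),\mathrm{pr}^{(n)}(\Phi_\eta(h))(\Xi_\eta(z_1,\dots,z_p)))$; this does not depend on the choice of $h$. If $X$ is the infinitesimal generator of the $\mathcal G$-complete action $\Phi$ and $\mathrm{pr}^{(n)}\Phi$ is $\mathcal G$-complete as well, $X$ and $\Phi$ are called $\mathcal G$-$n$-complete, and $\mathrm{pr}^{(n)}X|_z:=\frac{d}{d\eta}\big|_0\mathrm{pr}^{(n)}\Phi_\eta(z)$. *)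

theory Defs
  imports "HOL-Analysis.Analysis" "HOL-Library.Multiset" "HOL-Library.Landau_Symbols"
begin

section \<open>Coordinate spaces\<close>

text \<open>
  All spaces in play are coordinate spaces \<open>\<real>\<^sup>V\<close> for finite sets \<open>V\<close> of the following coordinates.
  \<open>Par k\<close> is the group parameter \<open>\<eta>\<^sub>k\<close>, \<open>Ind i\<close> is \<open>x\<^sub>i\<close>, and \<open>Dep \<alpha> J\<close> is the jet coordinate
  \<open>u\<^sub>J\<^sup>\<alpha>\<close>; unordered multi-indices are multisets, and \<open>Dep \<alpha> {#}\<close> is \<open>u\<^sup>\<alpha>\<close> itself.
  A point of \<open>\<real>\<^sup>V\<close> is a function vanishing off \<open>V\<close>; on the set of these points the product topology
  is the Euclidean one.
\<close>

datatype coord = Par nat | Ind nat | Dep nat "nat multiset"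

type_synonym point = "coord \<Rightarrow> real"

definition coord_space :: "coord set \<Rightarrow> point set" where
  "coord_space V = {z. \<forall>c. c \<notin> V \<longrightarrow> z c = 0}"

definition proj :: "coord set \<Rightarrow> point \<Rightarrow> point" where
  "proj V z = (\<lambda>c. if c \<in> V then z c else 0)"

definition vnorm :: "coord set \<Rightarrow> point \<Rightarrow> real" where
  "vnorm V z = L2_set z V"

definition pd :: "coord \<Rightarrow> (point \<Rightarrow> real) \<Rightarrow> point \<Rightarrow> real" where
  "pd c f z = deriv (\<lambda>t. f (z(c := t))) (z c)"

fun pds :: "coord list \<Rightarrow> (point \<Rightarrow> real) \<Rightarrow> point \<Rightarrow> real" where
  "pds [] f = f"
| "pds (c # cs) f = pd c (pds cs f)"

definition smooth :: "coord set \<Rightarrow> (point \<Rightarrow> real) \<Rightarrow> bool" where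
  "smooth V f \<longleftrightarrow>
     (\<forall>cs \<in> lists V. continuous_on (coord_space V) (pds cs f) \<and>
        (\<forall>c\<in>V. \<forall>z\<in>coord_space V. (\<lambda>t. pds cs f (z(c := t))) differentiable (at (z c))))"


section \<open>Tempered generalized functions\<close>

text \<open>
  Generalized functions are handled through representing nets indexed by \<open>\<epsilon> \<in> (0,1]\<close>; equality of
  generalized functions is negligibility of the difference of representatives. The values of a
  net at \<open>\<epsilon>\<close> outside \<open>(0,1]\<close> are irrelevant.

  The set \<open>W\<close> collects the parameter coordinates, with respect to which estimates are only
  required uniformly on compact sets \<open>K\<close>. Thus \<open>Etau {} V\<close> and \<open>Ntau {} V\<close> represent
  \<open>\<G>\<^sub>\<tau>(\<real>\<^sup>V)\<close>, and \<open>Etau {Par 1} V\<close> and \<open>Ntau {Par 1} V\<close> represent the variant of it on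
  \<open>\<real> \<times> \<real>\<^sup>V\<close>. Bounds on suprema are written out pointwise since \<open>Sup\<close> of an unbounded set of
  reals is unspecified.
\<close>

type_synonym net = "real \<Rightarrow> point \<Rightarrow> real"
type_synonym vnet = "real \<Rightarrow> point \<Rightarrow> point"

definition wbound ::
  "coord set \<Rightarrow> coord set \<Rightarrow> point set \<Rightarrow> real \<Rightarrow> (point \<Rightarrow> real) \<Rightarrow> real \<Rightarrow> bool" where
  "wbound W V K r f B \<longleftrightarrow>
     (\<forall>z\<in>coord_space (W \<union> V). proj W z \<in> K \<longrightarrow> (1 + vnorm V z) powr (- r) * \<bar>f z\<bar> \<le> B)"

definition OM :: "coord set \<Rightarrow> coord set \<Rightarrow> (point \<Rightarrow> real) set" where
  "OM W V = {f. smooth (W \<union> V) f \<and>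
     (\<forall>K. compact K \<and> K \<subseteq> coord_space W \<longrightarrow>
       (\<forall>cs \<in> lists (W \<union> V). \<exists>r>0. \<exists>C. wbound W V K r (pds cs f) C))}"

definition Etau :: "coord set \<Rightarrow> coord set \<Rightarrow> net set" where
  "Etau W V = {u. (\<forall>\<epsilon>\<in>{0<..1}. u \<epsilon> \<in> OM W V) \<and>
     (\<forall>K. compact K \<and> K \<subseteq> coord_space W \<longrightarrow>
       (\<forall>cs \<in> lists (W \<union> V). \<exists>r>0. \<exists>C.
          \<forall>\<^sub>F \<epsilon> in at_right 0. wbound W V K r (pds cs (u \<epsilon>)) (C * \<epsilon> powr (- r))))}"

definition Ntau :: "coord set \<Rightarrow> coord set \<Rightarrow> net set" where
  "Ntau W V = {u. (\<forall>\<epsilon>\<in>{0<..1}. u \<epsilon> \<in> OM W V) \<and>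
     (\<forall>K. compact K \<and> K \<subseteq> coord_space W \<longrightarrow>
       (\<forall>cs \<in> lists (W \<union> V). \<exists>r>0. \<forall>s>0. \<exists>C.
          \<forall>\<^sub>F \<epsilon> in at_right 0. wbound W V K r (pds cs (u \<epsilon>)) (C * \<epsilon> powr s)))}"

definition tau_eq :: "coord set \<Rightarrow> coord set \<Rightarrow> coord set \<Rightarrow> vnet \<Rightarrow> vnet \<Rightarrow> bool" where
  "tau_eq W V C u v \<longleftrightarrow> (\<forall>c\<in>C. (\<lambda>\<epsilon> z. u \<epsilon> z c - v \<epsilon> z c) \<in> Ntau W V)"


section \<open>Generalized curves, generalized numbers, complete vector fields\<close>

definition EM :: "(real \<Rightarrow> real \<Rightarrow> real) set" where
  "EM = {u. (\<forall>\<epsilon>\<in>{0<..1}. \<forall>k t. ((deriv ^^ k) (u \<epsilon>)) differentiable (at t)) \<and>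
     (\<forall>K k. compact K \<longrightarrow> (\<exists>r C. \<forall>\<^sub>F \<epsilon> in at_right 0. \<forall>t\<in>K.
        \<bar>(deriv ^^ k) (u \<epsilon>) t\<bar> \<le> C * \<epsilon> powr (- r)))}"

definition NM :: "(real \<Rightarrow> real \<Rightarrow> real) set" where
  "NM = {u. (\<forall>\<epsilon>\<in>{0<..1}. \<forall>k t. ((deriv ^^ k) (u \<epsilon>)) differentiable (at t)) \<and>
     (\<forall>K k. compact K \<longrightarrow> (\<forall>s. \<exists>C. \<forall>\<^sub>F \<epsilon> in at_right 0. \<forall>t\<in>K.
        \<bar>(deriv ^^ k) (u \<epsilon>) t\<bar> \<le> C * \<epsilon> powr s))}"

definition moderate_num :: "(real \<Rightarrow> real) set" where
  "moderate_num = {a. \<exists>s. \<forall>\<^sub>F \<epsilon> in at_right 0. \<bar>a \<epsilon>\<bar> \<le> \<epsilon> powr (- s)}"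

definition negligible_num :: "(real \<Rightarrow> real) set" where
  "negligible_num = {a. \<forall>s. a \<in> O[at_right 0](\<lambda>\<epsilon>. \<epsilon> powr s)}"

definition gsolution ::
  "coord set \<Rightarrow> vnet \<Rightarrow> real \<Rightarrow> (real \<Rightarrow> point) \<Rightarrow> (real \<Rightarrow> real \<Rightarrow> point) \<Rightarrow> bool" where
  "gsolution V \<xi> t0 x0 x \<longleftrightarrow>
     (\<forall>\<epsilon>\<in>{0<..1}. \<forall>t. x \<epsilon> t \<in> coord_space V) \<and>
     (\<forall>c\<in>V. (\<lambda>\<epsilon> t. x \<epsilon> t c) \<in> EM \<and>
            (\<lambda>\<epsilon> t. deriv (\<lambda>s. x \<epsilon> s c) t - \<xi> \<epsilon> (x \<epsilon> t) c) \<in> NM \<and>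
            (\<lambda>\<epsilon>. x \<epsilon> t0 c - x0 \<epsilon> c) \<in> negligible_num)"

definition G_complete :: "coord set \<Rightarrow> vnet \<Rightarrow> bool" where
  "G_complete V \<xi> \<longleftrightarrow>
     (\<forall>t0 x0. (\<forall>c\<in>V. (\<lambda>\<epsilon>. x0 \<epsilon> c) \<in> moderate_num) \<longrightarrow>
        (\<exists>x. gsolution V \<xi> t0 x0 x) \<and>
        (\<forall>x y. gsolution V \<xi> t0 x0 x \<and> gsolution V \<xi> t0 x0 y \<longrightarrow>
           (\<forall>c\<in>V. (\<lambda>\<epsilon> t. x \<epsilon> t c - y \<epsilon> t c) \<in> NM)))"


section \<open>Generalized group actions\<close>

text \<open>Arguments of a one-parameter net: \<open>\<epsilon>\<close>, the group parameter \<open>\<eta>\<close>, the point.\<close>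

type_synonym action = "real \<Rightarrow> real \<Rightarrow> point \<Rightarrow> point"

text \<open>As a net of functions on \<open>\<real> \<times> \<real>\<^sup>V\<close>, with \<open>Par 1\<close> as the coordinate on the first factor.\<close>

definition uncurried :: "coord set \<Rightarrow> action \<Rightarrow> vnet" where
  "uncurried V F = (\<lambda>\<epsilon> w. F \<epsilon> (w (Par 1)) (proj V w))"

definition moderate_action :: "coord set \<Rightarrow> coord set \<Rightarrow> action \<Rightarrow> bool" where
  "moderate_action V C F \<longleftrightarrow>
     (\<forall>\<epsilon>\<in>{0<..1}. \<forall>\<eta>. \<forall>z\<in>coord_space V. F \<epsilon> \<eta> z \<in> coord_space C) \<and>
     (\<forall>c\<in>C. (\<lambda>\<epsilon> w. uncurried V F \<epsilon> w c) \<in> Etau {Par 1} V)"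

definition group_action :: "coord set \<Rightarrow> action \<Rightarrow> bool" where
  "group_action V \<Phi> \<longleftrightarrow>
     moderate_action V V \<Phi> \<and>
     tau_eq {} V V (\<lambda>\<epsilon>. \<Phi> \<epsilon> 0) (\<lambda>\<epsilon> z. z) \<and>
     tau_eq {Par 1, Par 2} V V
       (\<lambda>\<epsilon> w. \<Phi> \<epsilon> (w (Par 1) + w (Par 2)) (proj V w))
       (\<lambda>\<epsilon> w. \<Phi> \<epsilon> (w (Par 1)) (\<Phi> \<epsilon> (w (Par 2)) (proj V w)))"

definition generator :: "action \<Rightarrow> vnet" where
  "generator \<Phi> = (\<lambda>\<epsilon> z c. deriv (\<lambda>\<eta>. \<Phi> \<epsilon> \<eta> z c) 0)"

definition infinitesimal_generator :: "coord set \<Rightarrow> vnet \<Rightarrow> action \<Rightarrow> bool" where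
  "infinitesimal_generator V X \<Phi> \<longleftrightarrow>
     tau_eq {} V V X (generator \<Phi>) \<and> G_complete V (generator \<Phi>)"


section \<open>Jet spaces, projectable actions and prolongation\<close>

definition multi_indices :: "nat \<Rightarrow> nat \<Rightarrow> nat multiset set" where
  "multi_indices p n = {J. set_mset J \<subseteq> {1..p} \<and> size J \<le> n}"

definition base :: "nat \<Rightarrow> coord set" where
  "base p = Ind ` {1..p}"

definition fibre :: "nat \<Rightarrow> coord set" where
  "fibre q = (\<lambda>\<alpha>. Dep \<alpha> {#}) ` {1..q}"

text \<open>In particular \<open>jets p q 0 = base p \<union> fibre q\<close> is \<open>\<real>\<^sup>p \<times> \<real>\<^sup>q\<close>.\<close>

definition jets :: "nat \<Rightarrow> nat \<Rightarrow> nat \<Rightarrow> coord set" where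
  "jets p q n = base p \<union> {Dep \<alpha> J | \<alpha> J. \<alpha> \<in> {1..q} \<and> J \<in> multi_indices p n}"

text \<open>For \<open>x \<in> \<real>\<^sup>p\<close> and \<open>u\<close> in \<open>\<real>\<^sup>q\<close> (or in the space of all \<open>u\<close>-coordinates), the point \<open>(x,u)\<close>:
  the coordinates of \<open>x\<close> and \<open>u\<close> are disjoint, so the pair is the sum.\<close>

definition pair :: "point \<Rightarrow> point \<Rightarrow> point" where
  "pair x u = (\<lambda>c. x c + u c)"

definition projectable :: "nat \<Rightarrow> nat \<Rightarrow> action \<Rightarrow> action \<Rightarrow> action \<Rightarrow> bool" where
  "projectable p q \<Phi> \<Xi> \<Psi> \<longleftrightarrow>
     moderate_action (base p) (base p) \<Xi> \<and>
     moderate_action (jets p q 0) (fibre q) \<Psi> \<and>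
     tau_eq {Par 1} (jets p q 0) (jets p q 0)
       (uncurried (jets p q 0) \<Phi>)
       (uncurried (jets p q 0) (\<lambda>\<epsilon> \<eta> z. pair (\<Xi> \<epsilon> \<eta> (proj (base p) z)) (\<Psi> \<epsilon> \<eta> z)))"

text \<open>The net of functions \<open>\<Phi>\<^sub>\<eta>(U)\<close> for a net \<open>U\<close> of functions from \<open>\<real>\<^sup>p\<close> to \<open>\<real>\<^sup>q\<close>.\<close>

definition act :: "action \<Rightarrow> action \<Rightarrow> real \<Rightarrow> vnet \<Rightarrow> vnet" where
  "act \<Xi> \<Psi> \<eta> U = (\<lambda>\<epsilon> x. \<Psi> \<epsilon> \<eta> (pair (\<Xi> \<epsilon> (- \<eta>) x) (U \<epsilon> (\<Xi> \<epsilon> (- \<eta>) x))))"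

text \<open>The \<open>u\<close>-coordinates of the \<open>n\<close>-jet of \<open>h\<close> at \<open>x\<close>. Partial derivatives of smooth functions
  commute, so any enumeration of the multi-index \<open>J\<close> may be used; the same remark applies to
  total derivatives below.\<close>

definition pr_fun :: "nat \<Rightarrow> nat \<Rightarrow> nat \<Rightarrow> (point \<Rightarrow> point) \<Rightarrow> point \<Rightarrow> point" where
  "pr_fun p q n h x = (\<lambda>c. case c of
       Dep \<alpha> J \<Rightarrow>
         if \<alpha> \<in> {1..q} \<and> J \<in> multi_indices p n
         then pds (map Ind (sorted_list_of_multiset J)) (\<lambda>y. h y (Dep \<alpha> {#})) x
         else 0
     | _ \<Rightarrow> 0)"

text \<open>The function \<open>h\<close> with prescribed \<open>n\<close>-jet \<open>z\<close> used to define the prolongation is the Taylor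
  polynomial. (A choice of \<open>h\<close> depending arbitrarily on \<open>z\<close> need not give a net that is smooth
  in \<open>z\<close>, since \<open>\<Xi>\<^sub>-\<^sub>\<eta> \<circ> \<Xi>\<^sub>\<eta>\<close> is the identity only up to a negligible net.) Lemma
  \<open>taylor_jet\<close> below confirms that its jet is \<open>z\<close>.\<close>

definition taylor_monom :: "nat \<Rightarrow> point \<Rightarrow> nat multiset \<Rightarrow> point \<Rightarrow> real" where
  "taylor_monom p z J y =
     (\<Prod>i=1..p. (y (Ind i) - z (Ind i)) ^ count J i / fact (count J i))"

definition taylor :: "nat \<Rightarrow> nat \<Rightarrow> nat \<Rightarrow> point \<Rightarrow> point \<Rightarrow> point" where
  "taylor p q n z y = (\<lambda>c. case c of
       Dep \<alpha> K \<Rightarrow>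
         if \<alpha> \<in> {1..q} \<and> K = {#}
         then \<Sum>J\<in>multi_indices p n. z (Dep \<alpha> J) * taylor_monom p z J y
         else 0
     | _ \<Rightarrow> 0)"

definition prolong :: "nat \<Rightarrow> nat \<Rightarrow> nat \<Rightarrow> action \<Rightarrow> action \<Rightarrow> action" where
  "prolong p q n \<Xi> \<Psi> = (\<lambda>\<epsilon> \<eta> z.
     let x' = \<Xi> \<epsilon> \<eta> (proj (base p) z)
     in pair x' (pr_fun p q n (act \<Xi> \<Psi> \<eta> (\<lambda>_. taylor p q n z) \<epsilon>) x'))"

definition G_n_complete ::
  "nat \<Rightarrow> nat \<Rightarrow> nat \<Rightarrow> vnet \<Rightarrow> action \<Rightarrow> action \<Rightarrow> action \<Rightarrow> bool" where
  "G_n_complete p q n X \<Phi> \<Xi> \<Psi> \<longleftrightarrow>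
     group_action (jets p q 0) \<Phi> \<and> projectable p q \<Phi> \<Xi> \<Psi> \<and>
     infinitesimal_generator (jets p q 0) X \<Phi> \<and>
     G_complete (jets p q n) (generator (prolong p q n \<Xi> \<Psi>))"


section \<open>Vector fields in coordinates and total derivatives\<close>

definition coord_field :: "coord \<Rightarrow> point" where
  "coord_field c = (\<lambda>d. if d = c then 1 else 0)"

definition vector_field :: "nat \<Rightarrow> nat \<Rightarrow> (nat \<Rightarrow> net) \<Rightarrow> (nat \<Rightarrow> net) \<Rightarrow> vnet" where
  "vector_field p q \<xi> \<psi> = (\<lambda>\<epsilon> z c.
     (\<Sum>i=1..p. \<xi> i \<epsilon> (proj (base p) z) * coord_field (Ind i) c) +
     (\<Sum>\<alpha>=1..q. \<psi> \<alpha> \<epsilon> (proj (jets p q 0) z) * coord_field (Dep \<alpha> {#}) c))"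

text \<open>\<open>total_deriv p q k i\<close> is \<open>D\<^sub>i\<close> as an operator from functions on the \<open>k\<close>-jet space to
  functions on the \<open>(k+1)\<close>-jet space. In \<open>total_derivs\<close> the function \<open>f\<close> lives on the \<open>k\<close>-jet
  space, so after \<open>length js\<close> steps one is on the \<open>(k + length js)\<close>-jet space.\<close>

definition total_deriv ::
  "nat \<Rightarrow> nat \<Rightarrow> nat \<Rightarrow> nat \<Rightarrow> (point \<Rightarrow> real) \<Rightarrow> point \<Rightarrow> real" where
  "total_deriv p q k i f z =
     pd (Ind i) f (proj (jets p q k) z) +
     (\<Sum>\<alpha>=1..q. \<Sum>J\<in>multi_indices p k.
        z (Dep \<alpha> (add_mset i J)) * pd (Dep \<alpha> J) f (proj (jets p q k) z))"

fun total_derivs ::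
  "nat \<Rightarrow> nat \<Rightarrow> nat \<Rightarrow> nat list \<Rightarrow> (point \<Rightarrow> real) \<Rightarrow> point \<Rightarrow> real" where
  "total_derivs p q k [] f = f"
| "total_derivs p q k (j # js) f =
     total_deriv p q (k + length js) j (total_derivs p q k js f)"

definition characteristic ::
  "nat \<Rightarrow> nat \<Rightarrow> (nat \<Rightarrow> net) \<Rightarrow> (nat \<Rightarrow> net) \<Rightarrow> nat \<Rightarrow> net" where
  "characteristic p q \<xi> \<psi> \<alpha> = (\<lambda>\<epsilon> z.
     \<psi> \<alpha> \<epsilon> (proj (jets p q 0) z) -
     (\<Sum>i=1..p. \<xi> i \<epsilon> (proj (base p) z) * z (Dep \<alpha> {#i#})))"

text \<open>A priori \<open>\<psi>\<^sub>\<alpha>\<^sup>J\<close> is a function on the \<open>(|J|+1)\<close>-jet space, since \<open>u\<^sub>J\<^sub>,\<^sub>i\<close> occurs in it;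
  for \<open>|J| = n\<close> the coordinates of order \<open>n + 1\<close> cancel. Identities between it and a function on
  the \<open>n\<close>-jet space are therefore identities on the \<open>(n+1)\<close>-jet space, with the latter function
  pulled back along the projection.\<close>

definition prolonged_coeff ::
  "nat \<Rightarrow> nat \<Rightarrow> (nat \<Rightarrow> net) \<Rightarrow> (nat \<Rightarrow> net) \<Rightarrow> nat \<Rightarrow> nat multiset \<Rightarrow> net" where
  "prolonged_coeff p q \<xi> \<psi> \<alpha> J = (\<lambda>\<epsilon> z.
     total_derivs p q 1 (sorted_list_of_multiset J) (characteristic p q \<xi> \<psi> \<alpha> \<epsilon>) z +
     (\<Sum>i=1..p. \<xi> i \<epsilon> (proj (base p) z) * z (Dep \<alpha> (add_mset i J))))"


section \<open>The jet of the Taylor polynomial\<close>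

lemma finite_multi_indices: "finite (multi_indices p n)"
proof -
  have "multi_indices p n \<subseteq> mset ` {xs. set xs \<subseteq> {1..p} \<and> length xs \<le> n}"
  proof
    fix J assume J: "J \<in> multi_indices p n"
    obtain xs where "mset xs = J" using ex_mset by blast
    with J show "J \<in> mset ` {xs. set xs \<subseteq> {1..p} \<and> length xs \<le> n}"
      by (auto simp: multi_indices_def intro!: image_eqI[of _ _ xs])
  qed
  moreover have "finite (mset ` {xs. set xs \<subseteq> {1..p} \<and> length xs \<le> n})"
    by (intro finite_imageI finite_lists_length_le) simp
  ultimately show ?thesis by (rule finite_subset)
qed

lemma taylor_monom_deriv:
  assumes i: "i \<in> {1..p}"
  shows "((\<lambda>t. taylor_monom p z J (y(Ind i := t))) has_real_derivative
     (if i \<in># J then taylor_monom p z (J - {#i#}) y else 0)) (at (y (Ind i)))"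
proof -
  define R where "R = (\<Prod>k\<in>{1..p}-{i}. (y (Ind k) - z (Ind k)) ^ count J k / fact (count J k))"
  define c where "c = count J i"
  have split: "taylor_monom p z J (y(Ind i := t)) = (t - z (Ind i)) ^ c / fact c * R" for t
    unfolding taylor_monom_def R_def c_def
    using i by (subst prod.remove[of _ i]) (auto intro!: prod.cong)
  have D: "((\<lambda>t. (t - z (Ind i)) ^ c / fact c * R) has_real_derivative
      (real c * (y (Ind i) - z (Ind i)) ^ (c - 1) / fact c * R)) (at (y (Ind i)))"
    by (auto intro!: derivative_eq_intros)
  have "real c * (y (Ind i) - z (Ind i)) ^ (c - 1) / fact c * R =
     (if i \<in># J then taylor_monom p z (J - {#i#}) y else 0)"
  proof (cases "i \<in># J")
    case True
    then obtain c' where c': "c = Suc c'" unfolding c_def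
      by (metis count_greater_zero_iff gr0_implies_Suc)
    have "taylor_monom p z (J - {#i#}) y = (y (Ind i) - z (Ind i)) ^ c' / fact c' * R"
      unfolding taylor_monom_def using i c'
      by (subst prod.remove[of _ i]) (auto simp: R_def c_def[symmetric] intro!: prod.cong)
    with True c' show ?thesis by (simp add: field_simps del: of_nat_Suc)
  next
    case False
    then have "c = 0" by (simp add: c_def not_in_iff)
    with False show ?thesis by simp
  qed
  with D show ?thesis unfolding split by simp
qed

lemma pds_taylor:
  assumes "set js \<subseteq> {1..p}"
  shows "pds (map Ind js) (\<lambda>y. \<Sum>J\<in>multi_indices p n. a J * taylor_monom p z J y) =
    (\<lambda>y. \<Sum>J | J \<in> multi_indices p n \<and> mset js \<subseteq># J. a J * taylor_monom p z (J - mset js) y)"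
  using assms
proof (induction js)
  case Nil then show ?case by simp
next
  case (Cons j js)
  let ?A = "{J \<in> multi_indices p n. mset js \<subseteq># J}"
  let ?B = "{J \<in> multi_indices p n. mset (j # js) \<subseteq># J}"
  have fin: "finite ?A" by (simp add: finite_multi_indices)
  have iff: "J \<in> ?B \<longleftrightarrow> J \<in> ?A \<and> j \<in># J - mset js" for J
  proof -
    have "mset js \<subseteq># J \<Longrightarrow> mset (j # js) \<subseteq># J \<longleftrightarrow> j \<in># J - mset js"
      using subset_mset.le_diff_conv2[of "mset js" J "{#j#}"] by simp
    moreover have "mset (j # js) \<subseteq># J \<Longrightarrow> mset js \<subseteq># J"
      using subset_mset.order_trans[of "mset js" "mset (j # js)" J] by simp
    ultimately show ?thesis by blast
  qed
  show ?case
  proof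
    fix y
    have "((\<lambda>t. \<Sum>J\<in>?A. a J * taylor_monom p z (J - mset js) (y(Ind j := t))) has_real_derivative
       (\<Sum>J\<in>?A. a J * (if j \<in># J - mset js then taylor_monom p z (J - mset js - {#j#}) y else 0)))
       (at (y (Ind j)))"
      using Cons.prems by (intro DERIV_sum DERIV_cmult taylor_monom_deriv) auto
    then have "pds (map Ind (j # js)) (\<lambda>y. \<Sum>J\<in>multi_indices p n. a J * taylor_monom p z J y) y =
       (\<Sum>J\<in>?A. a J * (if j \<in># J - mset js then taylor_monom p z (J - mset js - {#j#}) y else 0))"
      using Cons by (simp add: pd_def DERIV_imp_deriv)
    also have "\<dots> = (\<Sum>J\<in>?B. a J * taylor_monom p z (J - mset (j # js)) y)"
      by (rule sum.mono_neutral_cong_right[OF fin]) (use iff in auto)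
    finally show "pds (map Ind (j # js)) (\<lambda>y. \<Sum>J\<in>multi_indices p n. a J * taylor_monom p z J y) y =
      (\<Sum>J\<in>?B. a J * taylor_monom p z (J - mset (j # js)) y)" .
  qed
qed

lemma taylor_jet:
  assumes "z \<in> coord_space (jets p q n)"
  shows "pair (proj (base p) z) (pr_fun p q n (taylor p q n z) (proj (base p) z)) = z"
proof
  fix c
  show "pair (proj (base p) z) (pr_fun p q n (taylor p q n z) (proj (base p) z)) c = z c"
  proof (cases c)
    case (Dep \<alpha> J)
    show ?thesis
    proof (cases "\<alpha> \<in> {1..q} \<and> J \<in> multi_indices p n")
      case True
      let ?x = "proj (base p) z"
      let ?B = "{K \<in> multi_indices p n. J \<subseteq># K}"
      have m: "taylor_monom p z (K - J) ?x = (if K = J then 1 else 0)" if "K \<in> ?B" for K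
      proof (cases "K = J")
        case True then show ?thesis by (simp add: taylor_monom_def)
      next
        case False
        with that obtain i where i: "i \<in># K - J"
          by (metis (no_types, lifting) mem_Collect_eq multiset_nonemptyE subset_mset.diff_add add_0)
        with that have "i \<in> {1..p}" by (auto simp: multi_indices_def dest: in_diffD)
        moreover have "?x (Ind i) = z (Ind i)" using \<open>i \<in> {1..p}\<close> by (simp add: proj_def base_def)
        ultimately show ?thesis using False i unfolding taylor_monom_def
          by (subst prod.remove[of _ i]) (auto simp: zero_power simp flip: count_greater_zero_iff)
      qed
      have "pr_fun p q n (taylor p q n z) ?x c =
         (\<Sum>K\<in>?B. z (Dep \<alpha> K) * taylor_monom p z (K - J) ?x)"
        using True pds_taylor[where js = "sorted_list_of_multiset J" and p = p and n = n and z = z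
            and a = "\<lambda>K. z (Dep \<alpha> K)"]
        by (simp add: pr_fun_def taylor_def Dep multi_indices_def)
      also have "\<dots> = (\<Sum>K\<in>?B. if K = J then z (Dep \<alpha> K) else 0)"
        by (rule sum.cong) (auto simp: m)
      also have "\<dots> = z c" using True by (simp add: finite_multi_indices Dep)
      finally show ?thesis by (auto simp: pair_def proj_def base_def Dep)
    next
      case False
      then have "c \<notin> jets p q n" by (auto simp: jets_def base_def Dep)
      with assms False show ?thesis by (auto simp: coord_space_def pair_def proj_def base_def pr_fun_def Dep)
    qed
  qed (use assms in \<open>auto simp: coord_space_def pair_def proj_def base_def pr_fun_def jets_def\<close>)
qed
end

theory Submission
  imports Defs
begin

text \<open>
  For a smooth action the formula is obtained by differentiating the \<open>n\<close>-jet of the transformed function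
  \<open>\<Phi>\<^sub>\<eta>(h)\<close> at \<open>\<eta> = 0\<close>. The difficulty here is that \<open>\<Phi>\<^sub>0 = id\<close> and \<open>\<Xi>\<^sub>-\<^sub>\<eta> \<circ> \<Xi>\<^sub>\<eta> = id\<close> hold only modulo negligible
  nets, so that for a fixed \<open>\<epsilon>\<close> nothing cancels. The proof therefore separates an exact computation, valid
  for each \<open>\<epsilon>\<close>, from a calculus of congruences.

  The exact part is the chain rule. By \<open>pds_act\<close> the derivative \<open>\<partial>\<^sub>J\<close> of the transformed Taylor polynomial \<open>h\<close>
  is \<open>transformed_deriv \<alpha> J\<close>, a function of \<open>\<eta>\<close>, of the point \<open>y\<close> and of the jet of \<open>h\<close> at \<open>\<Xi>\<^sub>-\<^sub>\<eta>(y)\<close>. It is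
  built by total derivatives that are twisted by the Jacobian matrix of \<open>\<Xi>\<^sub>-\<^sub>\<eta>\<close>.

  At \<open>\<eta> = 0\<close> this matrix is the unit matrix up to a negligible error. Hence \<open>transformed_deriv \<alpha> J\<close> is
  congruent to the coordinate \<open>u\<^sub>J\<close> (\<open>transformed_deriv_0\<close>), and, as partial derivatives commute, its
  derivative in \<open>\<eta>\<close> is congruent to the coefficient \<open>c\<^sub>J\<close> given by \<open>c = \<psi>\<^sub>\<alpha>\<close> for empty \<open>J\<close> and
  \<open>c\<^sub>J\<^sub>,\<^sub>j = D\<^sub>j c\<^sub>J - \<Sum>\<^sub>l (\<partial>\<^sub>j \<xi>\<^sub>l) u\<^sub>J\<^sub>,\<^sub>l\<close> (\<open>transformed_deriv_1\<close>). Since \<open>D\<^sub>j\<close> is a derivation, the recursion is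
  solved by \<open>D\<^sub>J(\<psi>\<^sub>\<alpha> - \<Sum>\<^sub>l \<xi>\<^sub>l u\<^sub>l) + \<Sum>\<^sub>l \<xi>\<^sub>l u\<^sub>J\<^sub>,\<^sub>l\<close> (\<open>total_derivs_characteristic\<close>); and since \<open>c\<^sub>J\<close> lives on the
  \<open>|J|\<close>-jet space, the cancellation of the coordinates of order \<open>|J| + 1\<close> comes for free.

  In the prolonged action the point at which \<open>transformed_deriv \<alpha> J\<close> is evaluated also depends on \<open>\<eta>\<close>. This
  does not contribute to the generator (\<open>prolonged_derivative\<close>): the derivatives of \<open>u\<^sub>J\<close> in the base
  directions vanish, and the jet coordinates of the point are stationary to first order, because they
  depend on \<open>\<eta>\<close> only through \<open>\<Xi>\<^sub>-\<^sub>\<eta> \<circ> \<Xi>\<^sub>\<eta>\<close>.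

  The calculus of congruences needs that moderate nets form an algebra closed under partial
  derivatives and composition, and that congruence is compatible with these operations. The former
  follows from the coinduction principle \<open>Etau_coinduct\<close>. For the latter, an interpolation inequality
  (\<open>negligible_pd\<close>) makes estimates of order zero sufficient: a moderate net that is negligible of order
  zero is negligible together with all its derivatives.
\<close>

section \<open>Calculus on coordinate spaces\<close>

lemma coord_space_upd: "z \<in> coord_space V \<Longrightarrow> c \<in> V \<Longrightarrow> z(c := t) \<in> coord_space V"
  by (auto simp: coord_space_def)

lemma coord_space_mono: "V \<subseteq> V' \<Longrightarrow> coord_space V \<subseteq> coord_space V'"
  by (auto simp: coord_space_def)

lemma proj_in: "proj V z \<in> coord_space V"
  by (simp add: proj_def coord_space_def)

lemma proj_id: "z \<in> coord_space V \<Longrightarrow> proj V z = z"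
  by (auto simp: proj_def coord_space_def fun_eq_iff)

lemma proj_upd_in: "c \<in> V \<Longrightarrow> proj V (z(c := t)) = (proj V z)(c := t)"
  by (auto simp: proj_def fun_eq_iff)

lemma proj_upd_notin: "c \<notin> V \<Longrightarrow> proj V (z(c := t)) = proj V z"
  by (auto simp: proj_def fun_eq_iff)

lemma proj_proj: "V \<subseteq> V' \<Longrightarrow> proj V (proj V' z) = proj V z"
  by (auto simp: proj_def fun_eq_iff)

lemma pds_append: "pds (cs @ [c]) f = pds cs (pd c f)"
  by (induction cs) auto

lemma pd_cong:
  assumes "\<And>z. z \<in> coord_space V \<Longrightarrow> f z = g z" "c \<in> V" "z \<in> coord_space V"
  shows "pd c f z = pd c g z"
proof -
  have "(\<lambda>t. f (z(c := t))) = (\<lambda>t. g (z(c := t)))"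
    using assms by (auto intro: coord_space_upd)
  then show ?thesis by (simp add: pd_def)
qed

definition has_partial :: "coord \<Rightarrow> (point \<Rightarrow> real) \<Rightarrow> (point \<Rightarrow> real) \<Rightarrow> point \<Rightarrow> bool" where
  "has_partial c f f' z \<longleftrightarrow> ((\<lambda>t. f (z(c := t))) has_real_derivative f' z) (at (z c))"

lemma has_partial_imp_pd: "has_partial c f f' z \<Longrightarrow> pd c f z = f' z"
  by (simp add: has_partial_def pd_def DERIV_imp_deriv)

lemma has_partial_line:
  assumes "\<And>z. z \<in> coord_space V \<Longrightarrow> has_partial c f f' z" "c \<in> V" "z \<in> coord_space V"
  shows "((\<lambda>t. f (z(c := t))) has_real_derivative f' (z(c := s))) (at s)"
  using assms(1)[of "z(c := s)"] coord_space_upd[OF assms(3,2)]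
  by (simp add: has_partial_def)

lemma smooth_has_partial:
  assumes "smooth V f" "cs \<in> lists V" "c \<in> V" "z \<in> coord_space V"
  shows "has_partial c (pds cs f) (pds (c # cs) f) z"
  using assms unfolding smooth_def has_partial_def
  by (auto simp: pd_def DERIV_deriv_iff_real_differentiable)

lemma smooth_continuous: "smooth V f \<Longrightarrow> cs \<in> lists V \<Longrightarrow> continuous_on (coord_space V) (pds cs f)"
  by (simp add: smooth_def)

lemma tendsto_point:
  fixes f :: "'a \<Rightarrow> point"
  assumes "\<And>c. ((\<lambda>t. f t c) \<longlongrightarrow> l c) F"
  shows "(f \<longlongrightarrow> l) F"
proof -
  have "limitin (product_topology (\<lambda>i. euclidean) UNIV) f l F"
    using assms by (simp add: limitin_componentwise)
  then show ?thesis by (simp add: euclidean_product_topology)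
qed

lemma mvt_between:
  fixes \<phi> :: "real \<Rightarrow> real"
  assumes "\<And>s. (\<phi> has_real_derivative \<phi>' s) (at s)"
  shows "\<exists>\<xi>. \<bar>\<xi> - a\<bar> \<le> \<bar>b - a\<bar> \<and> \<phi> b - \<phi> a = \<phi>' \<xi> * (b - a)"
proof (cases a b rule: linorder_cases)
  case less
  then obtain \<xi> where "a < \<xi>" "\<xi> < b" "\<phi> b - \<phi> a = (b - a) * \<phi>' \<xi>"
    using MVT2[of a b \<phi> \<phi>'] assms by blast
  then show ?thesis by (intro exI[of _ \<xi>]) auto
next
  case greater
  then obtain \<xi> where "b < \<xi>" "\<xi> < a" "\<phi> a - \<phi> b = (a - b) * \<phi>' \<xi>"
    using MVT2[of b a \<phi> \<phi>'] assms by blast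
  then show ?thesis by (intro exI[of _ \<xi>]) (auto simp: algebra_simps)
qed auto

text \<open>Points are functions, a type with a topology but without a norm, so there is no Frechet derivative to
  compose with. Instead the increment along the curve is split into one increment per coordinate; the mean
  value theorem turns each of them into a partial derivative at a point that tends to \<open>u t0\<close>.\<close>

lemma chain_rule_curve:
  fixes u :: "real \<Rightarrow> point"
  assumes fin: "finite V"
    and cont: "\<And>c. c \<in> V \<Longrightarrow> continuous_on (coord_space V) (F c)"
    and der: "\<And>c z. c \<in> V \<Longrightarrow> z \<in> coord_space V \<Longrightarrow> has_partial c f (F c) z"
    and u: "\<And>t. u t \<in> coord_space V"
    and u': "\<And>c. c \<in> V \<Longrightarrow> ((\<lambda>t. u t c) has_real_derivative u' c) (at t0)"
  shows "((\<lambda>t. f (u t)) has_real_derivative (\<Sum>c\<in>V. F c (u t0) * u' c)) (at t0)"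
proof -
  \<comment> \<open>the curve on which only the coordinates in \<open>S\<close> move; the induction sets one after the other in motion\<close>
  define v where "v S t = (\<lambda>c. if c \<in> S then u t c else u t0 c)" for S t
  have v_in: "v S t \<in> coord_space V" for S t
    using u by (auto simp: v_def coord_space_def)
  have lim_u: "((\<lambda>t. u t c) \<longlongrightarrow> u t0 c) (at t0)" if "c \<in> V" for c
    using DERIV_isCont[OF u'[OF that]] by (simp add: isCont_def)
  have "((\<lambda>t. f (v S t)) has_real_derivative (\<Sum>c\<in>S. F c (u t0) * u' c)) (at t0)" if "S \<subseteq> V" for S
    using finite_subset[OF that fin] that
  proof (induction S rule: finite_induct)
    case empty
    then show ?case by (simp add: v_def)
  next
    case (insert c S)
    then have c: "c \<in> V" and cS: "c \<notin> S" by auto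
    have "\<exists>\<xi>. \<bar>\<xi> - u t0 c\<bar> \<le> \<bar>u t c - u t0 c\<bar> \<and>
        f ((v S t)(c := u t c)) - f ((v S t)(c := u t0 c)) = F c ((v S t)(c := \<xi>)) * (u t c - u t0 c)" for t
      using mvt_between[of "\<lambda>s. f ((v S t)(c := s))" "\<lambda>s. F c ((v S t)(c := s))"]
        has_partial_line[OF der[OF c] c v_in] by blast
    then obtain \<xi> where \<xi>: "\<And>t. \<bar>\<xi> t - u t0 c\<bar> \<le> \<bar>u t c - u t0 c\<bar>"
      and mvt: "\<And>t. f ((v S t)(c := u t c)) - f ((v S t)(c := u t0 c)) =
         F c ((v S t)(c := \<xi> t)) * (u t c - u t0 c)" by metis
    have split: "f (v (insert c S) t) = f (v S t) + F c ((v S t)(c := \<xi> t)) * (u t c - u t0 c)" for t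
    proof -
      have "v (insert c S) t = (v S t)(c := u t c)" "v S t = (v S t)(c := u t0 c)"
        using cS by (auto simp: v_def fun_eq_iff)
      then show ?thesis using mvt[of t] by simp
    qed
    have "((\<lambda>t. \<xi> t - u t0 c) \<longlongrightarrow> 0) (at t0)"
    proof (rule Lim_null_comparison)
      show "\<forall>\<^sub>F t in at t0. norm (\<xi> t - u t0 c) \<le> \<bar>u t c - u t0 c\<bar>" using \<xi> by simp
      show "((\<lambda>t. \<bar>u t c - u t0 c\<bar>) \<longlongrightarrow> 0) (at t0)"
        using tendsto_rabs_zero[OF LIM_zero[OF lim_u[OF c]]] .
    qed
    then have lim_\<xi>: "(\<xi> \<longlongrightarrow> u t0 c) (at t0)" by (rule LIM_zero_cancel)
    have "((\<lambda>t. (v S t)(c := \<xi> t)) \<longlongrightarrow> u t0) (at t0)"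
    proof (rule tendsto_point)
      fix d
      show "((\<lambda>t. ((v S t)(c := \<xi> t)) d) \<longlongrightarrow> u t0 d) (at t0)"
        using lim_\<xi> lim_u insert.prems by (cases "d = c"; cases "d \<in> S") (auto simp: v_def)
    qed
    then have "((\<lambda>t. F c ((v S t)(c := \<xi> t))) \<longlongrightarrow> F c (u t0)) (at t0)"
      by (rule continuous_on_tendsto_compose[OF cont[OF c]])
         (auto simp: u intro!: coord_space_upd v_in c always_eventually)
    moreover have "((\<lambda>t. (u t c - u t0 c) / (t - t0)) \<longlongrightarrow> u' c) (at t0)"
      using u'[OF c] by (simp add: has_field_derivative_iff)
    ultimately have "((\<lambda>t. F c ((v S t)(c := \<xi> t)) * ((u t c - u t0 c) / (t - t0))) \<longlongrightarrow> F c (u t0) * u' c) (at t0)"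
      by (rule tendsto_mult)
    then have "((\<lambda>t. F c ((v S t)(c := \<xi> t)) * (u t c - u t0 c)) has_real_derivative F c (u t0) * u' c) (at t0)"
      by (simp add: has_field_derivative_iff)
    from DERIV_add[OF insert.IH this] insert.prems insert.hyps show ?case
      by (simp add: split add.commute)
  qed
  moreover have "v V t = u t" for t
    using u[of t] u[of t0] by (auto simp: v_def coord_space_def fun_eq_iff)
  ultimately show ?thesis by force
qed

text \<open>The second difference is the increment in \<open>c\<close> of the increment in \<open>d\<close>; one application of the mean value
  theorem for each of the two.\<close>

lemma second_difference:
  assumes f: "smooth V f" and c: "c \<in> V" and d: "d \<in> V" and "c \<noteq> d" and z: "z \<in> coord_space V"
  shows "\<exists>a b. \<bar>a\<bar> \<le> \<bar>h\<bar> \<and> \<bar>b\<bar> \<le> \<bar>h\<bar> \<and>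
    f (z(c := z c + h, d := z d + h)) - f (z(c := z c + h)) - f (z(d := z d + h)) + f z =
    pd d (pd c f) (z(c := z c + a, d := z d + b)) * h^2"
proof -
  define P where "P h k = z(c := z c + h, d := z d + k)" for h k
  have P_in: "P h k \<in> coord_space V" for h k
    using z c d by (auto simp: P_def intro!: coord_space_upd)
  have 1: "((\<lambda>s. f (P s k)) has_real_derivative pd c f (P s k)) (at s)" for s k
  proof -
    have eq: "(P 0 k)(c := s + z c) = P s k" for s
      using \<open>c \<noteq> d\<close> by (auto simp: P_def fun_eq_iff)
    have "((\<lambda>t. f ((P 0 k)(c := t))) has_real_derivative pd c f ((P 0 k)(c := s + z c))) (at (s + z c))"
      using has_partial_line[OF smooth_has_partial[OF f, of "[]" c] c P_in] c by simp
    from this[unfolded DERIV_shift] show ?thesis by (simp only: eq)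
  qed
  have 2: "((\<lambda>k. pd c f (P s k)) has_real_derivative pd d (pd c f) (P s k)) (at k)" for s k
  proof -
    have eq: "(P s 0)(d := k + z d) = P s k" for k by (auto simp: P_def fun_eq_iff)
    have "((\<lambda>t. pd c f ((P s 0)(d := t))) has_real_derivative pd d (pd c f) ((P s 0)(d := k + z d))) (at (k + z d))"
      using has_partial_line[OF smooth_has_partial[OF f, of "[c]" d] d P_in] c d by simp
    from this[unfolded DERIV_shift] show ?thesis by (simp only: eq)
  qed
  obtain a where a: "\<bar>a - 0\<bar> \<le> \<bar>h - 0\<bar>"
    "(f (P h h) - f (P h 0)) - (f (P 0 h) - f (P 0 0)) = (pd c f (P a h) - pd c f (P a 0)) * (h - 0)"
    using mvt_between[of "\<lambda>s. f (P s h) - f (P s 0)" "\<lambda>s. pd c f (P s h) - pd c f (P s 0)" 0 h]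
      DERIV_diff[OF 1 1] by blast
  obtain b where b: "\<bar>b - 0\<bar> \<le> \<bar>h - 0\<bar>" "pd c f (P a h) - pd c f (P a 0) = pd d (pd c f) (P a b) * (h - 0)"
    using mvt_between[of "\<lambda>k. pd c f (P a k)" "\<lambda>k. pd d (pd c f) (P a k)" 0 h] 2 by blast
  have "P h 0 = z(c := z c + h)" "P 0 h = z(d := z d + h)" "P 0 0 = z"
    using \<open>c \<noteq> d\<close> by (auto simp: P_def fun_eq_iff)
  with a b show ?thesis unfolding P_def[symmetric]
    by (intro exI[of _ a] exI[of _ b]) (simp add: power2_eq_square algebra_simps)
qed

text \<open>Schwarz's theorem. The mixed second difference over a square of side \<open>h\<close> does not depend on the order of
  the coordinates, and it is \<open>h\<^sup>2\<close> times either mixed derivative at a point near the corner.\<close>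

lemma pd_commute:
  assumes f: "smooth V f" and c: "c \<in> V" and d: "d \<in> V" and z: "z \<in> coord_space V"
  shows "pd c (pd d f) z = pd d (pd c f) z"
proof (cases "c = d")
  case False
  have "\<exists>a b a' b'. \<forall>h. \<bar>a h\<bar> \<le> \<bar>h\<bar> \<and> \<bar>b h\<bar> \<le> \<bar>h\<bar> \<and> \<bar>a' h\<bar> \<le> \<bar>h\<bar> \<and> \<bar>b' h\<bar> \<le> \<bar>h\<bar> \<and>
      pd d (pd c f) (z(c := z c + a h, d := z d + b h)) * h^2 =
      pd c (pd d f) (z(c := z c + a' h, d := z d + b' h)) * h^2"
  proof -
    have "\<exists>a b a' b'. \<bar>a\<bar> \<le> \<bar>h\<bar> \<and> \<bar>b\<bar> \<le> \<bar>h\<bar> \<and> \<bar>a'\<bar> \<le> \<bar>h\<bar> \<and> \<bar>b'\<bar> \<le> \<bar>h\<bar> \<and>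
      pd d (pd c f) (z(c := z c + a, d := z d + b)) * h^2 =
      pd c (pd d f) (z(c := z c + a', d := z d + b')) * h^2" for h
    proof -
      from second_difference[OF f c d False z, of h] obtain a b where
        1: "\<bar>a\<bar> \<le> \<bar>h\<bar>" "\<bar>b\<bar> \<le> \<bar>h\<bar>"
        "f (z(c := z c + h, d := z d + h)) - f (z(c := z c + h)) - f (z(d := z d + h)) + f z =
          pd d (pd c f) (z(c := z c + a, d := z d + b)) * h^2" by blast
      from second_difference[OF f d c not_sym[OF False] z, of h] obtain a' b' where
        2: "\<bar>a'\<bar> \<le> \<bar>h\<bar>" "\<bar>b'\<bar> \<le> \<bar>h\<bar>"
        "f (z(d := z d + h, c := z c + h)) - f (z(d := z d + h)) - f (z(c := z c + h)) + f z =
          pd c (pd d f) (z(d := z d + a', c := z c + b')) * h^2" by blast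
      show ?thesis
        using 1 2 by (intro exI[of _ a] exI[of _ b] exI[of _ b'] exI[of _ a'])
          (simp add: fun_upd_twist[OF False] algebra_simps)
    qed
    then show ?thesis by metis
  qed
  then obtain a b a' b' where bound: "\<And>h. \<bar>a h\<bar> \<le> \<bar>h\<bar>" "\<And>h. \<bar>b h\<bar> \<le> \<bar>h\<bar>" "\<And>h. \<bar>a' h\<bar> \<le> \<bar>h\<bar>" "\<And>h. \<bar>b' h\<bar> \<le> \<bar>h\<bar>"
    and eq: "\<And>h. pd d (pd c f) (z(c := z c + a h, d := z d + b h)) * h^2 =
      pd c (pd d f) (z(c := z c + a' h, d := z d + b' h)) * h^2" by blast
  have lim: "((\<lambda>h. G (z(c := z c + a h, d := z d + b h))) \<longlongrightarrow> G z) (at 0)"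
    if G: "continuous_on (coord_space V) G" and a: "\<And>h. \<bar>a h\<bar> \<le> \<bar>h\<bar>" and b: "\<And>h. \<bar>b h\<bar> \<le> \<bar>h\<bar>"
    for G :: "point \<Rightarrow> real" and a b :: "real \<Rightarrow> real"
  proof (rule continuous_on_tendsto_compose[OF G])
    have 0: "(a \<longlongrightarrow> 0) (at 0)" if "\<And>h. \<bar>a h\<bar> \<le> \<bar>h\<bar>" for a :: "real \<Rightarrow> real"
      by (rule Lim_null_comparison[where g = "\<lambda>h. \<bar>h\<bar>"]) (auto simp: that intro!: tendsto_eq_intros)
    have "((\<lambda>h. z c + a h) \<longlongrightarrow> z c) (at 0)" "((\<lambda>h. z d + b h) \<longlongrightarrow> z d) (at 0)"
      using tendsto_add[OF tendsto_const 0[of a, OF a], of "z c"]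
        tendsto_add[OF tendsto_const 0[of b, OF b], of "z d"] by simp_all
    then show "((\<lambda>h. z(c := z c + a h, d := z d + b h)) \<longlongrightarrow> z) (at 0)"
      by (intro tendsto_point, rename_tac e, case_tac "e = d"; case_tac "e = c") auto
  qed (use z c d in \<open>auto intro!: coord_space_upd always_eventually\<close>)
  have "((\<lambda>h. pd d (pd c f) (z(c := z c + a h, d := z d + b h))) \<longlongrightarrow> pd d (pd c f) z) (at 0)"
    using smooth_continuous[OF f, of "[d, c]"] c d bound by (intro lim) auto
  moreover have "\<forall>\<^sub>F h in at 0. pd d (pd c f) (z(c := z c + a h, d := z d + b h)) =
      pd c (pd d f) (z(c := z c + a' h, d := z d + b' h))"
    using eq by (auto simp: eventually_at intro!: exI[of _ 1])
  ultimately have "((\<lambda>h. pd c (pd d f) (z(c := z c + a' h, d := z d + b' h))) \<longlongrightarrow> pd d (pd c f) z) (at 0)"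
    by (rule Lim_transform_eventually)
  moreover have "((\<lambda>h. pd c (pd d f) (z(c := z c + a' h, d := z d + b' h))) \<longlongrightarrow> pd c (pd d f) z) (at 0)"
    using smooth_continuous[OF f, of "[c, d]"] c d bound by (intro lim) auto
  ultimately show ?thesis by (intro tendsto_unique[OF _ _ _]) (auto simp: LIM_unique)
qed simp

section \<open>Asymptotic scales\<close>

lemma eventually_at_right_0:
  "(\<forall>\<^sub>F \<epsilon> in at_right (0::real). P \<epsilon>) \<longleftrightarrow> (\<exists>\<delta>>0. \<forall>\<epsilon>. 0 < \<epsilon> \<and> \<epsilon> < \<delta> \<longrightarrow> P \<epsilon>)"
  by (auto simp: eventually_at_right_field)

lemma eventually_small: "0 < \<delta> \<Longrightarrow> \<forall>\<^sub>F \<epsilon> in at_right (0::real). 0 < \<epsilon> \<and> \<epsilon> < \<delta>"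
  by (auto simp: eventually_at_right_0)

text \<open>Powers of this one quantity, which exceeds every constant for small \<open>\<epsilon>\<close>, majorise both the weights and
  the powers of \<open>1/\<epsilon>\<close> in the definition of moderateness. Constants, sums, products and compositions can then
  be absorbed into the exponent.\<close>

definition scale :: "coord set \<Rightarrow> real \<Rightarrow> point \<Rightarrow> real" where
  "scale V \<epsilon> z = (1 + vnorm V z) / \<epsilon>"

lemma vnorm_nonneg: "0 \<le> vnorm V z"
  by (simp add: vnorm_def)

lemma scale_ge: "0 < \<epsilon> \<Longrightarrow> 1 / \<epsilon> \<le> scale V \<epsilon> z"
  by (simp add: scale_def vnorm_nonneg divide_right_mono)

lemma scale_ge': "0 < \<epsilon> \<Longrightarrow> \<epsilon> < 1 / a \<Longrightarrow> 0 < a \<Longrightarrow> a \<le> scale V \<epsilon> z"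
  by (rule order.trans[OF _ scale_ge]) (auto simp: field_simps)

definition slab :: "coord set \<Rightarrow> coord set \<Rightarrow> point set \<Rightarrow> point set" where
  "slab W V K = {z \<in> coord_space (W \<union> V). proj W z \<in> K}"

definition mod_on :: "coord set \<Rightarrow> point set \<Rightarrow> net \<Rightarrow> bool" where
  "mod_on V Z u \<longleftrightarrow> (\<exists>r::nat. \<forall>\<^sub>F \<epsilon> in at_right 0. \<forall>z\<in>Z. \<bar>u \<epsilon> z\<bar> \<le> scale V \<epsilon> z ^ r)"

text \<open>A power of the scale instead of a power of the weight is possible because the additional power of \<open>1/\<epsilon>\<close>
  is compensated by a larger \<open>s\<close>.\<close>

definition neg_on :: "coord set \<Rightarrow> point set \<Rightarrow> net \<Rightarrow> bool" where
  "neg_on V Z u \<longleftrightarrow> (\<exists>r::nat. \<forall>s::nat. \<forall>\<^sub>F \<epsilon> in at_right 0. \<forall>z\<in>Z. \<bar>u \<epsilon> z\<bar> \<le> scale V \<epsilon> z ^ r * \<epsilon> ^ s)"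

lemma mod_on_iff_wbound:
  "(\<exists>r>0. \<exists>C. \<forall>\<^sub>F \<epsilon> in at_right 0. wbound W V K r (f \<epsilon>) (C * \<epsilon> powr (- r))) \<longleftrightarrow> mod_on V (slab W V K) f"
proof
  assume "\<exists>r>0. \<exists>C. \<forall>\<^sub>F \<epsilon> in at_right 0. wbound W V K r (f \<epsilon>) (C * \<epsilon> powr (- r))"
  then obtain r C where r: "r > 0" and ev: "\<forall>\<^sub>F \<epsilon> in at_right 0. wbound W V K r (f \<epsilon>) (C * \<epsilon> powr (- r))"
    by blast
  show "mod_on V (slab W V K) f" unfolding mod_on_def
  proof (intro exI[of _ "nat \<lceil>r + 1\<rceil>"])
    have "\<forall>\<^sub>F \<epsilon> in at_right (0::real). 0 < \<epsilon> \<and> \<epsilon> < 1 / max 1 C" by (rule eventually_small) simp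
    with ev show "\<forall>\<^sub>F \<epsilon> in at_right 0. \<forall>z\<in>slab W V K. \<bar>f \<epsilon> z\<bar> \<le> scale V \<epsilon> z ^ nat \<lceil>r + 1\<rceil>"
    proof eventually_elim
      case (elim \<epsilon>)
      show ?case
      proof
        fix z assume "z \<in> slab W V K"
        then have *: "(1 + vnorm V z) powr (- r) * \<bar>f \<epsilon> z\<bar> \<le> C * \<epsilon> powr (- r)"
          using elim by (auto simp: wbound_def slab_def)
        have S: "max 1 C \<le> scale V \<epsilon> z" using elim by (intro scale_ge') auto
        have n: "0 < 1 + vnorm V z" using vnorm_nonneg[of V z] by simp
        have "\<bar>f \<epsilon> z\<bar> = (1 + vnorm V z) powr r * ((1 + vnorm V z) powr (- r) * \<bar>f \<epsilon> z\<bar>)"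
          using n by (simp add: powr_minus)
        also have "\<dots> \<le> (1 + vnorm V z) powr r * (C * \<epsilon> powr (- r))"
          using * by (intro mult_left_mono) auto
        also have "\<dots> = C * scale V \<epsilon> z powr r"
          using elim n by (simp add: scale_def powr_divide powr_minus_divide)
        also have "\<dots> \<le> scale V \<epsilon> z powr 1 * scale V \<epsilon> z powr r"
          using S by (intro mult_right_mono) auto
        also have "\<dots> = scale V \<epsilon> z powr (r + 1)" by (simp add: powr_add mult.commute)
        also have "\<dots> \<le> scale V \<epsilon> z powr (real (nat \<lceil>r + 1\<rceil>))"
          using S by (intro powr_mono) linarith+
        also have "\<dots> = scale V \<epsilon> z ^ nat \<lceil>r + 1\<rceil>"
          using S by (intro powr_realpow) auto
        finally show "\<bar>f \<epsilon> z\<bar> \<le> scale V \<epsilon> z ^ nat \<lceil>r + 1\<rceil>" .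
      qed
    qed
  qed
next
  assume "mod_on V (slab W V K) f"
  then obtain r :: nat where ev: "\<forall>\<^sub>F \<epsilon> in at_right 0. \<forall>z\<in>slab W V K. \<bar>f \<epsilon> z\<bar> \<le> scale V \<epsilon> z ^ r"
    unfolding mod_on_def by blast
  have main: "\<forall>\<^sub>F \<epsilon> in at_right 0. wbound W V K (real (Suc r)) (f \<epsilon>) (1 * \<epsilon> powr (- real (Suc r)))"
  proof -
    have "\<forall>\<^sub>F \<epsilon> in at_right (0::real). 0 < \<epsilon> \<and> \<epsilon> < 1" by (rule eventually_small) simp
    with ev show ?thesis
    proof eventually_elim
      case (elim \<epsilon>)
      show ?case unfolding wbound_def
      proof (intro ballI impI)
        fix z assume "z \<in> coord_space (W \<union> V)" "proj W z \<in> K"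
        then have *: "\<bar>f \<epsilon> z\<bar> \<le> scale V \<epsilon> z ^ r" using elim by (auto simp: slab_def)
        have S: "1 \<le> scale V \<epsilon> z" using elim by (intro scale_ge') auto
        have n: "0 < 1 + vnorm V z" using vnorm_nonneg[of V z] by simp
        note *
        also have "scale V \<epsilon> z ^ r \<le> scale V \<epsilon> z ^ Suc r" using S by (intro power_increasing) auto
        also have "\<dots> = scale V \<epsilon> z powr real (Suc r)"
          using S by (subst powr_realpow) auto
        also have "\<dots> = (1 + vnorm V z) powr real (Suc r) * \<epsilon> powr (- real (Suc r))"
          using elim n by (simp add: scale_def powr_divide powr_minus_divide del: of_nat_Suc)
        finally have "(1 + vnorm V z) powr (- real (Suc r)) * \<bar>f \<epsilon> z\<bar> \<le>
          (1 + vnorm V z) powr (- real (Suc r)) * ((1 + vnorm V z) powr real (Suc r) * \<epsilon> powr (- real (Suc r)))"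
          by (intro mult_left_mono) auto
        also have "\<dots> = 1 * \<epsilon> powr (- real (Suc r))"
          using n by (simp add: powr_minus del: of_nat_Suc)
        finally show "(1 + vnorm V z) powr (- real (Suc r)) * \<bar>f \<epsilon> z\<bar> \<le> 1 * \<epsilon> powr (- real (Suc r))" .
      qed
    qed
  qed
  have "real (Suc r) > 0" by simp
  with main show "\<exists>r>0. \<exists>C. \<forall>\<^sub>F \<epsilon> in at_right 0. wbound W V K r (f \<epsilon>) (C * \<epsilon> powr (- r))" by blast
qed

text \<open>For a fixed \<open>\<epsilon>\<close> the scale is a multiple of the weight, so that polynomial boundedness of one function is
  moderateness of a constant net. In this way each estimate has to be proved for nets only.\<close>

lemma mod_on_const_iff_wbound:
  "(\<exists>r>0. \<exists>C. wbound W V K r f C) \<longleftrightarrow> mod_on V (slab W V K) (\<lambda>_. f)"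
proof
  assume "\<exists>r>0. \<exists>C. wbound W V K r f C"
  then obtain r C where r: "r > 0" and b: "wbound W V K r f C" by blast
  have "\<forall>\<^sub>F \<epsilon> in at_right (0::real). 0 < \<epsilon> \<and> \<epsilon> < 1" by (rule eventually_small) simp
  then have "\<forall>\<^sub>F \<epsilon> in at_right 0. wbound W V K r f (\<bar>C\<bar> * \<epsilon> powr (- r))"
  proof eventually_elim
    case (elim \<epsilon>)
    then have "1 \<le> \<epsilon> powr (- r)" using r powr_mono'[of "- r" 0 \<epsilon>] by simp
    then have "\<bar>C\<bar> * 1 \<le> \<bar>C\<bar> * \<epsilon> powr (- r)" by (intro mult_left_mono) auto
    then have "C \<le> \<bar>C\<bar> * \<epsilon> powr (- r)" by simp
    with b show ?case unfolding wbound_def by force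
  qed
  with r have "\<exists>r>0. \<exists>C. \<forall>\<^sub>F \<epsilon> in at_right 0. wbound W V K r f (C * \<epsilon> powr (- r))" by blast
  then show "mod_on V (slab W V K) (\<lambda>_. f)" using mod_on_iff_wbound[of W V K "\<lambda>_. f"] by simp
next
  assume "mod_on V (slab W V K) (\<lambda>_. f)"
  then obtain r C where r: "r > 0" and ev: "\<forall>\<^sub>F \<epsilon> in at_right 0. wbound W V K r f (C * \<epsilon> powr (- r))"
    using mod_on_iff_wbound[of W V K "\<lambda>_. f"] by auto
  from eventually_happens[OF ev] obtain \<epsilon> where "wbound W V K r f (C * \<epsilon> powr (- r))"
    by (auto simp: trivial_limit_at_right_real)
  with r show "\<exists>r>0. \<exists>C. wbound W V K r f C" by blast
qed

lemma neg_on_iff_wbound: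
  "(\<exists>r>0. \<forall>s>0. \<exists>C. \<forall>\<^sub>F \<epsilon> in at_right 0. wbound W V K r (f \<epsilon>) (C * \<epsilon> powr s)) \<longleftrightarrow> neg_on V (slab W V K) f"
proof
  assume "\<exists>r>0. \<forall>s>0. \<exists>C. \<forall>\<^sub>F \<epsilon> in at_right 0. wbound W V K r (f \<epsilon>) (C * \<epsilon> powr s)"
  then obtain r where r: "r > 0"
    and ev: "\<And>s. s > 0 \<Longrightarrow> \<exists>C. \<forall>\<^sub>F \<epsilon> in at_right 0. wbound W V K r (f \<epsilon>) (C * \<epsilon> powr s)" by blast
  have "\<forall>\<^sub>F \<epsilon> in at_right 0. \<forall>z\<in>slab W V K. \<bar>f \<epsilon> z\<bar> \<le> scale V \<epsilon> z ^ nat \<lceil>r\<rceil> * \<epsilon> ^ s" for s :: nat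
  proof -
    obtain C where C: "\<forall>\<^sub>F \<epsilon> in at_right 0. wbound W V K r (f \<epsilon>) (C * \<epsilon> powr (real (Suc s)))"
      using ev[of "real (Suc s)"] by auto
    have "\<forall>\<^sub>F \<epsilon> in at_right (0::real). 0 < \<epsilon> \<and> \<epsilon> < 1 / max 1 C" by (rule eventually_small) simp
    with C show ?thesis
    proof eventually_elim
      case (elim \<epsilon>)
      show ?case
      proof
        fix z assume "z \<in> slab W V K"
        then have *: "(1 + vnorm V z) powr (- r) * \<bar>f \<epsilon> z\<bar> \<le> C * \<epsilon> powr (real (Suc s))"
          using elim by (auto simp: wbound_def slab_def)
        have S: "max 1 C \<le> scale V \<epsilon> z" using elim by (intro scale_ge') auto
        have e: "0 < \<epsilon>" "\<epsilon> \<le> 1" using elim by (auto intro: order.trans[OF less_imp_le])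
        have Ce: "C * \<epsilon> \<le> 1"
        proof -
          have "C * \<epsilon> \<le> max 1 C * \<epsilon>" using e by (intro mult_right_mono) auto
          also have "\<dots> \<le> 1" using elim by (simp add: field_simps)
          finally show ?thesis .
        qed
        have n: "1 \<le> 1 + vnorm V z" using vnorm_nonneg[of V z] by simp
        have le: "1 + vnorm V z \<le> scale V \<epsilon> z"
          using e n vnorm_nonneg[of V z] by (simp add: scale_def pos_le_divide_eq mult_left_le)
        have "\<bar>f \<epsilon> z\<bar> = (1 + vnorm V z) powr r * ((1 + vnorm V z) powr (- r) * \<bar>f \<epsilon> z\<bar>)"
          using n by (simp add: powr_minus)
        also have "\<dots> \<le> (1 + vnorm V z) powr r * (C * \<epsilon> powr (real (Suc s)))"
          using * by (intro mult_left_mono) auto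
        also have "\<epsilon> powr (real (Suc s)) = \<epsilon> ^ Suc s" using e by (intro powr_realpow) auto
        also have "(1 + vnorm V z) powr r * (C * \<epsilon> ^ Suc s) = (1 + vnorm V z) powr r * (C * \<epsilon>) * \<epsilon> ^ s"
          by simp
        also have "\<dots> \<le> (1 + vnorm V z) powr r * 1 * \<epsilon> ^ s"
          using Ce e by (intro mult_right_mono mult_left_mono) auto
        also have "\<dots> \<le> scale V \<epsilon> z powr real (nat \<lceil>r\<rceil>) * 1 * \<epsilon> ^ s"
        proof -
          have "(1 + vnorm V z) powr r \<le> (1 + vnorm V z) powr real (nat \<lceil>r\<rceil>)"
            using n by (intro powr_mono) linarith+
          also have "\<dots> \<le> scale V \<epsilon> z powr real (nat \<lceil>r\<rceil>)" using le n by (intro powr_mono2) auto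
          finally show ?thesis using e by (intro mult_right_mono) auto
        qed
        also have "scale V \<epsilon> z powr real (nat \<lceil>r\<rceil>) = scale V \<epsilon> z ^ nat \<lceil>r\<rceil>"
          using S by (intro powr_realpow) auto
        finally show "\<bar>f \<epsilon> z\<bar> \<le> scale V \<epsilon> z ^ nat \<lceil>r\<rceil> * \<epsilon> ^ s" by simp
      qed
    qed
  qed
  then show "neg_on V (slab W V K) f" unfolding neg_on_def by blast
next
  assume "neg_on V (slab W V K) f"
  then obtain r :: nat where ev: "\<And>s. \<forall>\<^sub>F \<epsilon> in at_right 0. \<forall>z\<in>slab W V K. \<bar>f \<epsilon> z\<bar> \<le> scale V \<epsilon> z ^ r * \<epsilon> ^ s"
    unfolding neg_on_def by blast
  have main: "\<forall>\<^sub>F \<epsilon> in at_right 0. wbound W V K (real (Suc r)) (f \<epsilon>) (1 * \<epsilon> powr s)" if s: "s > 0" for s :: real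
  proof -
    \<comment> \<open>\<open>r\<close> additional powers of \<open>\<epsilon>\<close> turn the scale into the weight\<close>
    define k where "k = nat \<lceil>s\<rceil> + r"
    have "\<forall>\<^sub>F \<epsilon> in at_right (0::real). 0 < \<epsilon> \<and> \<epsilon> < 1" by (rule eventually_small) simp
    with ev[of k] show ?thesis
    proof eventually_elim
      case (elim \<epsilon>)
      show ?case unfolding wbound_def
      proof (intro ballI impI)
        fix z assume "z \<in> coord_space (W \<union> V)" "proj W z \<in> K"
        then have *: "\<bar>f \<epsilon> z\<bar> \<le> scale V \<epsilon> z ^ r * \<epsilon> ^ k" using elim by (auto simp: slab_def)
        have n: "1 \<le> 1 + vnorm V z" using vnorm_nonneg[of V z] by simp
        note *
        also have "scale V \<epsilon> z ^ r * \<epsilon> ^ k = (1 + vnorm V z) ^ r * \<epsilon> ^ nat \<lceil>s\<rceil>"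
          using elim by (simp add: scale_def k_def power_add power_divide)
        also have "\<dots> \<le> (1 + vnorm V z) ^ Suc r * \<epsilon> ^ nat \<lceil>s\<rceil>"
          using n elim by (intro mult_right_mono power_increasing) auto
        also have "\<epsilon> ^ nat \<lceil>s\<rceil> = \<epsilon> powr (real (nat \<lceil>s\<rceil>))" using elim by (subst powr_realpow) auto
        also have "(1 + vnorm V z) ^ Suc r * \<epsilon> powr (real (nat \<lceil>s\<rceil>)) \<le> (1 + vnorm V z) ^ Suc r * \<epsilon> powr s"
          using elim n by (intro mult_left_mono powr_mono') (auto, linarith)
        also have "(1 + vnorm V z) ^ Suc r = (1 + vnorm V z) powr real (Suc r)"
          using n by (subst powr_realpow) auto
        finally have "(1 + vnorm V z) powr (- real (Suc r)) * \<bar>f \<epsilon> z\<bar> \<le>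
          (1 + vnorm V z) powr (- real (Suc r)) * ((1 + vnorm V z) powr real (Suc r) * \<epsilon> powr s)"
          by (intro mult_left_mono) auto
        also have "\<dots> = 1 * \<epsilon> powr s"
          using n by (simp add: powr_minus del: of_nat_Suc)
        finally show "(1 + vnorm V z) powr (- real (Suc r)) * \<bar>f \<epsilon> z\<bar> \<le> 1 * \<epsilon> powr s" .
      qed
    qed
  qed
  have "real (Suc r) > 0" by simp
  with main show "\<exists>r>0. \<forall>s>0. \<exists>C. \<forall>\<^sub>F \<epsilon> in at_right 0. wbound W V K r (f \<epsilon>) (C * \<epsilon> powr s)" by blast
qed

lemma mod_on_le:
  assumes "mod_on V Z v" "\<forall>\<^sub>F \<epsilon> in at_right 0. \<forall>z\<in>Z. \<bar>u \<epsilon> z\<bar> \<le> \<bar>v \<epsilon> z\<bar>"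
  shows "mod_on V Z u"
proof -
  obtain r where "\<forall>\<^sub>F \<epsilon> in at_right 0. \<forall>z\<in>Z. \<bar>v \<epsilon> z\<bar> \<le> scale V \<epsilon> z ^ r"
    using assms(1) by (auto simp: mod_on_def)
  with assms(2) have "\<forall>\<^sub>F \<epsilon> in at_right 0. \<forall>z\<in>Z. \<bar>u \<epsilon> z\<bar> \<le> scale V \<epsilon> z ^ r"
    by eventually_elim (meson order.trans)
  then show ?thesis by (auto simp: mod_on_def)
qed

lemma mod_on_cong:
  assumes "\<And>\<epsilon> z. \<epsilon> \<in> {0<..1} \<Longrightarrow> z \<in> Z \<Longrightarrow> u \<epsilon> z = v \<epsilon> z"
  shows "mod_on V Z u \<longleftrightarrow> mod_on V Z v"
proof -
  have "\<forall>\<^sub>F \<epsilon> in at_right (0::real). 0 < \<epsilon> \<and> \<epsilon> < 1" by (rule eventually_small) simp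
  then have "\<forall>\<^sub>F \<epsilon> in at_right 0. \<forall>z\<in>Z. u \<epsilon> z = v \<epsilon> z"
    by eventually_elim (auto intro: assms)
  then have "\<forall>\<^sub>F \<epsilon> in at_right 0. \<forall>z\<in>Z. \<bar>u \<epsilon> z\<bar> \<le> \<bar>v \<epsilon> z\<bar>" "\<forall>\<^sub>F \<epsilon> in at_right 0. \<forall>z\<in>Z. \<bar>v \<epsilon> z\<bar> \<le> \<bar>u \<epsilon> z\<bar>"
    by (auto elim: eventually_mono)
  then show ?thesis using mod_on_le by blast
qed

lemma mod_on_const: "mod_on V Z (\<lambda>_ _. a)"
proof -
  have "\<forall>\<^sub>F \<epsilon> in at_right (0::real). 0 < \<epsilon> \<and> \<epsilon> < 1 / (\<bar>a\<bar> + 1)" by (rule eventually_small) simp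
  then have "\<forall>\<^sub>F \<epsilon> in at_right 0. \<forall>z\<in>Z. \<bar>a\<bar> \<le> scale V \<epsilon> z ^ 1"
  proof eventually_elim
    case (elim \<epsilon>)
    then have "\<bar>a\<bar> + 1 \<le> scale V \<epsilon> z" for z by (intro scale_ge') auto
    then have "\<bar>a\<bar> \<le> scale V \<epsilon> z" for z by (smt (verit))
    then show ?case by simp
  qed
  then show ?thesis unfolding mod_on_def by blast
qed

lemma mod_on_coord:
  assumes "finite V" "c \<in> V"
  shows "mod_on V Z (\<lambda>_ z. z c)"
proof -
  have "\<forall>\<^sub>F \<epsilon> in at_right (0::real). 0 < \<epsilon> \<and> \<epsilon> < 1" by (rule eventually_small) simp
  then have "\<forall>\<^sub>F \<epsilon> in at_right 0. \<forall>z\<in>Z. \<bar>z c\<bar> \<le> scale V \<epsilon> z ^ 1"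
  proof eventually_elim
    case (elim \<epsilon>)
    have "\<bar>z c\<bar> \<le> scale V \<epsilon> z" for z
    proof -
      have "\<bar>z c\<bar> \<le> vnorm V z"
        using member_le_L2_set[OF assms, of "\<lambda>c. \<bar>z c\<bar>"] by (simp add: vnorm_def L2_set_def)
      also have "\<dots> \<le> scale V \<epsilon> z"
        using elim vnorm_nonneg[of V z] mult_left_le[of \<epsilon> "vnorm V z"]
        by (simp add: scale_def pos_le_divide_eq)
      finally show ?thesis .
    qed
    then show ?case by auto
  qed
  then show ?thesis unfolding mod_on_def by blast
qed

lemma mod_on_bounded:
  assumes "\<And>z. z \<in> Z \<Longrightarrow> \<bar>f z\<bar> \<le> a"
  shows "mod_on V Z (\<lambda>_. f)"
proof (rule mod_on_le[OF mod_on_const[of V Z a]])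
  show "\<forall>\<^sub>F \<epsilon> in at_right 0. \<forall>z\<in>Z. \<bar>f z\<bar> \<le> \<bar>a\<bar>"
    using order.trans[OF assms abs_ge_self] by (intro always_eventually) blast
qed

lemma mod_on_coord_slab:
  assumes V: "finite V" and K: "compact K" and c: "c \<in> W \<union> V"
  shows "mod_on V (slab W V K) (\<lambda>_ z. z c)"
proof (cases "c \<in> V")
  case False
  have "compact ((\<lambda>w. w c) ` K)"
    using K by (intro compact_continuous_image continuous_on_subset[OF continuous_on_product_coordinates]) auto
  then obtain a where a: "\<And>w. w \<in> K \<Longrightarrow> \<bar>w c\<bar> \<le> a"
    using compact_imp_bounded[of "(\<lambda>w. w c) ` K"] by (auto simp: bounded_iff)
  show ?thesis
  proof (rule mod_on_bounded)
    fix z assume "z \<in> slab W V K"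
    then show "\<bar>z c\<bar> \<le> a" using a[of "proj W z"] c False by (auto simp: slab_def proj_def)
  qed
qed (rule mod_on_coord[OF V])

lemma scale_power_mono: "1 \<le> scale V \<epsilon> z \<Longrightarrow> a \<le> b \<Longrightarrow> scale V \<epsilon> z ^ a \<le> scale V \<epsilon> z ^ b"
  by (rule power_increasing) auto

lemma mod_on_add:
  assumes "mod_on V Z u" "mod_on V Z v"
  shows "mod_on V Z (\<lambda>\<epsilon> z. u \<epsilon> z + v \<epsilon> z)"
proof -
  obtain r s where "\<forall>\<^sub>F \<epsilon> in at_right 0. \<forall>z\<in>Z. \<bar>u \<epsilon> z\<bar> \<le> scale V \<epsilon> z ^ r"
    "\<forall>\<^sub>F \<epsilon> in at_right 0. \<forall>z\<in>Z. \<bar>v \<epsilon> z\<bar> \<le> scale V \<epsilon> z ^ s"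
    using assms by (auto simp: mod_on_def)
  moreover have "\<forall>\<^sub>F \<epsilon> in at_right (0::real). 0 < \<epsilon> \<and> \<epsilon> < 1 / 2" by (rule eventually_small) simp
  ultimately have "\<forall>\<^sub>F \<epsilon> in at_right 0. \<forall>z\<in>Z. \<bar>u \<epsilon> z + v \<epsilon> z\<bar> \<le> scale V \<epsilon> z ^ (max r s + 1)"
  proof eventually_elim
    case (elim \<epsilon>)
    show ?case
    proof
      fix z assume z: "z \<in> Z"
      have S: "2 \<le> scale V \<epsilon> z" using elim by (intro scale_ge') auto
      then have "scale V \<epsilon> z ^ r \<le> scale V \<epsilon> z ^ max r s" "scale V \<epsilon> z ^ s \<le> scale V \<epsilon> z ^ max r s"
        by (auto intro!: scale_power_mono)
      then have "\<bar>u \<epsilon> z + v \<epsilon> z\<bar> \<le> 2 * scale V \<epsilon> z ^ max r s" using elim z by (smt (verit) abs_triangle_ineq)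
      also have "\<dots> \<le> scale V \<epsilon> z * scale V \<epsilon> z ^ max r s" using S by (intro mult_right_mono) auto
      finally show "\<bar>u \<epsilon> z + v \<epsilon> z\<bar> \<le> scale V \<epsilon> z ^ (max r s + 1)" by simp
    qed
  qed
  then show ?thesis unfolding mod_on_def by blast
qed

lemma mod_on_mult:
  assumes "mod_on V Z u" "mod_on V Z v"
  shows "mod_on V Z (\<lambda>\<epsilon> z. u \<epsilon> z * v \<epsilon> z)"
proof -
  obtain r s where "\<forall>\<^sub>F \<epsilon> in at_right 0. \<forall>z\<in>Z. \<bar>u \<epsilon> z\<bar> \<le> scale V \<epsilon> z ^ r"
    "\<forall>\<^sub>F \<epsilon> in at_right 0. \<forall>z\<in>Z. \<bar>v \<epsilon> z\<bar> \<le> scale V \<epsilon> z ^ s"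
    using assms by (auto simp: mod_on_def)
  then have "\<forall>\<^sub>F \<epsilon> in at_right 0. \<forall>z\<in>Z. \<bar>u \<epsilon> z * v \<epsilon> z\<bar> \<le> scale V \<epsilon> z ^ (r + s)"
    by eventually_elim (simp add: abs_mult power_add mult_mono')
  then show ?thesis unfolding mod_on_def by blast
qed

lemma mod_on_sum:
  "finite A \<Longrightarrow> (\<And>i. i \<in> A \<Longrightarrow> mod_on V Z (u i)) \<Longrightarrow> mod_on V Z (\<lambda>\<epsilon> z. \<Sum>i\<in>A. u i \<epsilon> z)"
  by (induction A rule: finite_induct) (auto intro: mod_on_add mod_on_const)

lemma mod_on_abs: "mod_on V Z u \<Longrightarrow> mod_on V Z (\<lambda>\<epsilon> z. \<bar>u \<epsilon> z\<bar>)"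
  by (erule mod_on_le) auto

lemma vnorm_le_sum_abs: "vnorm V z \<le> (\<Sum>c\<in>V. \<bar>z c\<bar>)"
  by (simp add: vnorm_def L2_set_le_sum_abs)

text \<open>A moderate substitution turns the scale at most into a power of the scale. The bound is stated for all
  points dominated by the image, so that it covers the segment between two images as well.\<close>

lemma mod_on_scale_comp:
  assumes V': "finite V'" and m: "\<And>c. c \<in> V' \<Longrightarrow> mod_on V Z (\<lambda>\<epsilon> z. m \<epsilon> z c)"
  shows "\<exists>q. \<forall>\<^sub>F \<epsilon> in at_right 0. \<forall>z\<in>Z. \<forall>p. (\<forall>c\<in>V'. \<bar>p c\<bar> \<le> \<bar>m \<epsilon> z c\<bar>) \<longrightarrow> scale V' \<epsilon> p \<le> scale V \<epsilon> z ^ q"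
proof -
  have "mod_on V Z (\<lambda>\<epsilon> z. 1 + (\<Sum>c\<in>V'. \<bar>m \<epsilon> z c\<bar>))"
    by (intro mod_on_add mod_on_const mod_on_sum V' mod_on_abs m)
  then obtain q where "\<forall>\<^sub>F \<epsilon> in at_right 0. \<forall>z\<in>Z. \<bar>1 + (\<Sum>c\<in>V'. \<bar>m \<epsilon> z c\<bar>)\<bar> \<le> scale V \<epsilon> z ^ q"
    by (auto simp: mod_on_def)
  moreover have "\<forall>\<^sub>F \<epsilon> in at_right (0::real). 0 < \<epsilon> \<and> \<epsilon> < 1" by (rule eventually_small) simp
  ultimately have "\<forall>\<^sub>F \<epsilon> in at_right 0. \<forall>z\<in>Z. \<forall>p. (\<forall>c\<in>V'. \<bar>p c\<bar> \<le> \<bar>m \<epsilon> z c\<bar>) \<longrightarrow> scale V' \<epsilon> p \<le> scale V \<epsilon> z ^ (q + 1)"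
  proof eventually_elim
    case (elim \<epsilon>)
    show ?case
    proof (intro ballI allI impI)
      fix z p assume z: "z \<in> Z" and p: "\<forall>c\<in>V'. \<bar>p c\<bar> \<le> \<bar>m \<epsilon> z c\<bar>"
      have "1 + vnorm V' p \<le> 1 + (\<Sum>c\<in>V'. \<bar>m \<epsilon> z c\<bar>)"
        using vnorm_le_sum_abs[of V' p] sum_mono[of V' "\<lambda>c. \<bar>p c\<bar>" "\<lambda>c. \<bar>m \<epsilon> z c\<bar>"] p by force
      also have "\<dots> \<le> scale V \<epsilon> z ^ q" using elim z by (metis abs_ge_self order.trans)
      finally have "(1 + vnorm V' p) * (1 / \<epsilon>) \<le> scale V \<epsilon> z ^ q * scale V \<epsilon> z"
        using elim scale_ge[of \<epsilon> V z] vnorm_nonneg[of V' p] by (intro mult_mono) auto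
      then show "scale V' \<epsilon> p \<le> scale V \<epsilon> z ^ (q + 1)"
        by (simp only: scale_def[of V'] power_add power_one_right times_divide_eq_right mult_1_right)
    qed
  qed
  then show ?thesis by blast
qed

lemma mod_on_comp:
  assumes f: "mod_on V' Z' f" and V': "finite V'" and m: "\<And>c. c \<in> V' \<Longrightarrow> mod_on V Z (\<lambda>\<epsilon> z. m \<epsilon> z c)"
    and Z': "\<And>\<epsilon> z. \<epsilon> \<in> {0<..1} \<Longrightarrow> z \<in> Z \<Longrightarrow> m \<epsilon> z \<in> Z'"
  shows "mod_on V Z (\<lambda>\<epsilon> z. f \<epsilon> (m \<epsilon> z))"
proof -
  obtain q where q: "\<forall>\<^sub>F \<epsilon> in at_right 0. \<forall>z\<in>Z. \<forall>p. (\<forall>c\<in>V'. \<bar>p c\<bar> \<le> \<bar>m \<epsilon> z c\<bar>) \<longrightarrow> scale V' \<epsilon> p \<le> scale V \<epsilon> z ^ q"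
    using mod_on_scale_comp[OF V', of V Z m] m by blast
  obtain r where r: "\<forall>\<^sub>F \<epsilon> in at_right 0. \<forall>z\<in>Z'. \<bar>f \<epsilon> z\<bar> \<le> scale V' \<epsilon> z ^ r"
    using f by (auto simp: mod_on_def)
  have "\<forall>\<^sub>F \<epsilon> in at_right (0::real). 0 < \<epsilon> \<and> \<epsilon> < 1" by (rule eventually_small) simp
  with q r have "\<forall>\<^sub>F \<epsilon> in at_right 0. \<forall>z\<in>Z. \<bar>f \<epsilon> (m \<epsilon> z)\<bar> \<le> scale V \<epsilon> z ^ (q * r)"
  proof eventually_elim
    case (elim \<epsilon>)
    show ?case
    proof
      fix z assume z: "z \<in> Z"
      have "\<bar>f \<epsilon> (m \<epsilon> z)\<bar> \<le> scale V' \<epsilon> (m \<epsilon> z) ^ r" using elim z Z'[of \<epsilon> z] by auto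
      also have "\<dots> \<le> (scale V \<epsilon> z ^ q) ^ r"
        using elim z vnorm_nonneg[of V' "m \<epsilon> z"] by (intro power_mono) (auto simp: scale_def)
      finally show "\<bar>f \<epsilon> (m \<epsilon> z)\<bar> \<le> scale V \<epsilon> z ^ (q * r)" by (simp add: power_mult)
    qed
  qed
  then show ?thesis unfolding mod_on_def by blast
qed

section \<open>The algebra of tempered nets\<close>

text \<open>The requirements of moderateness on the net itself, without those on its derivatives.\<close>

definition tempered :: "coord set \<Rightarrow> coord set \<Rightarrow> net \<Rightarrow> bool" where
  "tempered W V u \<longleftrightarrow> (\<forall>\<epsilon>\<in>{0<..1}. continuous_on (coord_space (W \<union> V)) (u \<epsilon>)) \<and>
     (\<forall>K. compact K \<and> K \<subseteq> coord_space W \<longrightarrow>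
        mod_on V (slab W V K) u \<and> (\<forall>\<epsilon>\<in>{0<..1}. mod_on V (slab W V K) (\<lambda>_. u \<epsilon>)))"

lemma Etau_iff:
  "u \<in> Etau W V \<longleftrightarrow>
     (\<forall>\<epsilon>\<in>{0<..1}. smooth (W \<union> V) (u \<epsilon>)) \<and> (\<forall>cs\<in>lists (W \<union> V). tempered W V (\<lambda>\<epsilon>. pds cs (u \<epsilon>)))"
  (is "?L \<longleftrightarrow> ?R")
proof
  assume ?L
  then show ?R
    unfolding Etau_def OM_def tempered_def mod_on_iff_wbound mod_on_const_iff_wbound
    by (auto simp: smooth_def)
next
  assume ?R
  then show ?L
    unfolding Etau_def OM_def tempered_def mod_on_iff_wbound mod_on_const_iff_wbound
    by auto
qed

lemma Etau_has_partial:
  assumes "u \<in> Etau W V" "\<epsilon> \<in> {0<..1}" "c \<in> W \<union> V" "z \<in> coord_space (W \<union> V)"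
  shows "has_partial c (u \<epsilon>) (pd c (u \<epsilon>)) z"
  using smooth_has_partial[of "W \<union> V" "u \<epsilon>" "[]" c z] assms by (auto simp: Etau_iff)

lemma Etau_tempered: "u \<in> Etau W V \<Longrightarrow> tempered W V u"
  unfolding Etau_iff by (auto dest: bspec[of _ _ "[]"])

lemma Etau_smooth: "u \<in> Etau W V \<Longrightarrow> \<epsilon> \<in> {0<..1} \<Longrightarrow> smooth (W \<union> V) (u \<epsilon>)"
  by (auto simp: Etau_iff)

lemma Etau_continuous: "u \<in> Etau W V \<Longrightarrow> \<epsilon> \<in> {0<..1} \<Longrightarrow> continuous_on (coord_space (W \<union> V)) (u \<epsilon>)"
  using Etau_tempered by (auto simp: tempered_def)

lemma tempered_cong:
  assumes "tempered W V u" and eq: "\<And>\<epsilon> z. \<epsilon> \<in> {0<..1} \<Longrightarrow> z \<in> coord_space (W \<union> V) \<Longrightarrow> v \<epsilon> z = u \<epsilon> z"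
  shows "tempered W V v"
proof -
  have "continuous_on (coord_space (W \<union> V)) (v \<epsilon>) = continuous_on (coord_space (W \<union> V)) (u \<epsilon>)" if "\<epsilon> \<in> {0<..1}" for \<epsilon>
    using that by (intro continuous_on_cong) (auto simp: eq)
  moreover have "mod_on V (slab W V K) v = mod_on V (slab W V K) u" for K
    by (rule mod_on_cong) (auto simp: eq slab_def)
  moreover have "mod_on V (slab W V K) (\<lambda>_. v \<epsilon>) = mod_on V (slab W V K) (\<lambda>_. u \<epsilon>)" if "\<epsilon> \<in> {0<..1}" for K \<epsilon>
    by (rule mod_on_cong) (use that in \<open>auto simp: eq slab_def\<close>)
  ultimately show ?thesis using assms(1) by (auto simp: tempered_def)
qed

text \<open>Moderateness of all derivatives follows from estimates of order zero for a class of nets that is closed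
  under partial derivatives. This replaces Leibniz and Faa di Bruno formulas: a closure property of moderate
  nets only needs a class in which derivatives can be formed once.\<close>

lemma Etau_coinduct:
  assumes "u \<in> F"
    and temp: "\<And>u. u \<in> F \<Longrightarrow> tempered W V u"
    and step: "\<And>u c. u \<in> F \<Longrightarrow> c \<in> W \<union> V \<Longrightarrow> \<exists>v\<in>F. \<forall>\<epsilon>\<in>{0<..1}. \<forall>z\<in>coord_space (W \<union> V). has_partial c (u \<epsilon>) (v \<epsilon>) z"
  shows "u \<in> Etau W V"
proof -
  have pds: "\<exists>v\<in>F. \<forall>\<epsilon>\<in>{0<..1}. \<forall>z\<in>coord_space (W \<union> V). pds cs (u \<epsilon>) z = v \<epsilon> z" if "cs \<in> lists (W \<union> V)" for cs
    using that
  proof (induction cs)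
    case Nil
    show ?case using \<open>u \<in> F\<close> by (intro bexI[of _ u]) auto
  next
    case (Cons c cs)
    then obtain v where v: "v \<in> F" "\<And>\<epsilon> z. \<epsilon> \<in> {0<..1} \<Longrightarrow> z \<in> coord_space (W \<union> V) \<Longrightarrow> pds cs (u \<epsilon>) z = v \<epsilon> z"
      by auto
    from step[OF v(1), of c] Cons.hyps obtain v' where v': "v' \<in> F"
      "\<And>\<epsilon> z. \<epsilon> \<in> {0<..1} \<Longrightarrow> z \<in> coord_space (W \<union> V) \<Longrightarrow> has_partial c (v \<epsilon>) (v' \<epsilon>) z" by auto
    have "pds (c # cs) (u \<epsilon>) z = v' \<epsilon> z" if "\<epsilon> \<in> {0<..1}" "z \<in> coord_space (W \<union> V)" for \<epsilon> z
      using pd_cong[of "W \<union> V" "pds cs (u \<epsilon>)" "v \<epsilon>" c z] v(2) Cons.hyps that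
        has_partial_imp_pd[OF v'(2)[OF that]] by auto
    with v'(1) show ?case by blast
  qed
  have temp': "tempered W V (\<lambda>\<epsilon>. pds cs (u \<epsilon>))" if "cs \<in> lists (W \<union> V)" for cs
    using pds[OF that] temp tempered_cong by (metis (no_types, lifting))
  have "smooth (W \<union> V) (u \<epsilon>)" if \<epsilon>: "\<epsilon> \<in> {0<..1}" for \<epsilon>
    unfolding smooth_def
  proof (intro ballI conjI)
    fix cs assume cs: "cs \<in> lists (W \<union> V)"
    show "continuous_on (coord_space (W \<union> V)) (pds cs (u \<epsilon>))"
      using temp'[OF cs] \<epsilon> by (auto simp: tempered_def)
    fix c z assume c: "c \<in> W \<union> V" and z: "z \<in> coord_space (W \<union> V)"
    obtain v where v: "v \<in> F" "\<And>z. z \<in> coord_space (W \<union> V) \<Longrightarrow> pds cs (u \<epsilon>) z = v \<epsilon> z"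
      using pds[OF cs] \<epsilon> by auto
    from step[OF v(1) c] \<epsilon> z obtain v' where "has_partial c (v \<epsilon>) v' z" by metis
    moreover have "(\<lambda>t. pds cs (u \<epsilon>) (z(c := t))) = (\<lambda>t. v \<epsilon> (z(c := t)))"
      using v(2) coord_space_upd[OF z c] by auto
    ultimately show "(\<lambda>t. pds cs (u \<epsilon>) (z(c := t))) differentiable (at (z c))"
      by (auto simp: has_partial_def real_differentiable_def)
  qed
  with temp' show ?thesis by (auto simp: Etau_iff)
qed

lemma Etau_pd:
  assumes "u \<in> Etau W V" "c \<in> W \<union> V"
  shows "(\<lambda>\<epsilon>. pd c (u \<epsilon>)) \<in> Etau W V"
proof -
  have "smooth (W \<union> V) (pd c (u \<epsilon>))" if "\<epsilon> \<in> {0<..1}" for \<epsilon>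
    using Etau_smooth[OF assms(1) that] assms(2) unfolding smooth_def
    by (metis append_in_lists_conv lists.simps pds_append)
  moreover have "tempered W V (\<lambda>\<epsilon>. pds cs (pd c (u \<epsilon>)))" if "cs \<in> lists (W \<union> V)" for cs
    using assms that by (auto simp: Etau_iff simp flip: pds_append)
  ultimately show ?thesis by (auto simp: Etau_iff)
qed


lemma Etau_cong:
  assumes "u \<in> Etau W V" and eq: "\<And>\<epsilon> z. \<epsilon> \<in> {0<..1} \<Longrightarrow> z \<in> coord_space (W \<union> V) \<Longrightarrow> v \<epsilon> z = u \<epsilon> z"
  shows "v \<in> Etau W V"
proof (rule Etau_coinduct[where F = "{v. \<exists>u\<in>Etau W V. \<forall>\<epsilon>\<in>{0<..1}. \<forall>z\<in>coord_space (W \<union> V). v \<epsilon> z = u \<epsilon> z}"])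
  show "v \<in> {v. \<exists>u\<in>Etau W V. \<forall>\<epsilon>\<in>{0<..1}. \<forall>z\<in>coord_space (W \<union> V). v \<epsilon> z = u \<epsilon> z}"
    using assms by auto
next
  fix v assume "v \<in> {v. \<exists>u\<in>Etau W V. \<forall>\<epsilon>\<in>{0<..1}. \<forall>z\<in>coord_space (W \<union> V). v \<epsilon> z = u \<epsilon> z}"
  then obtain u where u: "u \<in> Etau W V" "\<And>\<epsilon> z. \<epsilon> \<in> {0<..1} \<Longrightarrow> z \<in> coord_space (W \<union> V) \<Longrightarrow> v \<epsilon> z = u \<epsilon> z"
    by auto
  show "tempered W V v" using tempered_cong[OF Etau_tempered[OF u(1)] u(2)] .
  fix c assume c: "c \<in> W \<union> V"
  have "has_partial c (v \<epsilon>) (pd c (u \<epsilon>)) z" if "\<epsilon> \<in> {0<..1}" "z \<in> coord_space (W \<union> V)" for \<epsilon> z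
  proof -
    have "(\<lambda>t. v \<epsilon> (z(c := t))) = (\<lambda>t. u \<epsilon> (z(c := t)))"
      using u(2) that coord_space_upd[OF that(2) c] by auto
    then show ?thesis using Etau_has_partial[OF u(1) that(1) c that(2)] by (simp add: has_partial_def)
  qed
  with Etau_pd[OF u(1) c]
  show "\<exists>w\<in>{v. \<exists>u\<in>Etau W V. \<forall>\<epsilon>\<in>{0<..1}. \<forall>z\<in>coord_space (W \<union> V). v \<epsilon> z = u \<epsilon> z}.
      \<forall>\<epsilon>\<in>{0<..1}. \<forall>z\<in>coord_space (W \<union> V). has_partial c (v \<epsilon>) (w \<epsilon>) z"
    by (intro bexI[of _ "\<lambda>\<epsilon>. pd c (u \<epsilon>)"]) auto
qed

text \<open>Maps along which moderate nets can be pulled back. Since estimates are uniform in the parameters only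
  on compact sets, the parameters of the image must stay in a compact set.\<close>

definition tempered_map :: "coord set \<Rightarrow> coord set \<Rightarrow> coord set \<Rightarrow> coord set \<Rightarrow> vnet \<Rightarrow> bool" where
  "tempered_map W V W' V' m \<longleftrightarrow>
     (\<forall>\<epsilon>\<in>{0<..1}. \<forall>z\<in>coord_space (W \<union> V). m \<epsilon> z \<in> coord_space (W' \<union> V')) \<and>
     (\<forall>c\<in>W' \<union> V'. (\<lambda>\<epsilon> z. m \<epsilon> z c) \<in> Etau W V) \<and>
     (\<forall>K. compact K \<and> K \<subseteq> coord_space W \<longrightarrow> (\<exists>K'. compact K' \<and> K' \<subseteq> coord_space W' \<and>
        (\<forall>\<epsilon>\<in>{0<..1}. \<forall>z\<in>slab W V K. proj W' (m \<epsilon> z) \<in> K')))"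

text \<open>A class to which the coinduction principle applies, since the product and chain rules stay inside it.\<close>

inductive_set tempered_algebra :: "coord set \<Rightarrow> coord set \<Rightarrow> net set" for W V where
  base: "u \<in> Etau W V \<Longrightarrow> u \<in> tempered_algebra W V"
| const: "(\<lambda>_ _. a) \<in> tempered_algebra W V"
| coord: "c \<in> W \<union> V \<Longrightarrow> (\<lambda>_ z. z c) \<in> tempered_algebra W V"
| add: "u \<in> tempered_algebra W V \<Longrightarrow> v \<in> tempered_algebra W V \<Longrightarrow> (\<lambda>\<epsilon> z. u \<epsilon> z + v \<epsilon> z) \<in> tempered_algebra W V"
| mult: "u \<in> tempered_algebra W V \<Longrightarrow> v \<in> tempered_algebra W V \<Longrightarrow> (\<lambda>\<epsilon> z. u \<epsilon> z * v \<epsilon> z) \<in> tempered_algebra W V"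
| comp: "tempered_map W V W' V' m \<Longrightarrow> finite (W' \<union> V') \<Longrightarrow> f \<in> Etau W' V' \<Longrightarrow> (\<lambda>\<epsilon> z. f \<epsilon> (m \<epsilon> z)) \<in> tempered_algebra W V"

lemma tempered_algebra_sum:
  "finite A \<Longrightarrow> (\<And>i. i \<in> A \<Longrightarrow> u i \<in> tempered_algebra W V) \<Longrightarrow> (\<lambda>\<epsilon> z. \<Sum>i\<in>A. u i \<epsilon> z) \<in> tempered_algebra W V"
  by (induction A rule: finite_induct) (auto intro: tempered_algebra.add tempered_algebra.const)

lemma continuous_on_point:
  assumes "\<And>c. c \<in> V \<Longrightarrow> continuous_on S (\<lambda>z. m z c)" "\<And>z. z \<in> S \<Longrightarrow> m z \<in> coord_space V"
  shows "continuous_on S m"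
proof (rule continuous_on_coordinatewise_then_product)
  fix c show "continuous_on S (\<lambda>z. m z c)"
  proof (cases "c \<in> V")
    case False
    then have "continuous_on S (\<lambda>z. m z c) = continuous_on S (\<lambda>z. 0 :: real)"
      using assms(2) by (intro continuous_on_cong) (auto simp: coord_space_def)
    then show ?thesis by simp
  qed (rule assms)
qed

lemma tempered_comp:
  assumes m: "tempered_map W V W' V' m" and V': "finite (W' \<union> V')" and f: "f \<in> Etau W' V'"
  shows "tempered W V (\<lambda>\<epsilon> z. f \<epsilon> (m \<epsilon> z))"
  unfolding tempered_def
proof (intro conjI ballI allI impI)
  fix \<epsilon> :: real assume \<epsilon>: "\<epsilon> \<in> {0<..1}"
  show "continuous_on (coord_space (W \<union> V)) (\<lambda>z. f \<epsilon> (m \<epsilon> z))"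
  proof (rule continuous_on_compose2[OF Etau_continuous[OF f \<epsilon>]])
    show "continuous_on (coord_space (W \<union> V)) (m \<epsilon>)"
    proof (rule continuous_on_point[of "W' \<union> V'"])
      show "continuous_on (coord_space (W \<union> V)) (\<lambda>z. m \<epsilon> z c)" if "c \<in> W' \<union> V'" for c
        using Etau_continuous[of "\<lambda>\<epsilon> z. m \<epsilon> z c" W V \<epsilon>] m \<epsilon> that by (auto simp: tempered_map_def)
    qed (use m \<epsilon> in \<open>auto simp: tempered_map_def\<close>)
  qed (use m \<epsilon> in \<open>auto simp: tempered_map_def\<close>)
next
  fix K assume K: "compact K \<and> K \<subseteq> coord_space W"
  then obtain K' where K': "compact K'" "K' \<subseteq> coord_space W'"
    "\<And>\<epsilon> z. \<epsilon> \<in> {0<..1} \<Longrightarrow> z \<in> slab W V K \<Longrightarrow> proj W' (m \<epsilon> z) \<in> K'"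
    using m by (auto simp: tempered_map_def)
  have m_slab: "m \<epsilon> z \<in> slab W' V' K'" if "\<epsilon> \<in> {0<..1}" "z \<in> slab W V K" for \<epsilon> z
    using m that K'(3)[OF that] by (auto simp: tempered_map_def slab_def)
  have m_mod: "mod_on V (slab W V K) (\<lambda>\<epsilon> z. m \<epsilon> z c)" "\<epsilon> \<in> {0<..1} \<Longrightarrow> mod_on V (slab W V K) (\<lambda>_ z. m \<epsilon> z c)"
    if "c \<in> V'" for c \<epsilon>
    using m that K Etau_tempered[of "\<lambda>\<epsilon> z. m \<epsilon> z c" W V] by (auto simp: tempered_map_def tempered_def)
  have f_mod: "mod_on V' (slab W' V' K') f" "\<epsilon> \<in> {0<..1} \<Longrightarrow> mod_on V' (slab W' V' K') (\<lambda>_. f \<epsilon>)" for \<epsilon>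
    using Etau_tempered[OF f] K' by (auto simp: tempered_def)
  show "mod_on V (slab W V K) (\<lambda>\<epsilon> z. f \<epsilon> (m \<epsilon> z))"
    using V' by (intro mod_on_comp[OF f_mod(1)] m_mod m_slab) auto
  fix \<epsilon> :: real assume \<epsilon>: "\<epsilon> \<in> {0<..1}"
  show "mod_on V (slab W V K) (\<lambda>_ z. f \<epsilon> (m \<epsilon> z))"
    using V' \<epsilon> by (intro mod_on_comp[OF f_mod(2)[OF \<epsilon>], where m = "\<lambda>_. m \<epsilon>"] m_mod m_slab) auto
qed

lemma has_partial_comp:
  assumes m: "tempered_map W V W' V' m" and V': "finite (W' \<union> V')" and f: "f \<in> Etau W' V'"
    and \<epsilon>: "\<epsilon> \<in> {0<..1}" and c: "c \<in> W \<union> V" and z: "z \<in> coord_space (W \<union> V)"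
  shows "has_partial c (\<lambda>z. f \<epsilon> (m \<epsilon> z))
    (\<lambda>z. \<Sum>d\<in>W' \<union> V'. pd d (f \<epsilon>) (m \<epsilon> z) * pd c (\<lambda>z. m \<epsilon> z d) z) z"
proof -
  have "((\<lambda>t. f \<epsilon> (m \<epsilon> (z(c := t)))) has_real_derivative
      (\<Sum>d\<in>W' \<union> V'. pd d (f \<epsilon>) (m \<epsilon> (z(c := z c))) * pd c (\<lambda>z. m \<epsilon> z d) z)) (at (z c))"
  proof (rule chain_rule_curve[OF V'])
    fix d assume d: "d \<in> W' \<union> V'"
    show "continuous_on (coord_space (W' \<union> V')) (pd d (f \<epsilon>))"
      using Etau_continuous[OF Etau_pd[OF f d] \<epsilon>] .
    show "has_partial d (f \<epsilon>) (pd d (f \<epsilon>)) y" if "y \<in> coord_space (W' \<union> V')" for y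
      using Etau_has_partial[OF f \<epsilon> d that] .
    show "((\<lambda>t. m \<epsilon> (z(c := t)) d) has_real_derivative pd c (\<lambda>z. m \<epsilon> z d) z) (at (z c))"
      using Etau_has_partial[of "\<lambda>\<epsilon> z. m \<epsilon> z d" W V \<epsilon> c z] m \<epsilon> c z d by (auto simp: tempered_map_def has_partial_def)
  next
    show "m \<epsilon> (z(c := t)) \<in> coord_space (W' \<union> V')" for t
      using m \<epsilon> coord_space_upd[OF z c] by (auto simp: tempered_map_def)
  qed
  then show ?thesis by (simp add: has_partial_def)
qed

lemma tempered_algebra_moderate:
  assumes W: "finite W" and V: "finite V" and u: "u \<in> tempered_algebra W V"
  shows "u \<in> Etau W V"
proof (rule Etau_coinduct[OF u])
  fix u assume "u \<in> tempered_algebra W V"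
  then show "tempered W V u"
  proof induction
    case (comp W' V' m f)
    then show ?case by (rule tempered_comp)
  next
    case (coord c)
    then show ?case using V
      by (auto simp: tempered_def intro!: mod_on_coord_slab continuous_on_subset[OF continuous_on_product_coordinates])
  qed (auto simp: tempered_def Etau_tempered[unfolded tempered_def] intro: mod_on_const mod_on_add mod_on_mult continuous_intros)
next
  fix u c assume c: "c \<in> W \<union> V"
  assume "u \<in> tempered_algebra W V"
  then show "\<exists>v\<in>tempered_algebra W V. \<forall>\<epsilon>\<in>{0<..1}. \<forall>z\<in>coord_space (W \<union> V). has_partial c (u \<epsilon>) (v \<epsilon>) z"
  proof induction
    case (base u)
    then show ?case
      using Etau_pd[OF base c] Etau_has_partial[OF base _ c] tempered_algebra.base
      by (intro bexI[of _ "\<lambda>\<epsilon>. pd c (u \<epsilon>)"]) auto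
  next
    case (const a)
    show ?case by (rule bexI[OF _ tempered_algebra.const[of 0]]) (auto simp: has_partial_def)
  next
    case (coord d)
    show ?case by (rule bexI[OF _ tempered_algebra.const[of "if c = d then 1 else 0"]])
        (auto simp: has_partial_def)
  next
    case (add u v)
    then obtain u' v' where "u' \<in> tempered_algebra W V" "v' \<in> tempered_algebra W V"
      "\<And>\<epsilon> z. \<epsilon> \<in> {0<..1} \<Longrightarrow> z \<in> coord_space (W \<union> V) \<Longrightarrow> has_partial c (u \<epsilon>) (u' \<epsilon>) z"
      "\<And>\<epsilon> z. \<epsilon> \<in> {0<..1} \<Longrightarrow> z \<in> coord_space (W \<union> V) \<Longrightarrow> has_partial c (v \<epsilon>) (v' \<epsilon>) z" by metis
    then show ?case
      by (intro bexI[OF _ tempered_algebra.add[of u' _ _ v']]) (auto simp: has_partial_def intro!: derivative_eq_intros)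
  next
    case (mult u v)
    then obtain u' v' where "u' \<in> tempered_algebra W V" "v' \<in> tempered_algebra W V"
      "\<And>\<epsilon> z. \<epsilon> \<in> {0<..1} \<Longrightarrow> z \<in> coord_space (W \<union> V) \<Longrightarrow> has_partial c (u \<epsilon>) (u' \<epsilon>) z"
      "\<And>\<epsilon> z. \<epsilon> \<in> {0<..1} \<Longrightarrow> z \<in> coord_space (W \<union> V) \<Longrightarrow> has_partial c (v \<epsilon>) (v' \<epsilon>) z" by metis
    with mult.hyps show ?case
      by (intro bexI[OF _ tempered_algebra.add[OF tempered_algebra.mult[of u' _ _ v] tempered_algebra.mult[of v' _ _ u]]])
         (auto simp: has_partial_def intro!: derivative_eq_intros)
  next
    case (comp W' V' m f)
    have "(\<lambda>\<epsilon> z. \<Sum>d\<in>W' \<union> V'. pd d (f \<epsilon>) (m \<epsilon> z) * pd c (\<lambda>z. m \<epsilon> z d) z) \<in> tempered_algebra W V"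
    proof (intro tempered_algebra_sum comp tempered_algebra.mult tempered_algebra.base[OF Etau_pd[OF _ c]])
      fix d assume d: "d \<in> W' \<union> V'"
      show "(\<lambda>\<epsilon> z. pd d (f \<epsilon>) (m \<epsilon> z)) \<in> tempered_algebra W V"
        using tempered_algebra.comp[OF comp(1,2) Etau_pd[OF comp(3) d]] .
      show "(\<lambda>\<epsilon> z. m \<epsilon> z d) \<in> Etau W V" using comp(1) d by (auto simp: tempered_map_def)
    qed
    then show ?case using has_partial_comp[OF comp _ c] by (intro bexI) auto
  qed
qed

context
  fixes W V :: "coord set"
  assumes W: "finite W" and V: "finite V"
begin

lemma Etau_const: "(\<lambda>_ _. a) \<in> Etau W V"
  by (rule tempered_algebra_moderate[OF W V tempered_algebra.const])

lemma Etau_coord: "c \<in> W \<union> V \<Longrightarrow> (\<lambda>_ z. z c) \<in> Etau W V"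
  by (rule tempered_algebra_moderate[OF W V tempered_algebra.coord])

lemma Etau_add: "u \<in> Etau W V \<Longrightarrow> v \<in> Etau W V \<Longrightarrow> (\<lambda>\<epsilon> z. u \<epsilon> z + v \<epsilon> z) \<in> Etau W V"
  by (rule tempered_algebra_moderate[OF W V tempered_algebra.add[OF tempered_algebra.base tempered_algebra.base]])

lemma Etau_mult: "u \<in> Etau W V \<Longrightarrow> v \<in> Etau W V \<Longrightarrow> (\<lambda>\<epsilon> z. u \<epsilon> z * v \<epsilon> z) \<in> Etau W V"
  by (rule tempered_algebra_moderate[OF W V tempered_algebra.mult[OF tempered_algebra.base tempered_algebra.base]])

lemma Etau_comp:
  "tempered_map W V W' V' m \<Longrightarrow> finite (W' \<union> V') \<Longrightarrow> f \<in> Etau W' V' \<Longrightarrow> (\<lambda>\<epsilon> z. f \<epsilon> (m \<epsilon> z)) \<in> Etau W V"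
  by (rule tempered_algebra_moderate[OF W V tempered_algebra.comp])

lemma Etau_uminus: "u \<in> Etau W V \<Longrightarrow> (\<lambda>\<epsilon> z. - u \<epsilon> z) \<in> Etau W V"
  using Etau_mult[OF Etau_const[of "-1"]] by simp

lemma Etau_diff: "u \<in> Etau W V \<Longrightarrow> v \<in> Etau W V \<Longrightarrow> (\<lambda>\<epsilon> z. u \<epsilon> z - v \<epsilon> z) \<in> Etau W V"
  using Etau_add[OF _ Etau_uminus] by simp

lemma Etau_sum:
  "(\<And>i. i \<in> A \<Longrightarrow> u i \<in> Etau W V) \<Longrightarrow> (\<lambda>\<epsilon> z. \<Sum>i\<in>A. u i \<epsilon> z) \<in> Etau W V"
  by (induction A rule: infinite_finite_induct) (simp_all add: Etau_add Etau_const)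

end

lemma mod_on_subset: "mod_on V Z u \<Longrightarrow> Z' \<subseteq> Z \<Longrightarrow> mod_on V Z' u"
  unfolding mod_on_def by (elim exE, rule exI, erule eventually_mono) blast

lemma proj_disjoint: "z \<in> coord_space V \<Longrightarrow> W \<inter> V = {} \<Longrightarrow> proj W z = (\<lambda>_. 0)"
  by (auto simp: proj_def coord_space_def fun_eq_iff)

lemma coord_space_subset_slab:
  "W \<inter> V = {} \<Longrightarrow> coord_space V \<subseteq> slab W V {\<lambda>_. 0}"
  using coord_space_mono[of V "W \<union> V"] by (auto simp: slab_def proj_disjoint)

text \<open>Points of the smaller space have parameter zero, so a net is restricted to the parameter value zero
  just by regarding it on the smaller space.\<close>

lemma Etau_restrict:
  assumes u: "u \<in> Etau W V" and disj: "W \<inter> V = {}"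
  shows "u \<in> Etau {} V"
proof -
  have sub: "coord_space V \<subseteq> coord_space (W \<union> V)" by (rule coord_space_mono) auto
  have "smooth V (u \<epsilon>)" if "\<epsilon> \<in> {0<..1}" for \<epsilon>
    unfolding smooth_def
  proof (intro ballI conjI)
    fix cs assume "cs \<in> lists V"
    then have cs: "cs \<in> lists (W \<union> V)" by auto
    show "continuous_on (coord_space V) (pds cs (u \<epsilon>))"
      using smooth_continuous[OF Etau_smooth[OF u that] cs] sub by (rule continuous_on_subset)
    fix c z assume "c \<in> V" "z \<in> coord_space V"
    then show "(\<lambda>t. pds cs (u \<epsilon>) (z(c := t))) differentiable (at (z c))"
      using Etau_smooth[OF u that] cs sub by (auto simp: smooth_def)
  qed
  moreover have "tempered {} V (\<lambda>\<epsilon>. pds cs (u \<epsilon>))" if "cs \<in> lists V" for cs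
  proof -
    have temp: "tempered W V (\<lambda>\<epsilon>. pds cs (u \<epsilon>))" using u that by (auto simp: Etau_iff)
    have "compact {\<lambda>_::coord. 0::real}" "{\<lambda>_. 0} \<subseteq> coord_space W" by (auto simp: coord_space_def)
    with temp have "mod_on V (slab W V {\<lambda>_. 0}) (\<lambda>\<epsilon>. pds cs (u \<epsilon>))"
      "\<And>\<epsilon>. \<epsilon> \<in> {0<..1} \<Longrightarrow> mod_on V (slab W V {\<lambda>_. 0}) (\<lambda>_. pds cs (u \<epsilon>))"
      unfolding tempered_def by blast+
    moreover have "slab {} V K \<subseteq> slab W V {\<lambda>_. 0}" for K
      using coord_space_subset_slab[OF disj] by (auto simp: slab_def)
    moreover have "continuous_on (coord_space V) (pds cs (u \<epsilon>))" if "\<epsilon> \<in> {0<..1}" for \<epsilon>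
      using temp that sub by (auto simp: tempered_def intro: continuous_on_subset)
    ultimately show ?thesis unfolding tempered_def by (simp add: mod_on_subset[of _ "slab W V {\<lambda>_. 0}"])
  qed
  ultimately show ?thesis by (auto simp: Etau_iff)
qed

section \<open>Negligible nets\<close>

lemma neg_on_le:
  assumes "neg_on V Z v" "\<forall>\<^sub>F \<epsilon> in at_right 0. \<forall>z\<in>Z. \<bar>u \<epsilon> z\<bar> \<le> \<bar>v \<epsilon> z\<bar>"
  shows "neg_on V Z u"
proof -
  obtain r where r: "\<And>s. \<forall>\<^sub>F \<epsilon> in at_right 0. \<forall>z\<in>Z. \<bar>v \<epsilon> z\<bar> \<le> scale V \<epsilon> z ^ r * \<epsilon> ^ s"
    using assms(1) by (auto simp: neg_on_def)
  have "\<forall>\<^sub>F \<epsilon> in at_right 0. \<forall>z\<in>Z. \<bar>u \<epsilon> z\<bar> \<le> scale V \<epsilon> z ^ r * \<epsilon> ^ s" for s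
    using r[of s] assms(2) by eventually_elim (meson order.trans)
  then show ?thesis by (auto simp: neg_on_def)
qed

lemma neg_on_cong:
  assumes "neg_on V Z u" "\<And>\<epsilon> z. \<epsilon> \<in> {0<..1} \<Longrightarrow> z \<in> Z \<Longrightarrow> v \<epsilon> z = u \<epsilon> z"
  shows "neg_on V Z v"
proof (rule neg_on_le[OF assms(1)])
  have "\<forall>\<^sub>F \<epsilon> in at_right (0::real). 0 < \<epsilon> \<and> \<epsilon> < 1" by (rule eventually_small) simp
  then show "\<forall>\<^sub>F \<epsilon> in at_right 0. \<forall>z\<in>Z. \<bar>v \<epsilon> z\<bar> \<le> \<bar>u \<epsilon> z\<bar>"
    by eventually_elim (auto simp: assms(2))
qed

lemma neg_on_subset: "neg_on V Z u \<Longrightarrow> Z' \<subseteq> Z \<Longrightarrow> neg_on V Z' u"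
  unfolding neg_on_def by (elim exE, rule exI, rule allI, erule allE, erule eventually_mono) blast

lemma neg_on_zero: "neg_on V Z (\<lambda>_ _. 0)"
proof -
  have "\<forall>\<^sub>F \<epsilon> in at_right (0::real). 0 < \<epsilon> \<and> \<epsilon> < 1" by (rule eventually_small) simp
  then have "\<forall>\<^sub>F \<epsilon> in at_right (0::real). \<forall>z\<in>Z. \<bar>0\<bar> \<le> scale V \<epsilon> z ^ 0 * \<epsilon> ^ s" for s
    by eventually_elim auto
  then show ?thesis unfolding neg_on_def by blast
qed

lemma neg_on_abs: "neg_on V Z u \<Longrightarrow> neg_on V Z (\<lambda>\<epsilon> z. \<bar>u \<epsilon> z\<bar>)"
  by (erule neg_on_le) auto

lemma neg_on_add:
  assumes "neg_on V Z u" "neg_on V Z v"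
  shows "neg_on V Z (\<lambda>\<epsilon> z. u \<epsilon> z + v \<epsilon> z)"
proof -
  obtain r r' where r: "\<And>s. \<forall>\<^sub>F \<epsilon> in at_right 0. \<forall>z\<in>Z. \<bar>u \<epsilon> z\<bar> \<le> scale V \<epsilon> z ^ r * \<epsilon> ^ s"
    "\<And>s. \<forall>\<^sub>F \<epsilon> in at_right 0. \<forall>z\<in>Z. \<bar>v \<epsilon> z\<bar> \<le> scale V \<epsilon> z ^ r' * \<epsilon> ^ s"
    using assms by (auto simp: neg_on_def)
  have "\<forall>\<^sub>F \<epsilon> in at_right 0. \<forall>z\<in>Z. \<bar>u \<epsilon> z + v \<epsilon> z\<bar> \<le> scale V \<epsilon> z ^ (max r r' + 1) * \<epsilon> ^ s" for s
  proof -
    have "\<forall>\<^sub>F \<epsilon> in at_right (0::real). 0 < \<epsilon> \<and> \<epsilon> < 1 / 2" by (rule eventually_small) simp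
    with r(1)[of s] r(2)[of s] show ?thesis
    proof eventually_elim
      case (elim \<epsilon>)
      show ?case
      proof
        fix z assume z: "z \<in> Z"
        have S: "2 \<le> scale V \<epsilon> z" using elim by (intro scale_ge') auto
        have "\<bar>u \<epsilon> z\<bar> \<le> scale V \<epsilon> z ^ max r r' * \<epsilon> ^ s" "\<bar>v \<epsilon> z\<bar> \<le> scale V \<epsilon> z ^ max r r' * \<epsilon> ^ s"
          using elim z S
          by (auto intro: order.trans[OF _ mult_right_mono[OF scale_power_mono]])
        then have "\<bar>u \<epsilon> z + v \<epsilon> z\<bar> \<le> 2 * (scale V \<epsilon> z ^ max r r' * \<epsilon> ^ s)" by linarith
        also have "\<dots> \<le> scale V \<epsilon> z * (scale V \<epsilon> z ^ max r r' * \<epsilon> ^ s)"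
          using S elim by (intro mult_right_mono) auto
        finally show "\<bar>u \<epsilon> z + v \<epsilon> z\<bar> \<le> scale V \<epsilon> z ^ (max r r' + 1) * \<epsilon> ^ s" by (simp add: mult.assoc)
      qed
    qed
  qed
  then show ?thesis unfolding neg_on_def by blast
qed

lemma neg_on_sum:
  "(\<And>i. i \<in> A \<Longrightarrow> neg_on V Z (u i)) \<Longrightarrow> neg_on V Z (\<lambda>\<epsilon> z. \<Sum>i\<in>A. u i \<epsilon> z)"
  by (induction A rule: infinite_finite_induct) (simp_all add: neg_on_add neg_on_zero)

lemma neg_on_mult:
  assumes "mod_on V Z u" "neg_on V Z v"
  shows "neg_on V Z (\<lambda>\<epsilon> z. u \<epsilon> z * v \<epsilon> z)"
proof -
  obtain r r' where r: "\<forall>\<^sub>F \<epsilon> in at_right 0. \<forall>z\<in>Z. \<bar>u \<epsilon> z\<bar> \<le> scale V \<epsilon> z ^ r"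
    "\<And>s. \<forall>\<^sub>F \<epsilon> in at_right 0. \<forall>z\<in>Z. \<bar>v \<epsilon> z\<bar> \<le> scale V \<epsilon> z ^ r' * \<epsilon> ^ s"
    using assms by (auto simp: neg_on_def mod_on_def)
  have "\<forall>\<^sub>F \<epsilon> in at_right 0. \<forall>z\<in>Z. \<bar>u \<epsilon> z * v \<epsilon> z\<bar> \<le> scale V \<epsilon> z ^ (r + r') * \<epsilon> ^ s" for s
    using r(1) r(2)[of s]
  proof eventually_elim
    case (elim \<epsilon>)
    then show ?case
      by (auto simp: abs_mult power_add mult.assoc intro!: mult_mono' simp del: mult_le_cancel_left)
  qed
  then show ?thesis unfolding neg_on_def by blast
qed

lemma neg_on_comp:
  assumes f: "neg_on V' Z' f" and V': "finite V'" and m: "\<And>c. c \<in> V' \<Longrightarrow> mod_on V Z (\<lambda>\<epsilon> z. m \<epsilon> z c)"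
    and Z': "\<And>\<epsilon> z. \<epsilon> \<in> {0<..1} \<Longrightarrow> z \<in> Z \<Longrightarrow> m \<epsilon> z \<in> Z'"
  shows "neg_on V Z (\<lambda>\<epsilon> z. f \<epsilon> (m \<epsilon> z))"
proof -
  obtain q where q: "\<forall>\<^sub>F \<epsilon> in at_right 0. \<forall>z\<in>Z. \<forall>p. (\<forall>c\<in>V'. \<bar>p c\<bar> \<le> \<bar>m \<epsilon> z c\<bar>) \<longrightarrow> scale V' \<epsilon> p \<le> scale V \<epsilon> z ^ q"
    using mod_on_scale_comp[OF V', of V Z m] m by blast
  obtain r where r: "\<And>s. \<forall>\<^sub>F \<epsilon> in at_right 0. \<forall>z\<in>Z'. \<bar>f \<epsilon> z\<bar> \<le> scale V' \<epsilon> z ^ r * \<epsilon> ^ s"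
    using f by (auto simp: neg_on_def)
  have "\<forall>\<^sub>F \<epsilon> in at_right 0. \<forall>z\<in>Z. \<bar>f \<epsilon> (m \<epsilon> z)\<bar> \<le> scale V \<epsilon> z ^ (q * r) * \<epsilon> ^ s" for s
  proof -
    have "\<forall>\<^sub>F \<epsilon> in at_right (0::real). 0 < \<epsilon> \<and> \<epsilon> < 1" by (rule eventually_small) simp
    with q r[of s] show ?thesis
    proof eventually_elim
      case (elim \<epsilon>)
      show ?case
      proof
        fix z assume z: "z \<in> Z"
        have "\<bar>f \<epsilon> (m \<epsilon> z)\<bar> \<le> scale V' \<epsilon> (m \<epsilon> z) ^ r * \<epsilon> ^ s" using elim z Z'[of \<epsilon> z] by auto
        also have "\<dots> \<le> (scale V \<epsilon> z ^ q) ^ r * \<epsilon> ^ s"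
          using elim z vnorm_nonneg[of V' "m \<epsilon> z"] by (intro mult_right_mono power_mono) (auto simp: scale_def)
        finally show "\<bar>f \<epsilon> (m \<epsilon> z)\<bar> \<le> scale V \<epsilon> z ^ (q * r) * \<epsilon> ^ s" by (simp add: power_mult)
      qed
    qed
  qed
  then show ?thesis unfolding neg_on_def by blast
qed

definition negligible :: "coord set \<Rightarrow> net \<Rightarrow> bool" where
  "negligible V u \<longleftrightarrow> neg_on V (coord_space V) u"

lemma vnorm_upd_le:
  assumes "finite V" "\<bar>h\<bar> \<le> 1"
  shows "vnorm V (z(c := z c + h)) \<le> vnorm V z + 1"
proof -
  have "vnorm V (z(c := z c + h)) = L2_set (\<lambda>d. z d + (if d = c then h else 0)) V"
    unfolding vnorm_def by (rule L2_set_cong) auto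
  also have "\<dots> \<le> vnorm V z + L2_set (\<lambda>d. if d = c then h else 0) V"
    unfolding vnorm_def by (rule L2_set_triangle_ineq)
  also have "L2_set (\<lambda>d. if d = c then h else 0) V \<le> (\<Sum>d\<in>V. \<bar>if d = c then h else 0\<bar>)"
    by (rule L2_set_le_sum_abs)
  also have "(\<Sum>d\<in>V. \<bar>if d = c then h else 0\<bar>) = (\<Sum>d\<in>V. if d = c then \<bar>h\<bar> else 0)"
    by (rule sum.cong) auto
  also have "\<dots> \<le> 1" using assms by simp
  finally show ?thesis by (simp add: fun_upd_def)
qed

lemma scale_upd_le:
  assumes "finite V" "\<bar>h\<bar> \<le> 1" "0 < \<epsilon>" "\<epsilon> < 1 / 2"
  shows "scale V \<epsilon> (z(c := z c + h)) \<le> scale V \<epsilon> z ^ 2"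
proof -
  have S: "2 \<le> scale V \<epsilon> z" using assms by (intro scale_ge') auto
  have "scale V \<epsilon> (z(c := z c + h)) \<le> (1 + (vnorm V z + 1)) / \<epsilon>"
    unfolding scale_def using vnorm_upd_le[OF assms(1,2)] assms by (intro divide_right_mono add_left_mono) auto
  also have "\<dots> \<le> 2 * scale V \<epsilon> z"
    using assms vnorm_nonneg[of V z] by (simp add: scale_def field_simps)
  also have "\<dots> \<le> scale V \<epsilon> z ^ 2" using S by (simp add: power2_eq_square mult_right_mono)
  finally show ?thesis .
qed

text \<open>An interpolation inequality of Landau type. A difference quotient of step \<open>h\<close> differs from the derivative by
  at most \<open>h\<close> times a second derivative. If \<open>h\<close> is a high power of \<open>\<epsilon>\<close>, then the factor \<open>h\<close> compensates the second
  derivative, which is moderate, and the quotient is still negligible.\<close>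

lemma negligible_pd:
  assumes V: "finite V" and u: "u \<in> Etau {} V" and neg: "negligible V u" and c: "c \<in> V"
  shows "negligible V (\<lambda>\<epsilon>. pd c (u \<epsilon>))"
proof -
  obtain r where r: "\<And>s. \<forall>\<^sub>F \<epsilon> in at_right 0. \<forall>z\<in>coord_space V. \<bar>u \<epsilon> z\<bar> \<le> scale V \<epsilon> z ^ r * \<epsilon> ^ s"
    using neg by (auto simp: negligible_def neg_on_def)
  have u1: "(\<lambda>\<epsilon>. pd c (u \<epsilon>)) \<in> Etau {} V" using Etau_pd[OF u] c by simp
  have u2: "(\<lambda>\<epsilon>. pd c (pd c (u \<epsilon>))) \<in> Etau {} V" using Etau_pd[OF u1] c by simp
  have "mod_on V (slab {} V {\<lambda>_. 0}) (\<lambda>\<epsilon>. pd c (pd c (u \<epsilon>)))"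
    using Etau_tempered[OF u2] unfolding tempered_def by (auto simp: coord_space_def)
  then have "mod_on V (coord_space V) (\<lambda>\<epsilon>. pd c (pd c (u \<epsilon>)))"
    by (rule mod_on_subset) (rule coord_space_subset_slab, simp)
  then obtain a where a: "\<forall>\<^sub>F \<epsilon> in at_right 0. \<forall>z\<in>coord_space V. \<bar>pd c (pd c (u \<epsilon>)) z\<bar> \<le> scale V \<epsilon> z ^ a"
    by (auto simp: mod_on_def)
  have "\<forall>\<^sub>F \<epsilon> in at_right 0. \<forall>z\<in>coord_space V. \<bar>pd c (u \<epsilon>) z\<bar> \<le> scale V \<epsilon> z ^ (2 * r + 2 * a + 2) * \<epsilon> ^ s" for s
  proof -
    have "\<forall>\<^sub>F \<epsilon> in at_right (0::real). 0 < \<epsilon> \<and> \<epsilon> < 1 / 2" by (rule eventually_small) simp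
    \<comment> \<open>order \<open>2 s\<close>, as the quotient loses one factor \<open>h = \<epsilon>\<^sup>s\<close>\<close>
    with r[of "2 * s"] a show ?thesis
    proof eventually_elim
      case (elim \<epsilon>)
      show ?case
      proof
        fix z assume z: "z \<in> coord_space V"
        define S where "S = scale V \<epsilon> z"
        define h where "h = \<epsilon> ^ s"
        have S: "2 \<le> S" unfolding S_def using elim by (intro scale_ge') auto
        have h: "0 < h" "h \<le> 1" unfolding h_def using elim by (auto intro: power_le_one)
        have \<epsilon>: "\<epsilon> \<in> {0<..1}" using elim by auto
        let ?\<phi> = "\<lambda>t. u \<epsilon> (z(c := t))" and ?\<phi>' = "\<lambda>t. pd c (u \<epsilon>) (z(c := t))"
          and ?\<phi>'' = "\<lambda>t. pd c (pd c (u \<epsilon>)) (z(c := t))"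
        have d1: "(?\<phi> has_real_derivative ?\<phi>' t) (at t)" for t
          by (rule has_partial_line[of V]) (use Etau_has_partial[OF u \<epsilon>] c z in auto)
        have d2: "(?\<phi>' has_real_derivative ?\<phi>'' t) (at t)" for t
          by (rule has_partial_line[of V]) (use Etau_has_partial[OF u1 \<epsilon>] c z in auto)
        obtain \<xi> where \<xi>: "\<bar>\<xi> - z c\<bar> \<le> \<bar>z c + h - z c\<bar>" "?\<phi> (z c + h) - ?\<phi> (z c) = ?\<phi>' \<xi> * (z c + h - z c)"
          using mvt_between[OF d1] by blast
        obtain \<zeta> where \<zeta>: "\<bar>\<zeta> - z c\<bar> \<le> \<bar>\<xi> - z c\<bar>" "?\<phi>' \<xi> - ?\<phi>' (z c) = ?\<phi>'' \<zeta> * (\<xi> - z c)"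
          using mvt_between[OF d2] by blast
        have S1: "scale V \<epsilon> (z(c := t)) \<le> S ^ 2" if "\<bar>t - z c\<bar> \<le> 1" for t
          using scale_upd_le[OF V that, of \<epsilon> z c] elim by (simp add: S_def)
        have in_V: "z(c := t) \<in> coord_space V" for t using coord_space_upd[OF z c] .
        have scale_nonneg: "0 \<le> scale V \<epsilon> y" for y using elim vnorm_nonneg[of V y] by (simp add: scale_def)
        have b1: "\<bar>?\<phi> t\<bar> \<le> S ^ (2 * r) * h ^ 2" if "\<bar>t - z c\<bar> \<le> 1" for t
        proof -
          have "\<bar>?\<phi> t\<bar> \<le> scale V \<epsilon> (z(c := t)) ^ r * \<epsilon> ^ (2 * s)" using elim in_V by blast
          also have "\<dots> \<le> (S ^ 2) ^ r * \<epsilon> ^ (2 * s)"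
            using S1[OF that] elim scale_nonneg by (intro mult_right_mono power_mono) auto
          also have "\<dots> = S ^ (2 * r) * h ^ 2"
            by (simp add: h_def power_mult[symmetric] mult.commute)
          finally show ?thesis .
        qed
        have b2: "\<bar>?\<phi>'' \<zeta>\<bar> \<le> S ^ (2 * a)"
        proof -
          have "\<bar>?\<phi>'' \<zeta>\<bar> \<le> scale V \<epsilon> (z(c := \<zeta>)) ^ a" using elim in_V by blast
          also have "\<dots> \<le> (S ^ 2) ^ a"
            using S1[of \<zeta>] \<zeta> \<xi> h scale_nonneg by (intro power_mono) auto
          finally show ?thesis by (simp add: power_mult)
        qed
        have "\<bar>?\<phi>' \<xi>\<bar> * h = \<bar>?\<phi> (z c + h) - ?\<phi> (z c)\<bar>"
          using \<xi>(2) h by (simp add: abs_mult)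
        also have "\<dots> \<le> 2 * S ^ (2 * r) * h ^ 2" using b1[of "z c + h"] b1[of "z c"] h by simp
        finally have "\<bar>?\<phi>' \<xi>\<bar> * h \<le> (2 * S ^ (2 * r) * h) * h" by (simp add: power2_eq_square)
        then have q: "\<bar>?\<phi>' \<xi>\<bar> \<le> 2 * S ^ (2 * r) * h" using h by simp
        have "\<bar>?\<phi>'' \<zeta> * (\<xi> - z c)\<bar> \<le> S ^ (2 * a) * h"
          unfolding abs_mult using b2 \<xi> h S by (intro mult_mono) auto
        with q \<zeta>(2) have "\<bar>?\<phi>' (z c)\<bar> \<le> (2 * S ^ (2 * r) + S ^ (2 * a)) * h"
          by (simp add: algebra_simps)
        also have "\<dots> \<le> S ^ (2 * r + 2 * a + 2) * h"
        proof (rule mult_right_mono)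
          have "S ^ (2 * r) \<le> S ^ (2 * r + 2 * a)" "S ^ (2 * a) \<le> S ^ (2 * r + 2 * a)"
            using S by (auto intro: power_increasing)
          then have "2 * S ^ (2 * r) + S ^ (2 * a) \<le> 4 * S ^ (2 * r + 2 * a)"
            using S zero_le_power[of S "2 * r + 2 * a"] by linarith
          also have "\<dots> \<le> S ^ 2 * S ^ (2 * r + 2 * a)"
            using power_mono[OF S, of 2] S by (intro mult_right_mono) auto
          finally show "2 * S ^ (2 * r) + S ^ (2 * a) \<le> S ^ (2 * r + 2 * a + 2)"
            by (simp add: power_add power2_eq_square mult_ac)
        qed (use h in auto)
        finally show "\<bar>pd c (u \<epsilon>) z\<bar> \<le> scale V \<epsilon> z ^ (2 * r + 2 * a + 2) * \<epsilon> ^ s"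
          by (simp add: S_def h_def)
      qed
    qed
  qed
  then show ?thesis unfolding negligible_def neg_on_def by blast
qed

text \<open>Estimates on the compact set that consists of the parameter value zero.\<close>

lemma Ntau_imp_negligible_pds:
  assumes u: "u \<in> Ntau W V" and disj: "W \<inter> V = {}" and cs: "cs \<in> lists (W \<union> V)"
  shows "negligible V (\<lambda>\<epsilon>. pds cs (u \<epsilon>))"
proof -
  have "compact {\<lambda>_::coord. 0::real}" "{\<lambda>_. 0} \<subseteq> coord_space W" by (auto simp: coord_space_def)
  then have "neg_on V (slab W V {\<lambda>_. 0}) (\<lambda>\<epsilon>. pds cs (u \<epsilon>))"
    using u cs unfolding Ntau_def neg_on_iff_wbound by blast
  then show ?thesis unfolding negligible_def
    by (rule neg_on_subset) (rule coord_space_subset_slab[OF disj])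
qed

lemma negligible_imp_Ntau:
  assumes V: "finite V" and u: "u \<in> Etau {} V" and neg: "negligible V u"
  shows "u \<in> Ntau {} V"
proof -
  have "(\<lambda>\<epsilon>. pds cs (u \<epsilon>)) \<in> Etau {} V \<and> negligible V (\<lambda>\<epsilon>. pds cs (u \<epsilon>))" if "cs \<in> lists V" for cs
    using that
  proof (induction cs)
    case Nil then show ?case using u neg by simp
  next
    case (Cons c cs)
    then show ?case using negligible_pd[OF V, of "\<lambda>\<epsilon>. pds cs (u \<epsilon>)" c] Etau_pd[of "\<lambda>\<epsilon>. pds cs (u \<epsilon>)" "{}" V c] by auto
  qed
  moreover have "slab {} V K \<subseteq> coord_space V" for K by (auto simp: slab_def)
  ultimately have "neg_on V (slab {} V K) (\<lambda>\<epsilon>. pds cs (u \<epsilon>))" if "cs \<in> lists V" for cs K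
    using that unfolding negligible_def by (blast intro: neg_on_subset)
  with u show ?thesis unfolding Ntau_def neg_on_iff_wbound by (auto simp: Etau_def)
qed

section \<open>Congruence modulo negligible nets\<close>

definition gen_eq :: "coord set \<Rightarrow> net \<Rightarrow> net \<Rightarrow> bool" where
  "gen_eq V u v \<longleftrightarrow> u \<in> Etau {} V \<and> v \<in> Etau {} V \<and> negligible V (\<lambda>\<epsilon> z. u \<epsilon> z - v \<epsilon> z)"

lemma Etau_mod_on:
  assumes "u \<in> Etau {} V"
  shows "mod_on V (coord_space V) u"
proof -
  have "mod_on V (slab {} V {\<lambda>_. 0}) u"
    using Etau_tempered[OF assms] unfolding tempered_def by (auto simp: coord_space_def)
  then show ?thesis by (rule mod_on_subset) (rule coord_space_subset_slab, simp)
qed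

lemma gen_eq_refl: "u \<in> Etau {} V \<Longrightarrow> gen_eq V u u"
  by (simp add: gen_eq_def negligible_def neg_on_zero)

lemma gen_eq_sym: "gen_eq V u v \<Longrightarrow> gen_eq V v u"
  unfolding gen_eq_def negligible_def
  by (elim conjE, intro conjI, assumption, assumption, erule neg_on_le) (simp add: abs_minus_commute)

lemma gen_eq_trans [trans]: "gen_eq V u v \<Longrightarrow> gen_eq V v w \<Longrightarrow> gen_eq V u w"
  unfolding gen_eq_def negligible_def
  by (elim conjE, drule (1) neg_on_add) simp

lemma gen_eq_cong:
  assumes "gen_eq V u v" "\<And>\<epsilon> z. \<epsilon> \<in> {0<..1} \<Longrightarrow> z \<in> coord_space V \<Longrightarrow> u' \<epsilon> z = u \<epsilon> z"
    "\<And>\<epsilon> z. \<epsilon> \<in> {0<..1} \<Longrightarrow> z \<in> coord_space V \<Longrightarrow> v' \<epsilon> z = v \<epsilon> z"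
  shows "gen_eq V u' v'"
proof -
  have "u \<in> Etau {} V" "v \<in> Etau {} V" and neg: "neg_on V (coord_space V) (\<lambda>\<epsilon> z. u \<epsilon> z - v \<epsilon> z)"
    using assms(1) by (simp_all add: gen_eq_def negligible_def)
  then have "u' \<in> Etau {} V" "v' \<in> Etau {} V"
    using assms(2,3) by (blast intro: Etau_cong[of _ "{}" V, simplified Un_empty_left])+
  moreover have "negligible V (\<lambda>\<epsilon> z. u' \<epsilon> z - v' \<epsilon> z)"
    unfolding negligible_def by (rule neg_on_cong[OF neg]) (simp only: assms(2,3))
  ultimately show ?thesis by (simp add: gen_eq_def)
qed

text \<open>The mean value theorem on the segment between the two images: its points are dominated by the sum of the
  absolute values, so on it the first derivatives of \<open>f\<close> are bounded by a power of the scale.\<close>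

lemma negligible_comp_diff:
  assumes V': "finite V'" and f: "f \<in> Etau {} V'"
    and m: "tempered_map {} V {} V' m" and m': "tempered_map {} V {} V' m'"
    and eq: "\<And>c. c \<in> V' \<Longrightarrow> gen_eq V (\<lambda>\<epsilon> z. m \<epsilon> z c) (\<lambda>\<epsilon> z. m' \<epsilon> z c)"
  shows "negligible V (\<lambda>\<epsilon> z. f \<epsilon> (m \<epsilon> z) - f \<epsilon> (m' \<epsilon> z))"
proof -
  let ?Z = "coord_space V"
  have mods: "mod_on V ?Z (\<lambda>\<epsilon> z. m \<epsilon> z c)" "mod_on V ?Z (\<lambda>\<epsilon> z. m' \<epsilon> z c)" if "c \<in> V'" for c
    using eq[OF that] by (simp_all add: gen_eq_def Etau_mod_on)
  have "mod_on V ?Z (\<lambda>\<epsilon> z. \<bar>m \<epsilon> z c\<bar> + \<bar>m' \<epsilon> z c\<bar>)" if "c \<in> V'" for c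
    using mods[OF that] by (intro mod_on_add mod_on_abs)
  then have "\<exists>q. \<forall>\<^sub>F \<epsilon> in at_right 0. \<forall>z\<in>?Z. \<forall>p. (\<forall>c\<in>V'. \<bar>p c\<bar> \<le> \<bar>\<bar>m \<epsilon> z c\<bar> + \<bar>m' \<epsilon> z c\<bar>\<bar>) \<longrightarrow>
    scale V' \<epsilon> p \<le> scale V \<epsilon> z ^ q"
    by (rule mod_on_scale_comp[OF V', of V ?Z "\<lambda>\<epsilon> z c. \<bar>m \<epsilon> z c\<bar> + \<bar>m' \<epsilon> z c\<bar>"])
  then obtain q where q: "\<forall>\<^sub>F \<epsilon> in at_right 0. \<forall>z\<in>?Z. \<forall>p. (\<forall>c\<in>V'. \<bar>p c\<bar> \<le> \<bar>\<bar>m \<epsilon> z c\<bar> + \<bar>m' \<epsilon> z c\<bar>\<bar>) \<longrightarrow>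
    scale V' \<epsilon> p \<le> scale V \<epsilon> z ^ q" ..
  have "\<exists>r. \<forall>\<^sub>F \<epsilon> in at_right 0. \<forall>y\<in>coord_space V'. \<bar>pd c (f \<epsilon>) y\<bar> \<le> scale V' \<epsilon> y ^ r" if "c \<in> V'" for c
    using Etau_mod_on[OF Etau_pd[OF f, of c]] that by (auto simp: mod_on_def)
  then have "\<exists>r. \<forall>c\<in>V'. \<forall>\<^sub>F \<epsilon> in at_right 0. \<forall>y\<in>coord_space V'. \<bar>pd c (f \<epsilon>) y\<bar> \<le> scale V' \<epsilon> y ^ r c"
    by (intro bchoice ballI)
  then obtain r where r: "\<And>c. c \<in> V' \<Longrightarrow> \<forall>\<^sub>F \<epsilon> in at_right 0. \<forall>y\<in>coord_space V'. \<bar>pd c (f \<epsilon>) y\<bar> \<le> scale V' \<epsilon> y ^ r c"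
    by blast
  have r': "\<forall>\<^sub>F \<epsilon> in at_right 0. \<forall>c\<in>V'. \<forall>y\<in>coord_space V'. \<bar>pd c (f \<epsilon>) y\<bar> \<le> scale V' \<epsilon> y ^ r c"
    using r by (intro eventually_ball_finite V') auto
  have "neg_on V ?Z (\<lambda>\<epsilon> z. \<Sum>c\<in>V'. scale V \<epsilon> z ^ (q * r c) * \<bar>m \<epsilon> z c - m' \<epsilon> z c\<bar>)"
  proof (intro neg_on_sum neg_on_mult neg_on_abs)
    fix c assume c: "c \<in> V'"
    have "\<forall>\<^sub>F \<epsilon> in at_right (0::real). 0 < \<epsilon> \<and> \<epsilon> < 1" by (rule eventually_small) simp
    then have "\<forall>\<^sub>F \<epsilon> in at_right 0. \<forall>z\<in>?Z. \<bar>scale V \<epsilon> z ^ (q * r c)\<bar> \<le> scale V \<epsilon> z ^ (q * r c)"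
      by eventually_elim (simp add: scale_def vnorm_nonneg)
    then show "mod_on V ?Z (\<lambda>\<epsilon> z. scale V \<epsilon> z ^ (q * r c))" unfolding mod_on_def by blast
    show "neg_on V ?Z (\<lambda>\<epsilon> z. m \<epsilon> z c - m' \<epsilon> z c)"
      using eq[OF c] by (simp add: gen_eq_def negligible_def)
  qed
  moreover have "\<forall>\<^sub>F \<epsilon> in at_right (0::real). 0 < \<epsilon> \<and> \<epsilon> < 1" by (rule eventually_small) simp
  with q r' have "\<forall>\<^sub>F \<epsilon> in at_right 0. \<forall>z\<in>?Z. \<bar>f \<epsilon> (m \<epsilon> z) - f \<epsilon> (m' \<epsilon> z)\<bar> \<le>
     \<bar>\<Sum>c\<in>V'. scale V \<epsilon> z ^ (q * r c) * \<bar>m \<epsilon> z c - m' \<epsilon> z c\<bar>\<bar>"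
  proof eventually_elim
    case (elim \<epsilon>)
    then have \<epsilon>: "\<epsilon> \<in> {0<..1}" by auto
    show ?case
    proof
      fix z assume z: "z \<in> ?Z"
      define p where "p t = (\<lambda>c. m' \<epsilon> z c + t * (m \<epsilon> z c - m' \<epsilon> z c))" for t
      have p_in: "p t \<in> coord_space V'" for t
        using m m' \<epsilon> z by (auto simp: p_def tempered_map_def coord_space_def)
      have "((\<lambda>t. f \<epsilon> (p t)) has_real_derivative (\<Sum>c\<in>V'. pd c (f \<epsilon>) (p t) * (m \<epsilon> z c - m' \<epsilon> z c))) (at t)" for t
      proof (rule chain_rule_curve[OF V'])
        show "continuous_on (coord_space V') (pd c (f \<epsilon>))" if "c \<in> V'" for c
          using Etau_continuous[OF Etau_pd[OF f] \<epsilon>] that by simp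
        show "has_partial c (f \<epsilon>) (pd c (f \<epsilon>)) y" if "c \<in> V'" "y \<in> coord_space V'" for c y
          using Etau_has_partial[OF f \<epsilon>] that by simp
        show "((\<lambda>t. p t c) has_real_derivative m \<epsilon> z c - m' \<epsilon> z c) (at t)" for c
          unfolding p_def by (auto intro!: derivative_eq_intros)
      qed (rule p_in)
      then have "\<exists>t>0. t < 1 \<and> f \<epsilon> (p 1) - f \<epsilon> (p 0) = (1 - 0) * (\<Sum>c\<in>V'. pd c (f \<epsilon>) (p t) * (m \<epsilon> z c - m' \<epsilon> z c))"
        by (intro MVT2) simp_all
      then obtain t where t: "0 < t" "t < 1"
        "f \<epsilon> (p 1) - f \<epsilon> (p 0) = (1 - 0) * (\<Sum>c\<in>V'. pd c (f \<epsilon>) (p t) * (m \<epsilon> z c - m' \<epsilon> z c))" by blast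
      have "p 1 = m \<epsilon> z" "p 0 = m' \<epsilon> z" by (simp_all add: p_def)
      with t(3) have "f \<epsilon> (m \<epsilon> z) - f \<epsilon> (m' \<epsilon> z) = (\<Sum>c\<in>V'. pd c (f \<epsilon>) (p t) * (m \<epsilon> z c - m' \<epsilon> z c))" by simp
      then have "\<bar>f \<epsilon> (m \<epsilon> z) - f \<epsilon> (m' \<epsilon> z)\<bar> \<le> (\<Sum>c\<in>V'. \<bar>pd c (f \<epsilon>) (p t) * (m \<epsilon> z c - m' \<epsilon> z c)\<bar>)"
        by (simp only: sum_abs)
      also have "\<dots> \<le> (\<Sum>c\<in>V'. scale V \<epsilon> z ^ (q * r c) * \<bar>m \<epsilon> z c - m' \<epsilon> z c\<bar>)"
      proof (rule sum_mono)
        fix c assume c: "c \<in> V'"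
        have "\<bar>p t d\<bar> \<le> \<bar>\<bar>m \<epsilon> z d\<bar> + \<bar>m' \<epsilon> z d\<bar>\<bar>" for d
        proof -
          have "p t d = (1 - t) * m' \<epsilon> z d + t * m \<epsilon> z d" by (simp add: p_def algebra_simps)
          also have "\<bar>\<dots>\<bar> \<le> (1 - t) * \<bar>m' \<epsilon> z d\<bar> + t * \<bar>m \<epsilon> z d\<bar>"
            using t by (intro order.trans[OF abs_triangle_ineq]) (simp add: abs_mult)
          also have "\<dots> \<le> 1 * \<bar>m' \<epsilon> z d\<bar> + 1 * \<bar>m \<epsilon> z d\<bar>"
            using t by (intro add_mono mult_right_mono) auto
          finally show ?thesis by simp
        qed
        then have "scale V' \<epsilon> (p t) \<le> scale V \<epsilon> z ^ q" using elim(1) z by blast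
        then have "scale V' \<epsilon> (p t) ^ r c \<le> (scale V \<epsilon> z ^ q) ^ r c"
          using elim vnorm_nonneg[of V' "p t"] by (intro power_mono) (auto simp: scale_def)
        moreover have "\<bar>pd c (f \<epsilon>) (p t)\<bar> \<le> scale V' \<epsilon> (p t) ^ r c" using elim(2) c p_in by blast
        ultimately have "\<bar>pd c (f \<epsilon>) (p t)\<bar> \<le> scale V \<epsilon> z ^ (q * r c)" by (simp add: power_mult)
        then show "\<bar>pd c (f \<epsilon>) (p t) * (m \<epsilon> z c - m' \<epsilon> z c)\<bar> \<le> scale V \<epsilon> z ^ (q * r c) * \<bar>m \<epsilon> z c - m' \<epsilon> z c\<bar>"
          unfolding abs_mult by (intro mult_right_mono) auto
      qed
      finally show "\<bar>f \<epsilon> (m \<epsilon> z) - f \<epsilon> (m' \<epsilon> z)\<bar> \<le> \<bar>\<Sum>c\<in>V'. scale V \<epsilon> z ^ (q * r c) * \<bar>m \<epsilon> z c - m' \<epsilon> z c\<bar>\<bar>"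
        by linarith
    qed
  qed
  ultimately show ?thesis unfolding negligible_def by (rule neg_on_le)
qed

context
  fixes V :: "coord set"
  assumes V: "finite V"
begin

lemma gen_eq_add: "gen_eq V u u' \<Longrightarrow> gen_eq V v v' \<Longrightarrow> gen_eq V (\<lambda>\<epsilon> z. u \<epsilon> z + v \<epsilon> z) (\<lambda>\<epsilon> z. u' \<epsilon> z + v' \<epsilon> z)"
  unfolding gen_eq_def negligible_def
  using neg_on_add[of V "coord_space V" "\<lambda>\<epsilon> z. u \<epsilon> z - u' \<epsilon> z" "\<lambda>\<epsilon> z. v \<epsilon> z - v' \<epsilon> z"]
  by (auto simp: algebra_simps Etau_add[OF _ V])

lemma gen_eq_mult:
  assumes "gen_eq V u u'" "gen_eq V v v'"
  shows "gen_eq V (\<lambda>\<epsilon> z. u \<epsilon> z * v \<epsilon> z) (\<lambda>\<epsilon> z. u' \<epsilon> z * v' \<epsilon> z)"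
proof -
  have "neg_on V (coord_space V) (\<lambda>\<epsilon> z. u \<epsilon> z * (v \<epsilon> z - v' \<epsilon> z) + v' \<epsilon> z * (u \<epsilon> z - u' \<epsilon> z))"
    using assms by (intro neg_on_add neg_on_mult Etau_mod_on) (auto simp: gen_eq_def negligible_def)
  then show ?thesis using assms Etau_mult[OF _ V, of "{}"]
    unfolding gen_eq_def negligible_def by (simp add: algebra_simps)
qed

lemma gen_eq_const: "gen_eq V (\<lambda>_ _. a) (\<lambda>_ _. a)"
  by (rule gen_eq_refl) (rule Etau_const[OF _ V], simp)

lemma gen_eq_coord: "c \<in> V \<Longrightarrow> gen_eq V (\<lambda>_ z. z c) (\<lambda>_ z. z c)"
  by (rule gen_eq_refl) (rule Etau_coord[OF _ V], simp_all)

lemma gen_eq_uminus: "gen_eq V u u' \<Longrightarrow> gen_eq V (\<lambda>\<epsilon> z. - u \<epsilon> z) (\<lambda>\<epsilon> z. - u' \<epsilon> z)"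
  using gen_eq_mult[OF gen_eq_const[of "-1"]] by simp

lemma gen_eq_sum:
  "(\<And>i. i \<in> A \<Longrightarrow> gen_eq V (u i) (v i)) \<Longrightarrow> gen_eq V (\<lambda>\<epsilon> z. \<Sum>i\<in>A. u i \<epsilon> z) (\<lambda>\<epsilon> z. \<Sum>i\<in>A. v i \<epsilon> z)"
  by (induction A rule: infinite_finite_induct) (simp_all add: gen_eq_add gen_eq_const)

lemma gen_eq_pd:
  assumes "gen_eq V u v" "c \<in> V"
  shows "gen_eq V (\<lambda>\<epsilon>. pd c (u \<epsilon>)) (\<lambda>\<epsilon>. pd c (v \<epsilon>))"
proof -
  from assms have u: "u \<in> Etau {} V" and v: "v \<in> Etau {} V" by (auto simp: gen_eq_def)
  have "negligible V (\<lambda>\<epsilon>. pd c (\<lambda>z. u \<epsilon> z - v \<epsilon> z))"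
    using assms Etau_diff[OF _ V u v] by (intro negligible_pd V) (auto simp: gen_eq_def)
  then have "negligible V (\<lambda>\<epsilon> z. pd c (u \<epsilon>) z - pd c (v \<epsilon>) z)"
    unfolding negligible_def
  proof (rule neg_on_cong)
    fix \<epsilon> :: real and z assume "\<epsilon> \<in> {0<..1}" "z \<in> coord_space V"
    then have "has_partial c (\<lambda>z. u \<epsilon> z - v \<epsilon> z) (\<lambda>z. pd c (u \<epsilon>) z - pd c (v \<epsilon>) z) z"
      using Etau_has_partial[OF u] Etau_has_partial[OF v] assms(2)
      by (auto simp: has_partial_def intro!: derivative_eq_intros)
    then show "pd c (u \<epsilon>) z - pd c (v \<epsilon>) z = pd c (\<lambda>z. u \<epsilon> z - v \<epsilon> z) z"
      by (simp add: has_partial_imp_pd)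
  qed
  with u v assms(2) show ?thesis using Etau_pd[of _ "{}" V c] by (auto simp: gen_eq_def)
qed

lemma gen_eq_comp:
  assumes V': "finite V'" and fg: "gen_eq V' f g"
    and m: "tempered_map {} V {} V' m" and m': "tempered_map {} V {} V' m'"
    and eq: "\<And>c. c \<in> V' \<Longrightarrow> gen_eq V (\<lambda>\<epsilon> z. m \<epsilon> z c) (\<lambda>\<epsilon> z. m' \<epsilon> z c)"
  shows "gen_eq V (\<lambda>\<epsilon> z. f \<epsilon> (m \<epsilon> z)) (\<lambda>\<epsilon> z. g \<epsilon> (m' \<epsilon> z))"
proof -
  from fg have f: "f \<in> Etau {} V'" and g: "g \<in> Etau {} V'" and n: "negligible V' (\<lambda>\<epsilon> z. f \<epsilon> z - g \<epsilon> z)"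
    by (auto simp: gen_eq_def)
  have "neg_on V (coord_space V) (\<lambda>\<epsilon> z. (f \<epsilon> (m' \<epsilon> z) - g \<epsilon> (m' \<epsilon> z)))"
    using n unfolding negligible_def
  proof (rule neg_on_comp[OF _ V'])
    show "mod_on V (coord_space V) (\<lambda>\<epsilon> z. m' \<epsilon> z c)" if "c \<in> V'" for c
      using m' that by (intro Etau_mod_on) (auto simp: tempered_map_def)
    show "m' \<epsilon> z \<in> coord_space V'" if "\<epsilon> \<in> {0<..1}" "z \<in> coord_space V" for \<epsilon> z
      using m' that by (auto simp: tempered_map_def)
  qed
  from neg_on_add[OF negligible_comp_diff[OF V' f m m' eq, unfolded negligible_def] this]
  have "negligible V (\<lambda>\<epsilon> z. f \<epsilon> (m \<epsilon> z) - g \<epsilon> (m' \<epsilon> z))" by (simp add: negligible_def)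
  with f g show ?thesis
    using Etau_comp[OF _ V m] Etau_comp[OF _ V m'] V' by (auto simp: gen_eq_def)
qed

end

section \<open>Partial derivatives of moderate nets\<close>

context
  fixes W V :: "coord set" and \<epsilon> :: real and c :: coord and z :: point
  assumes W: "finite W" and V: "finite V" and \<epsilon>: "\<epsilon> \<in> {0<..1}" and c: "c \<in> W \<union> V" and z: "z \<in> coord_space (W \<union> V)"
begin

lemma pd_add:
  assumes "u \<in> Etau W V" "v \<in> Etau W V"
  shows "pd c (\<lambda>z. u \<epsilon> z + v \<epsilon> z) z = pd c (u \<epsilon>) z + pd c (v \<epsilon>) z"
proof -
  have "has_partial c (\<lambda>z. u \<epsilon> z + v \<epsilon> z) (\<lambda>z. pd c (u \<epsilon>) z + pd c (v \<epsilon>) z) z"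
    using Etau_has_partial[OF assms(1) \<epsilon> c z] Etau_has_partial[OF assms(2) \<epsilon> c z]
    by (auto simp: has_partial_def intro!: derivative_eq_intros)
  then show ?thesis by (simp add: has_partial_imp_pd)
qed

lemma pd_mult:
  assumes "u \<in> Etau W V" "v \<in> Etau W V"
  shows "pd c (\<lambda>z. u \<epsilon> z * v \<epsilon> z) z = pd c (u \<epsilon>) z * v \<epsilon> z + u \<epsilon> z * pd c (v \<epsilon>) z"
proof -
  have "has_partial c (\<lambda>z. u \<epsilon> z * v \<epsilon> z) (\<lambda>z. pd c (u \<epsilon>) z * v \<epsilon> z + u \<epsilon> z * pd c (v \<epsilon>) z) z"
    using Etau_has_partial[OF assms(1) \<epsilon> c z] Etau_has_partial[OF assms(2) \<epsilon> c z]
    by (auto simp: has_partial_def intro!: derivative_eq_intros)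
  then show ?thesis by (simp add: has_partial_imp_pd)
qed

lemma pd_const: "pd c (\<lambda>_. a) z = 0"
  by (simp add: pd_def)

lemma pd_sum:
  assumes "finite A" "\<And>i. i \<in> A \<Longrightarrow> u i \<in> Etau W V"
  shows "pd c (\<lambda>z. \<Sum>i\<in>A. u i \<epsilon> z) z = (\<Sum>i\<in>A. pd c (u i \<epsilon>) z)"
  using assms
proof (induction A rule: finite_induct)
  case empty
  then show ?case by (simp add: pd_const)
next
  case (insert i A)
  then show ?case
    using pd_add[of "u i" "\<lambda>\<epsilon> z. \<Sum>i\<in>A. u i \<epsilon> z"] Etau_sum[OF W V, of A u] by simp
qed

end


section \<open>Jet coordinates and substitutions\<close>

lemma Par_notin_jets: "Par k \<notin> jets p q n"
  by (auto simp: jets_def base_def)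

lemma finite_base: "finite (base p)"
  by (simp add: base_def)

lemma finite_jets: "finite (jets p q n)"
proof -
  have "{Dep \<alpha> J | \<alpha> J. \<alpha> \<in> {1..q} \<and> J \<in> multi_indices p n} = (\<lambda>(\<alpha>, J). Dep \<alpha> J) ` ({1..q} \<times> multi_indices p n)"
    by auto
  then show ?thesis using finite_multi_indices[of p n] by (simp add: jets_def finite_base)
qed

lemma multi_indices_mono: "k \<le> n \<Longrightarrow> multi_indices p k \<subseteq> multi_indices p n"
  by (auto simp: multi_indices_def)

lemma jets_mono: "k \<le> n \<Longrightarrow> jets p q k \<subseteq> jets p q n"
  using multi_indices_mono[of k n p] by (auto simp: jets_def)

lemma base_subset_jets: "base p \<subseteq> jets p q n"
  by (simp add: jets_def)

lemma Ind_in_base [simp]: "Ind i \<in> base p \<longleftrightarrow> i \<in> {1..p}"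
  by (auto simp: base_def)

lemma Dep_notin_base [simp]: "Dep \<alpha> J \<notin> base p"
  by (auto simp: base_def)

lemma Ind_in_jets [simp]: "Ind i \<in> jets p q n \<longleftrightarrow> i \<in> {1..p}"
  by (auto simp: jets_def)

lemma Dep_in_jets [simp]: "Dep \<alpha> J \<in> jets p q n \<longleftrightarrow> \<alpha> \<in> {1..q} \<and> J \<in> multi_indices p n"
  by (auto simp: jets_def)

lemma Dep_in_fibre [simp]: "Dep \<alpha> J \<in> fibre q \<longleftrightarrow> \<alpha> \<in> {1..q} \<and> J = {#}"
  by (auto simp: fibre_def)

lemma Ind_notin_fibre [simp]: "Ind i \<notin> fibre q"
  by (auto simp: fibre_def)

lemma Par_notin_fibre [simp]: "Par k \<notin> fibre q"
  by (auto simp: fibre_def)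

lemma Par_notin_base [simp]: "Par k \<notin> base p"
  by (auto simp: base_def)

lemma empty_multi_index [simp]: "{#} \<in> multi_indices p n"
  by (simp add: multi_indices_def)

lemma multi_indices_0: "multi_indices p 0 = {{#}}"
  by (auto simp: multi_indices_def)

lemma jets_0: "jets p q 0 = base p \<union> fibre q"
  by (auto simp: jets_def fibre_def multi_indices_0)

lemma sum_jets:
  fixes f :: "coord \<Rightarrow> real"
  shows "(\<Sum>c\<in>jets p q n. f c) = (\<Sum>i=1..p. f (Ind i)) + (\<Sum>\<alpha>=1..q. \<Sum>J\<in>multi_indices p n. f (Dep \<alpha> J))"
proof -
  let ?D = "{Dep \<alpha> J | \<alpha> J. \<alpha> \<in> {1..q} \<and> J \<in> multi_indices p n}"
  have D: "?D = (\<lambda>(\<alpha>, J). Dep \<alpha> J) ` ({1..q} \<times> multi_indices p n)" by auto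
  have "finite ?D" unfolding D using finite_multi_indices[of p n] by simp
  then have "(\<Sum>c\<in>jets p q n. f c) = (\<Sum>c\<in>base p. f c) + (\<Sum>c\<in>?D. f c)"
    unfolding jets_def by (intro sum.union_disjoint) (auto simp: finite_base base_def)
  also have "(\<Sum>c\<in>base p. f c) = (\<Sum>i=1..p. f (Ind i))"
    unfolding base_def by (subst sum.reindex) (auto simp: inj_on_def)
  also have "(\<Sum>c\<in>?D. f c) = (\<Sum>(\<alpha>, J)\<in>{1..q} \<times> multi_indices p n. f (Dep \<alpha> J))"
    unfolding D by (subst sum.reindex) (auto simp: inj_on_def case_prod_beta')
  also have "\<dots> = (\<Sum>\<alpha>=1..q. \<Sum>J\<in>multi_indices p n. f (Dep \<alpha> J))"
    by (rule sum.cartesian_product[symmetric])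
  finally show ?thesis .
qed

lemma tempered_map_plain:
  assumes "\<And>\<epsilon> z. \<epsilon> \<in> {0<..1} \<Longrightarrow> z \<in> coord_space V \<Longrightarrow> m \<epsilon> z \<in> coord_space V'"
    "\<And>c. c \<in> V' \<Longrightarrow> (\<lambda>\<epsilon> z. m \<epsilon> z c) \<in> Etau {} V"
  shows "tempered_map {} V {} V' m"
  unfolding tempered_map_def
proof (intro conjI allI impI)
  fix K :: "point set"
  show "\<exists>K'. compact K' \<and> K' \<subseteq> coord_space {} \<and> (\<forall>\<epsilon>\<in>{0<..1}. \<forall>z\<in>slab {} V K. proj {} (m \<epsilon> z) \<in> K')"
    by (intro exI[of _ "{\<lambda>_. 0}"]) (auto simp: coord_space_def proj_def)
next
  show "\<forall>\<epsilon>\<in>{0<..1}. \<forall>z\<in>coord_space ({} \<union> V). m \<epsilon> z \<in> coord_space ({} \<union> V')"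
    unfolding Un_empty_left using assms(1) by blast
  show "\<forall>c\<in>{} \<union> V'. (\<lambda>\<epsilon> z. m \<epsilon> z c) \<in> Etau {} V"
    unfolding Un_empty_left using assms(2) by blast
qed

lemma tempered_map_param:
  fixes \<sigma> :: real
  assumes V: "finite V"
    and "\<And>\<epsilon> z. \<epsilon> \<in> {0<..1} \<Longrightarrow> z \<in> coord_space ({Par 1} \<union> V) \<Longrightarrow> m \<epsilon> z \<in> coord_space ({Par 1} \<union> V')"
    and \<sigma>: "\<And>\<epsilon> z. \<epsilon> \<in> {0<..1} \<Longrightarrow> z \<in> coord_space ({Par 1} \<union> V) \<Longrightarrow> m \<epsilon> z (Par 1) = \<sigma> * z (Par 1)"
    and "\<And>c. c \<in> V' \<Longrightarrow> (\<lambda>\<epsilon> z. m \<epsilon> z c) \<in> Etau {Par 1} V"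
  shows "tempered_map {Par 1} V {Par 1} V' m"
  unfolding tempered_map_def
proof (intro conjI allI impI)
  have "(\<lambda>_ z. \<sigma> * z (Par 1)) \<in> Etau {Par 1} V"
    by (intro Etau_mult[OF _ V] Etau_const[OF _ V] Etau_coord[OF _ V]) auto
  then have "(\<lambda>\<epsilon> z. m \<epsilon> z (Par 1)) \<in> Etau {Par 1} V"
    by (rule Etau_cong) (rule \<sigma>)
  then show "\<forall>c\<in>{Par 1} \<union> V'. (\<lambda>\<epsilon> z. m \<epsilon> z c) \<in> Etau {Par 1} V" using assms(4) by blast
  fix K :: "point set" assume K: "compact K \<and> K \<subseteq> coord_space {Par 1}"
  let ?K' = "(\<lambda>w c. \<sigma> * w c) ` K"
  have "continuous_on K (\<lambda>w. \<sigma> * w c)" for c :: coord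
    by (intro continuous_on_mult_left continuous_on_subset[OF continuous_on_product_coordinates]) simp
  then have "continuous_on K (\<lambda>w c. \<sigma> * w c)"
    by (rule continuous_on_coordinatewise_then_product)
  then have "compact ?K'" using K by (blast intro: compact_continuous_image)
  moreover have "?K' \<subseteq> coord_space {Par 1}" using K by (fastforce simp: coord_space_def)
  moreover have "proj {Par 1} (m \<epsilon> z) \<in> ?K'" if "\<epsilon> \<in> {0<..1}" "z \<in> slab {Par 1} V K" for \<epsilon> z
  proof
    show "proj {Par 1} z \<in> K" using that by (simp add: slab_def)
    show "proj {Par 1} (m \<epsilon> z) = (\<lambda>c. \<sigma> * proj {Par 1} z c)"
    proof -
      have "m \<epsilon> z (Par 1) = \<sigma> * z (Par 1)" using that by (intro \<sigma>) (simp_all add: slab_def)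
      then show ?thesis by (simp add: proj_def fun_eq_iff)
    qed
  qed
  ultimately show "\<exists>K'. compact K' \<and> K' \<subseteq> coord_space {Par 1} \<and>
      (\<forall>\<epsilon>\<in>{0<..1}. \<forall>z\<in>slab {Par 1} V K. proj {Par 1} (m \<epsilon> z) \<in> K')" by blast
next
  show "\<forall>\<epsilon>\<in>{0<..1}. \<forall>z\<in>coord_space ({Par 1} \<union> V). m \<epsilon> z \<in> coord_space ({Par 1} \<union> V')"
    using assms(2) by blast
qed

lemma tempered_map_restrict:
  assumes m: "tempered_map {Par 1} V {Par 1} V' m" and V: "Par 1 \<notin> V"
    and 0: "\<And>\<epsilon> z. \<epsilon> \<in> {0<..1} \<Longrightarrow> z \<in> coord_space V \<Longrightarrow> m \<epsilon> z (Par 1) = 0"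
  shows "tempered_map {} V {} V' m"
proof (rule tempered_map_plain)
  fix \<epsilon> :: real and z assume \<epsilon>: "\<epsilon> \<in> {0<..1}" and z: "z \<in> coord_space V"
  have "z \<in> coord_space ({Par 1} \<union> V)"
    using z coord_space_mono[of V "{Par 1} \<union> V"] by blast
  then have m_in: "m \<epsilon> z \<in> coord_space ({Par 1} \<union> V')"
    using m \<epsilon> by (simp add: tempered_map_def)
  show "m \<epsilon> z \<in> coord_space V'"
    unfolding coord_space_def
  proof (intro CollectI allI impI)
    fix c assume "c \<notin> V'"
    then show "m \<epsilon> z c = 0"
      using m_in 0[OF \<epsilon> z] by (cases "c = Par 1") (simp_all add: coord_space_def)
  qed
next
  fix c assume "c \<in> V'"
  then have "(\<lambda>\<epsilon> z. m \<epsilon> z c) \<in> Etau {Par 1} V"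
    using m by (simp add: tempered_map_def)
  then show "(\<lambda>\<epsilon> z. m \<epsilon> z c) \<in> Etau {} V"
    by (rule Etau_restrict) (simp add: V[unfolded One_nat_def])
qed


section \<open>Total derivatives\<close>

lemma pd_proj:
  assumes f: "\<And>z. f (proj V z) = f z"
  shows "pd c f (proj V z) = pd c f z"
proof (cases "c \<in> V")
  case True
  then have "f ((proj V z)(c := t)) = f (z(c := t))" for t
    using f[of "z(c := t)"] by (simp add: proj_upd_in)
  then show ?thesis using True by (simp add: pd_def proj_def)
next
  case False
  have "f (z(c := t)) = f z" for t and z
    using f[of "z(c := t)"] f[of z] False by (simp add: proj_upd_notin)
  then show ?thesis by (simp add: pd_def)
qed

lemma pd_proj_notin:
  assumes f: "\<And>z. f (proj V z) = f z" and "c \<notin> V"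
  shows "pd c f z = 0"
proof -
  have "f (z(c := t)) = f z" for t
    using f[of "z(c := t)"] f[of z] \<open>c \<notin> V\<close> by (simp add: proj_upd_notin)
  then show ?thesis by (simp add: pd_def)
qed

text \<open>The part of the total derivative that acts along the fibres of the jet space. It is separated from the
  partial derivative because the twisted total derivative below treats the two differently.\<close>

definition fibre_deriv :: "nat \<Rightarrow> nat \<Rightarrow> nat \<Rightarrow> nat \<Rightarrow> (point \<Rightarrow> real) \<Rightarrow> point \<Rightarrow> real" where
  "fibre_deriv p q n i f z =
     (\<Sum>\<alpha>=1..q. \<Sum>J\<in>multi_indices p n. z (Dep \<alpha> (add_mset i J)) * pd (Dep \<alpha> J) f z)"

text \<open>Regarded as functions of the \<open>(n+1)\<close>-jet, functions of lower jets have a common total derivative, whatever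
  jet space they came from. This allows the iterated derivatives to be computed on one space.\<close>

lemma total_deriv_ambient:
  assumes f: "\<And>z. f (proj (jets p q k) z) = f z" and k: "k \<le> n"
  shows "total_deriv p q k i f z = pd (Ind i) f z + fibre_deriv p q n i f z"
proof -
  have "(\<Sum>J\<in>multi_indices p n. z (Dep \<alpha> (add_mset i J)) * pd (Dep \<alpha> J) f z) =
      (\<Sum>J\<in>multi_indices p k. z (Dep \<alpha> (add_mset i J)) * pd (Dep \<alpha> J) f z)" if "\<alpha> \<in> {1..q}" for \<alpha>
  proof (rule sum.mono_neutral_right)
    show "\<forall>J\<in>multi_indices p n - multi_indices p k. z (Dep \<alpha> (add_mset i J)) * pd (Dep \<alpha> J) f z = 0"
    proof
      fix J assume "J \<in> multi_indices p n - multi_indices p k"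
      then have "Dep \<alpha> J \<notin> jets p q k" by simp
      then have "pd (Dep \<alpha> J) f z = 0" by (rule pd_proj_notin[of f, OF f])
      then show "z (Dep \<alpha> (add_mset i J)) * pd (Dep \<alpha> J) f z = 0" by simp
    qed
  qed (use multi_indices_mono[OF k, of p] finite_multi_indices in auto)
  then show ?thesis
    unfolding total_deriv_def fibre_deriv_def by (simp add: pd_proj[of f "jets p q k", OF f])
qed

lemma total_deriv_proj:
  "i \<in> {1..p} \<Longrightarrow> total_deriv p q k i f (proj (jets p q (Suc k)) z) = total_deriv p q k i f z"
proof -
  assume i: "i \<in> {1..p}"
  have "proj (jets p q (Suc k)) z (Dep \<alpha> (add_mset i J)) = z (Dep \<alpha> (add_mset i J))"
    if "\<alpha> \<in> {1..q}" "J \<in> multi_indices p k" for \<alpha> J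
    using that i by (auto simp: proj_def multi_indices_def)
  then show ?thesis
    unfolding total_deriv_def using proj_proj[OF jets_mono[of k "Suc k" p q], of z] by simp
qed

lemma fibre_deriv_add:
  assumes "\<epsilon> \<in> {0<..1}" "z \<in> coord_space (W \<union> jets p q (n + 1))" "finite W"
    "u \<in> Etau W (jets p q (n + 1))" "v \<in> Etau W (jets p q (n + 1))"
  shows "fibre_deriv p q n i (\<lambda>z. u \<epsilon> z + v \<epsilon> z) z = fibre_deriv p q n i (u \<epsilon>) z + fibre_deriv p q n i (v \<epsilon>) z"
proof -
  have "pd (Dep \<alpha> J) (\<lambda>z. u \<epsilon> z + v \<epsilon> z) z = pd (Dep \<alpha> J) (u \<epsilon>) z + pd (Dep \<alpha> J) (v \<epsilon>) z"
    if "\<alpha> \<in> {1..q}" "J \<in> multi_indices p n" for \<alpha> J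
    using that multi_indices_mono[of n "n + 1" p] assms by (intro pd_add[OF _ finite_jets]) auto
  then show ?thesis
    by (simp add: fibre_deriv_def distrib_left sum.distrib)
qed

lemma fibre_deriv_mult:
  assumes "\<epsilon> \<in> {0<..1}" "z \<in> coord_space (W \<union> jets p q (n + 1))" "finite W"
    "u \<in> Etau W (jets p q (n + 1))" "v \<in> Etau W (jets p q (n + 1))"
  shows "fibre_deriv p q n i (\<lambda>z. u \<epsilon> z * v \<epsilon> z) z =
    fibre_deriv p q n i (u \<epsilon>) z * v \<epsilon> z + u \<epsilon> z * fibre_deriv p q n i (v \<epsilon>) z"
proof -
  have "pd (Dep \<alpha> J) (\<lambda>z. u \<epsilon> z * v \<epsilon> z) z = pd (Dep \<alpha> J) (u \<epsilon>) z * v \<epsilon> z + u \<epsilon> z * pd (Dep \<alpha> J) (v \<epsilon>) z"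
    if "\<alpha> \<in> {1..q}" "J \<in> multi_indices p n" for \<alpha> J
    using that multi_indices_mono[of n "n + 1" p] assms by (intro pd_mult[OF _ finite_jets]) auto
  then show ?thesis
    by (simp add: fibre_deriv_def distrib_left sum.distrib sum_distrib_left sum_distrib_right mult_ac)
qed

lemma fibre_deriv_coord:
  assumes "\<alpha> \<in> {1..q}" "J \<in> multi_indices p n"
  shows "fibre_deriv p q n i (\<lambda>z. z (Dep \<alpha> J)) z = z (Dep \<alpha> (add_mset i J))"
proof -
  have "(\<Sum>K\<in>multi_indices p n. z (Dep \<beta> (add_mset i K)) * pd (Dep \<beta> K) (\<lambda>z. z (Dep \<alpha> J)) z) =
     (if \<beta> = \<alpha> then z (Dep \<alpha> (add_mset i J)) else 0)" for \<beta>
  proof -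
    have "z (Dep \<beta> (add_mset i K)) * pd (Dep \<beta> K) (\<lambda>z. z (Dep \<alpha> J)) z =
        (if K = J then if \<beta> = \<alpha> then z (Dep \<alpha> (add_mset i J)) else 0 else 0)" for K
      by (auto simp: pd_def)
    then show ?thesis using assms(2) by (simp add: finite_multi_indices)
  qed
  then show ?thesis using assms(1) by (simp add: fibre_deriv_def)
qed

lemma fibre_deriv_base:
  assumes "\<And>z. f (proj (base p) z) = f z"
  shows "fibre_deriv p q n i f z = 0"
proof -
  have "pd (Dep \<alpha> J) f z = 0" for \<alpha> J
    by (rule pd_proj_notin[of f "base p", OF assms]) simp
  then show ?thesis by (simp add: fibre_deriv_def)
qed

lemma Etau_fibre_deriv:
  assumes "finite W" "f \<in> Etau W (jets p q (n + 1))" "i \<in> {1..p}"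
  shows "(\<lambda>\<epsilon>. fibre_deriv p q n i (f \<epsilon>)) \<in> Etau W (jets p q (n + 1))"
  unfolding fibre_deriv_def
  by (intro Etau_sum[OF assms(1) finite_jets] Etau_mult[OF assms(1) finite_jets]
      Etau_coord[OF assms(1) finite_jets] Etau_pd[OF assms(2)])
     (use assms(3) in \<open>auto simp: multi_indices_def\<close>)

lemma gen_eq_fibre_deriv:
  assumes "gen_eq (jets p q (n + 1)) u v" "i \<in> {1..p}"
  shows "gen_eq (jets p q (n + 1)) (\<lambda>\<epsilon>. fibre_deriv p q n i (u \<epsilon>)) (\<lambda>\<epsilon>. fibre_deriv p q n i (v \<epsilon>))"
  unfolding fibre_deriv_def
  by (intro gen_eq_sum[OF finite_jets] gen_eq_mult[OF finite_jets] gen_eq_coord[OF finite_jets]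
      gen_eq_pd[OF finite_jets assms(1)])
     (use assms(2) in \<open>auto simp: multi_indices_def\<close>)

section \<open>Projectable flows\<close>

(* Otherwise simplification turns the coordinate Par 1 into Par (Suc 0). *)
declare One_nat_def [simp del]

text \<open>The first-order behaviour of an action at parameter zero, expressed by its two components.\<close>

locale projectable_flow =
  fixes p q n :: nat and \<xi> \<psi> :: "nat \<Rightarrow> net" and \<Xi> \<Psi> :: action
  assumes xi: "\<And>i. i \<in> {1..p} \<Longrightarrow> \<xi> i \<in> Etau {} (base p)"
    and psi: "\<And>\<alpha>. \<alpha> \<in> {1..q} \<Longrightarrow> \<psi> \<alpha> \<in> Etau {} (jets p q 0)"
    and Xi: "moderate_action (base p) (base p) \<Xi>"
    and Psi: "moderate_action (jets p q 0) (fibre q) \<Psi>"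
    and Xi_0: "\<And>i. i \<in> {1..p} \<Longrightarrow> gen_eq (jets p q 0) (\<lambda>\<epsilon> z. \<Xi> \<epsilon> 0 (proj (base p) z) (Ind i)) (\<lambda>_ z. z (Ind i))"
    and Xi_1: "\<And>i. i \<in> {1..p} \<Longrightarrow> gen_eq (jets p q 0)
      (\<lambda>\<epsilon> z. deriv (\<lambda>\<eta>. \<Xi> \<epsilon> \<eta> (proj (base p) z) (Ind i)) 0) (\<lambda>\<epsilon> z. \<xi> i \<epsilon> (proj (base p) z))"
    and Psi_0: "\<And>\<alpha>. \<alpha> \<in> {1..q} \<Longrightarrow> gen_eq (jets p q 0) (\<lambda>\<epsilon> z. \<Psi> \<epsilon> 0 z (Dep \<alpha> {#})) (\<lambda>_ z. z (Dep \<alpha> {#}))"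
    and Psi_1: "\<And>\<alpha>. \<alpha> \<in> {1..q} \<Longrightarrow> gen_eq (jets p q 0) (\<lambda>\<epsilon> z. deriv (\<lambda>\<eta>. \<Psi> \<epsilon> \<eta> z (Dep \<alpha> {#})) 0) (\<psi> \<alpha>)"
begin

text \<open>All computations take place on the \<open>(n+1)\<close>-jet space, because the total derivatives of functions of the
  \<open>n\<close>-jet involve coordinates of order \<open>n + 1\<close>.\<close>

abbreviation V :: "coord set" where "V \<equiv> jets p q (n + 1)"
abbreviation E :: "coord set" where "E \<equiv> {Par 1}"

lemma fin_E: "finite E" by simp
lemma fin_V: "finite V" by (rule finite_jets)
lemma E_disj: "E \<inter> V = {}" using Par_notin_jets by auto
lemma fin_EV: "finite (E \<union> V)" using fin_V by simp

lemma V_in_EV: "z \<in> coord_space V \<Longrightarrow> z \<in> coord_space (E \<union> V)"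
  using coord_space_mono[of V "E \<union> V"] by auto

lemma Par_zero: "z \<in> coord_space V \<Longrightarrow> z (Par 1) = 0"
  using Par_notin_jets by (auto simp: coord_space_def)

lemmas restrict_EV = Etau_restrict[OF _ E_disj]

lemma jets0_sub: "jets p q 0 \<subseteq> V" by (rule jets_mono) simp
lemma base_sub: "base p \<subseteq> V" by (rule base_subset_jets)

lemma Xi_in: "\<epsilon> \<in> {0<..1} \<Longrightarrow> x \<in> coord_space (base p) \<Longrightarrow> \<Xi> \<epsilon> \<eta> x \<in> coord_space (base p)"
  using Xi by (simp add: moderate_action_def)

lemma proj_jets0_map: "tempered_map {} V {} (jets p q 0) (\<lambda>\<epsilon>. proj (jets p q 0))"
proof (rule tempered_map_plain)
  fix c assume c: "c \<in> jets p q 0"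
  then have "(\<lambda>_ z. z c) \<in> Etau {} V"
    using jets0_sub by (intro Etau_coord[OF _ fin_V]) auto
  then show "(\<lambda>\<epsilon> z. proj (jets p q 0) z c) \<in> Etau {} V"
    using c by (simp add: proj_def)
qed (rule proj_in)

lemma gen_eq_pull:
  assumes "gen_eq (jets p q 0) f g"
  shows "gen_eq V (\<lambda>\<epsilon> z. f \<epsilon> (proj (jets p q 0) z)) (\<lambda>\<epsilon> z. g \<epsilon> (proj (jets p q 0) z))"
proof (rule gen_eq_comp[OF fin_V finite_jets assms proj_jets0_map proj_jets0_map])
  fix c assume c: "c \<in> jets p q 0"
  then have "(\<lambda>_ z. z c) \<in> Etau {} V"
    using jets0_sub by (intro Etau_coord[OF _ fin_V]) auto
  then show "gen_eq V (\<lambda>\<epsilon> z. proj (jets p q 0) z c) (\<lambda>\<epsilon> z. proj (jets p q 0) z c)"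
    using c by (intro gen_eq_refl) (simp add: proj_def)
qed

text \<open>The components of \<open>\<Xi>\<^sub>\<sigma>\<^sub>\<eta>\<close>; the sign \<open>\<sigma> = -1\<close> gives the flow that is inverse to \<open>\<Xi>\<^sub>\<eta>\<close> up to negligible nets.\<close>

definition flow_at :: "real \<Rightarrow> nat \<Rightarrow> net" where
  "flow_at \<sigma> l = (\<lambda>\<epsilon> w. \<Xi> \<epsilon> (\<sigma> * w (Par 1)) (proj (base p) w) (Ind l))"

lemma flow_at_Etau:
  assumes l: "l \<in> {1..p}"
  shows "flow_at \<sigma> l \<in> Etau E V"
proof -
  let ?m = "\<lambda>(\<epsilon>::real) w c. if c = Par 1 then \<sigma> * w (Par 1) else proj (base p) w c"
  have m: "tempered_map E V E (base p) ?m"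
  proof (rule tempered_map_param[OF fin_V])
    fix c assume c: "c \<in> base p"
    then have "(\<lambda>_ z. z c) \<in> Etau E V"
      using base_sub by (intro Etau_coord[OF _ fin_V]) auto
    moreover have "c \<noteq> Par 1" using c by auto
    ultimately show "(\<lambda>\<epsilon> w. ?m \<epsilon> w c) \<in> Etau E V" using c by (simp add: proj_def)
  qed (auto simp: coord_space_def proj_def)
  have f: "(\<lambda>\<epsilon> w. uncurried (base p) \<Xi> \<epsilon> w (Ind l)) \<in> Etau E (base p)"
    using Xi l by (simp add: moderate_action_def)
  have "finite (E \<union> base p)" by (simp add: finite_base)
  from Etau_comp[OF fin_E fin_V m this f]
  have "(\<lambda>\<epsilon> w. uncurried (base p) \<Xi> \<epsilon> (?m \<epsilon> w) (Ind l)) \<in> Etau E V" .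
  moreover have "proj (base p) (?m \<epsilon> w) = proj (base p) w" for \<epsilon> w
    by (auto simp: proj_def fun_eq_iff)
  ultimately show ?thesis by (simp add: uncurried_def flow_at_def)
qed

abbreviation flow :: "nat \<Rightarrow> net" where "flow \<equiv> flow_at 1"
abbreviation flow_inv :: "nat \<Rightarrow> net" where "flow_inv \<equiv> flow_at (- 1)"

lemma proj_base_jets0: "proj (base p) (proj (jets p q 0) z) = proj (base p) z"
  by (rule proj_proj) (rule base_subset_jets)

lemma proj_jets0_Ind: "l \<in> {1..p} \<Longrightarrow> proj (jets p q 0) z (Ind l) = z (Ind l)"
  by (simp add: proj_def)

lemma flow_at_0:
  assumes l: "l \<in> {1..p}"
  shows "gen_eq V (flow_at \<sigma> l) (\<lambda>_ z. z (Ind l))"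
  by (rule gen_eq_cong[OF gen_eq_pull[OF Xi_0[OF l]]])
     (use l in \<open>simp_all add: flow_at_def Par_zero proj_base_jets0 proj_jets0_Ind\<close>)

lemma flow_has_derivative:
  assumes l: "l \<in> {1..p}" and \<epsilon>: "\<epsilon> \<in> {0<..1}" and z: "z \<in> coord_space V"
  shows "((\<lambda>\<eta>. \<Xi> \<epsilon> \<eta> (proj (base p) z) (Ind l)) has_real_derivative pd (Par 1) (flow l \<epsilon>) z) (at 0)"
  using Etau_has_partial[OF flow_at_Etau[OF l] \<epsilon>, of "Par 1" z 1] V_in_EV[OF z]
  by (simp add: has_partial_def flow_at_def Par_zero[OF z] proj_upd_notin)

lemma flow_1:
  assumes l: "l \<in> {1..p}"
  shows "gen_eq V (\<lambda>\<epsilon>. pd (Par 1) (flow l \<epsilon>)) (\<lambda>\<epsilon> z. \<xi> l \<epsilon> (proj (base p) z))"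
proof (rule gen_eq_cong[OF gen_eq_pull[OF Xi_1[OF l]]])
  fix \<epsilon> :: real and z assume "\<epsilon> \<in> {0<..1}" "z \<in> coord_space V"
  from DERIV_imp_deriv[OF flow_has_derivative[OF l this]]
  show "pd (Par 1) (flow l \<epsilon>) z = deriv (\<lambda>\<eta>. \<Xi> \<epsilon> \<eta> (proj (base p) (proj (jets p q 0) z)) (Ind l)) 0"
    by (simp add: proj_base_jets0)
qed (simp add: proj_base_jets0)

lemma flow_inv_1:
  assumes l: "l \<in> {1..p}"
  shows "gen_eq V (\<lambda>\<epsilon>. pd (Par 1) (flow_inv l \<epsilon>)) (\<lambda>\<epsilon> z. - \<xi> l \<epsilon> (proj (base p) z))"
proof (rule gen_eq_cong[OF gen_eq_uminus[OF fin_V flow_1[OF l]]])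
  fix \<epsilon> :: real and z assume \<epsilon>: "\<epsilon> \<in> {0<..1}" and z: "z \<in> coord_space V"
  have "((\<lambda>\<eta>. \<Xi> \<epsilon> (- \<eta>) (proj (base p) z) (Ind l)) has_real_derivative - pd (Par 1) (flow l \<epsilon>) z) (at 0)"
    using flow_has_derivative[OF l \<epsilon> z] DERIV_mirror[of "\<lambda>\<eta>. \<Xi> \<epsilon> \<eta> (proj (base p) z) (Ind l)" _ 0] by simp
  moreover have "pd (Par 1) (flow_inv l \<epsilon>) z = deriv (\<lambda>\<eta>. \<Xi> \<epsilon> (- \<eta>) (proj (base p) z) (Ind l)) 0"
    by (simp add: pd_def flow_at_def Par_zero[OF z] proj_upd_notin)
  ultimately show "pd (Par 1) (flow_inv l \<epsilon>) z = - pd (Par 1) (flow l \<epsilon>) z"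
    using DERIV_imp_deriv by metis
qed simp

lemma xi_Etau:
  assumes "l \<in> {1..p}"
  shows "(\<lambda>\<epsilon> z. \<xi> l \<epsilon> (proj (base p) z)) \<in> Etau {} V"
  using flow_1[OF assms] by (simp add: gen_eq_def)

section \<open>The transformed derivatives\<close>

text \<open>By the chain rule the derivatives of \<open>y \<mapsto> \<Psi>\<^sub>\<eta>(\<Xi>\<^sub>-\<^sub>\<eta>(y), h(\<Xi>\<^sub>-\<^sub>\<eta>(y)))\<close> are fixed functions of \<open>\<eta>\<close>, \<open>y\<close> and
  the jet of \<open>h\<close> at \<open>\<Xi>\<^sub>-\<^sub>\<eta>(y)\<close>. Differentiation in \<open>y\<^sub>j\<close> acts on such functions as a total derivative in which the
  coordinate \<open>u\<^sub>J\<close> contributes \<open>\<Sum>\<^sub>l u\<^sub>J\<^sub>,\<^sub>l \<partial>\<^sub>j(\<Xi>\<^sub>-\<^sub>\<eta>)\<^sub>l\<close> instead of \<open>u\<^sub>J\<^sub>,\<^sub>j\<close>, as the jet is taken at \<open>\<Xi>\<^sub>-\<^sub>\<eta>(y)\<close>.\<close>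

definition twisted_deriv :: "nat \<Rightarrow> net \<Rightarrow> net" where
  "twisted_deriv j f = (\<lambda>\<epsilon> w. pd (Ind j) (f \<epsilon>) w +
     (\<Sum>l=1..p. pd (Ind j) (flow_inv l \<epsilon>) w * fibre_deriv p q n l (f \<epsilon>) w))"

fun transformed_deriv :: "nat \<Rightarrow> nat list \<Rightarrow> net" where
  "transformed_deriv \<alpha> [] = (\<lambda>\<epsilon> w.
     \<Psi> \<epsilon> (w (Par 1)) (pair (\<Xi> \<epsilon> (- w (Par 1)) (proj (base p) w)) (proj (fibre q) w)) (Dep \<alpha> {#}))"
| "transformed_deriv \<alpha> (j # js) = twisted_deriv j (transformed_deriv \<alpha> js)"

lemma Etau_twisted_deriv:
  assumes "f \<in> Etau E V" "j \<in> {1..p}"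
  shows "twisted_deriv j f \<in> Etau E V"
  unfolding twisted_deriv_def
proof (intro Etau_add[OF fin_E fin_V] Etau_sum[OF fin_E fin_V] Etau_mult[OF fin_E fin_V])
  show "(\<lambda>\<epsilon>. pd (Ind j) (f \<epsilon>)) \<in> Etau E V"
    by (rule Etau_pd[OF assms(1)]) (use assms(2) in simp)
  fix l assume l: "l \<in> {1..p}"
  show "(\<lambda>\<epsilon>. pd (Ind j) (flow_inv l \<epsilon>)) \<in> Etau E V"
    by (rule Etau_pd[OF flow_at_Etau[OF l]]) (use assms(2) in simp)
  show "(\<lambda>\<epsilon>. fibre_deriv p q n l (f \<epsilon>)) \<in> Etau E V"
    by (rule Etau_fibre_deriv[OF fin_E assms(1) l])
qed

text \<open>The point at which \<open>\<Psi>\<close> is evaluated in the undifferentiated transformed function.\<close>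

definition source_point :: vnet where
  "source_point = (\<lambda>\<epsilon> w c. if c = Par 1 then w c else
     pair (\<Xi> \<epsilon> (- w (Par 1)) (proj (base p) w)) (proj (fibre q) w) c)"

lemma pair_in_jets0:
  assumes "x \<in> coord_space (base p)" "u \<in> coord_space (fibre q)"
  shows "pair x u \<in> coord_space (jets p q 0)"
  using assms by (auto simp: coord_space_def pair_def jets_0)

lemma source_pair_in:
  "\<epsilon> \<in> {0<..1} \<Longrightarrow> pair (\<Xi> \<epsilon> \<eta> (proj (base p) w)) (proj (fibre q) w) \<in> coord_space (jets p q 0)"
  by (intro pair_in_jets0 Xi_in proj_in)

lemma source_point_Par: "source_point \<epsilon> w (Par 1) = w (Par 1)"
  by (simp add: source_point_def)

lemma source_point_Ind:
  "i \<in> {1..p} \<Longrightarrow> source_point \<epsilon> w (Ind i) = flow_inv i \<epsilon> w"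
  by (simp add: source_point_def flow_at_def pair_def proj_def)

lemma source_point_Dep:
  assumes "\<epsilon> \<in> {0<..1}" "\<beta> \<in> {1..q}"
  shows "source_point \<epsilon> w (Dep \<beta> {#}) = w (Dep \<beta> {#})"
proof -
  have "\<Xi> \<epsilon> (- w (Par 1)) (proj (base p) w) (Dep \<beta> {#}) = 0"
    using Xi_in[OF assms(1) proj_in, of "- w (Par 1)" w] by (simp add: coord_space_def)
  then show ?thesis using assms(2) by (simp add: source_point_def pair_def proj_def)
qed

lemma jets0_cases:
  assumes "c \<in> jets p q 0"
  obtains i where "c = Ind i" "i \<in> {1..p}" | \<beta> where "c = Dep \<beta> {#}" "\<beta> \<in> {1..q}"
  using assms by (auto simp: jets_0 base_def fibre_def)

lemma source_point_map: "tempered_map E V E (jets p q 0) source_point"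
proof (rule tempered_map_param[OF fin_V, where \<sigma> = 1])
  fix \<epsilon> :: real and z assume "\<epsilon> \<in> {0<..1}"
  then show "source_point \<epsilon> z \<in> coord_space (E \<union> jets p q 0)"
    using source_pair_in[of \<epsilon> "- z (Par 1)" z] by (auto simp: coord_space_def source_point_def)
next
  fix c assume "c \<in> jets p q 0"
  then show "(\<lambda>\<epsilon> z. source_point \<epsilon> z c) \<in> Etau E V"
  proof (cases rule: jets0_cases)
    case (1 i)
    then show ?thesis by (simp add: source_point_Ind flow_at_Etau)
  next
    case (2 \<beta>)
    have "(\<lambda>_ z. z (Dep \<beta> {#})) \<in> Etau E V"
      using 2 by (intro Etau_coord[OF fin_E fin_V]) simp
    then show ?thesis by (rule Etau_cong) (use 2 in \<open>simp add: source_point_Dep\<close>)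
  qed
qed (simp add: source_point_Par)

definition psi_net :: "nat \<Rightarrow> net" where
  "psi_net \<alpha> = (\<lambda>\<epsilon> w. \<Psi> \<epsilon> (w (Par 1)) (proj (jets p q 0) w) (Dep \<alpha> {#}))"

lemma psi_net_Etau: "\<alpha> \<in> {1..q} \<Longrightarrow> psi_net \<alpha> \<in> Etau E (jets p q 0)"
  using Psi by (simp add: moderate_action_def uncurried_def psi_net_def)

lemma transformed_deriv_Nil:
  assumes "\<epsilon> \<in> {0<..1}"
  shows "transformed_deriv \<alpha> [] \<epsilon> w = psi_net \<alpha> \<epsilon> (source_point \<epsilon> w)"
proof -
  have "proj (jets p q 0) (source_point \<epsilon> w) = pair (\<Xi> \<epsilon> (- w (Par 1)) (proj (base p) w)) (proj (fibre q) w)"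
    using source_pair_in[OF assms, of "- w (Par 1)" w] Par_notin_jets[of 1 p q 0]
    by (auto simp: proj_def source_point_def coord_space_def fun_eq_iff)
  then show ?thesis by (simp add: psi_net_def source_point_Par)
qed

lemma fin_E0: "finite (E \<union> jets p q 0)"
  using finite_jets by simp

lemma transformed_deriv_Etau:
  assumes "\<alpha> \<in> {1..q}" "js \<in> lists {1..p}"
  shows "transformed_deriv \<alpha> js \<in> Etau E V"
  using assms(2)
proof (induction js)
  case Nil
  show ?case
    by (rule Etau_cong[OF Etau_comp[OF fin_E fin_V source_point_map fin_E0 psi_net_Etau[OF assms(1)]]])
       (rule transformed_deriv_Nil)
next
  case (Cons j js)
  then show ?case unfolding transformed_deriv.simps by (intro Etau_twisted_deriv) auto
qed

text \<open>At parameter zero the Jacobian matrix of the inverse flow is congruent to the unit matrix, and the twist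
  disappears.\<close>

lemma gen_eq_twisted_deriv:
  assumes f: "gen_eq V f g" and j: "j \<in> {1..p}"
  shows "gen_eq V (twisted_deriv j f) (\<lambda>\<epsilon> z. pd (Ind j) (g \<epsilon>) z + fibre_deriv p q n j (g \<epsilon>) z)"
proof -
  have "gen_eq V (twisted_deriv j f)
     (\<lambda>\<epsilon> z. pd (Ind j) (g \<epsilon>) z + (\<Sum>l=1..p. pd (Ind j) (\<lambda>z. z (Ind l)) z * fibre_deriv p q n l (g \<epsilon>) z))"
    unfolding twisted_deriv_def
  proof (intro gen_eq_add[OF fin_V] gen_eq_sum[OF fin_V] gen_eq_mult[OF fin_V])
    show "gen_eq V (\<lambda>\<epsilon>. pd (Ind j) (f \<epsilon>)) (\<lambda>\<epsilon>. pd (Ind j) (g \<epsilon>))"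
      by (rule gen_eq_pd[OF fin_V f]) (use j in simp)
    fix l assume l: "l \<in> {1..p}"
    show "gen_eq V (\<lambda>\<epsilon>. pd (Ind j) (flow_inv l \<epsilon>)) (\<lambda>_. pd (Ind j) (\<lambda>z. z (Ind l)))"
      by (rule gen_eq_pd[OF fin_V flow_at_0[OF l]]) (use j in simp)
    show "gen_eq V (\<lambda>\<epsilon>. fibre_deriv p q n l (f \<epsilon>)) (\<lambda>\<epsilon>. fibre_deriv p q n l (g \<epsilon>))"
      by (rule gen_eq_fibre_deriv[OF f l])
  qed
  then show ?thesis
  proof (rule gen_eq_cong)
    fix \<epsilon> :: real and z
    have "(\<Sum>l=1..p. pd (Ind j) (\<lambda>z. z (Ind l)) z * fibre_deriv p q n l (g \<epsilon>) z) =
      (\<Sum>l=1..p. if l = j then fibre_deriv p q n l (g \<epsilon>) z else 0)"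
      by (rule sum.cong) (auto simp: pd_def)
    then show "pd (Ind j) (g \<epsilon>) z + fibre_deriv p q n j (g \<epsilon>) z = pd (Ind j) (g \<epsilon>) z +
       (\<Sum>l=1..p. pd (Ind j) (\<lambda>z. z (Ind l)) z * fibre_deriv p q n l (g \<epsilon>) z)"
      using j by simp
  qed simp
qed

lemma psi_net_0: "\<alpha> \<in> {1..q} \<Longrightarrow> gen_eq (jets p q 0) (psi_net \<alpha>) (\<lambda>_ z. z (Dep \<alpha> {#}))"
proof (rule gen_eq_cong[OF Psi_0])
  fix \<epsilon> :: real and z assume "z \<in> coord_space (jets p q 0)"
  then show "psi_net \<alpha> \<epsilon> z = \<Psi> \<epsilon> 0 z (Dep \<alpha> {#})"
    using Par_notin_jets[of 1 p q 0] by (simp add: psi_net_def proj_id coord_space_def)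
qed auto

lemma start_map_0: "tempered_map {} V {} (jets p q 0) source_point"
  by (rule tempered_map_restrict[OF source_point_map]) (simp_all add: Par_notin_jets source_point_Par Par_zero)

lemma source_point_0:
  assumes "c \<in> jets p q 0"
  shows "gen_eq V (\<lambda>\<epsilon> z. source_point \<epsilon> z c) (\<lambda>\<epsilon> z. proj (jets p q 0) z c)"
  using assms
proof (cases rule: jets0_cases)
  case (1 i)
  show ?thesis
    by (rule gen_eq_cong[OF flow_at_0[OF 1(2), of "-1"]]) (use 1 in \<open>simp_all add: source_point_Ind proj_def\<close>)
next
  case (2 \<beta>)
  then have "Dep \<beta> {#} \<in> V" by simp
  from gen_eq_coord[OF fin_V this] show ?thesis
    by (rule gen_eq_cong) (use 2 in \<open>simp_all add: source_point_Dep proj_def\<close>)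
qed

lemma gen_eq_comp_source_point:
  assumes "gen_eq (jets p q 0) f g"
  shows "gen_eq V (\<lambda>\<epsilon> z. f \<epsilon> (source_point \<epsilon> z)) (\<lambda>\<epsilon> z. g \<epsilon> (proj (jets p q 0) z))"
  by (rule gen_eq_comp[OF fin_V finite_jets assms start_map_0 proj_jets0_map source_point_0])

lemma mset_in_multi_indices:
  "js \<in> lists {1..p} \<Longrightarrow> length js \<le> k \<Longrightarrow> mset js \<in> multi_indices p k"
  by (auto simp: multi_indices_def)

text \<open>At parameter zero the action is congruent to the identity, so the derivatives of the transformed function
  are those of the function.\<close>

lemma transformed_deriv_0:
  assumes \<alpha>: "\<alpha> \<in> {1..q}" and "js \<in> lists {1..p}" "length js \<le> n + 1"
  shows "gen_eq V (transformed_deriv \<alpha> js) (\<lambda>_ z. z (Dep \<alpha> (mset js)))"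
  using assms(2,3)
proof (induction js)
  case Nil
  show ?case
    by (rule gen_eq_cong[OF gen_eq_comp_source_point[OF psi_net_0[OF \<alpha>]]])
       (use \<alpha> in \<open>simp_all only: transformed_deriv_Nil, simp add: proj_def\<close>)
next
  case (Cons j js)
  then have j: "j \<in> {1..p}" and js: "js \<in> lists {1..p}" and len: "length js \<le> n" by auto
  have J: "mset js \<in> multi_indices p n" by (rule mset_in_multi_indices[OF js len])
  have "gen_eq V (transformed_deriv \<alpha> js) (\<lambda>_ z. z (Dep \<alpha> (mset js)))"
    using Cons.IH len by simp
  from gen_eq_twisted_deriv[OF this j] show ?case
    by (rule gen_eq_cong) (simp_all add: fibre_deriv_coord[OF \<alpha> J] pd_def)
qed


section \<open>First-order expansion in the group parameter\<close>

lemma pd_Par_fibre_deriv: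
  assumes f: "f \<in> Etau E V" and l: "l \<in> {1..p}" and \<epsilon>: "\<epsilon> \<in> {0<..1}" and z: "z \<in> coord_space (E \<union> V)"
  shows "pd (Par 1) (fibre_deriv p q n l (f \<epsilon>)) z = fibre_deriv p q n l (pd (Par 1) (f \<epsilon>)) z"
proof -
  have P: "Par 1 \<in> E \<union> V" by simp
  have mem: "Dep \<alpha> (add_mset l J) \<in> E \<union> V" "Dep \<alpha> J \<in> E \<union> V" if "\<alpha> \<in> {1..q}" "J \<in> multi_indices p n" for \<alpha> J
    using that l by (auto simp: multi_indices_def)
  have tau: "(\<lambda>\<epsilon> z. z (Dep \<alpha> (add_mset l J)) * pd (Dep \<alpha> J) (f \<epsilon>) z) \<in> Etau E V"
    if "\<alpha> \<in> {1..q}" "J \<in> multi_indices p n" for \<alpha> J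
    by (intro Etau_mult[OF fin_E fin_V] Etau_coord[OF fin_E fin_V] Etau_pd[OF f] mem that)
  have "pd (Par 1) (fibre_deriv p q n l (f \<epsilon>)) z =
      (\<Sum>\<alpha>=1..q. pd (Par 1) (\<lambda>z. \<Sum>J\<in>multi_indices p n. z (Dep \<alpha> (add_mset l J)) * pd (Dep \<alpha> J) (f \<epsilon>) z) z)"
    unfolding fibre_deriv_def[abs_def]
    by (rule pd_sum[OF fin_E fin_V \<epsilon> P z]) (intro finite_atLeastAtMost Etau_sum[OF fin_E fin_V] tau)+
  also have "\<dots> = (\<Sum>\<alpha>=1..q. \<Sum>J\<in>multi_indices p n. pd (Par 1) (\<lambda>z. z (Dep \<alpha> (add_mset l J)) * pd (Dep \<alpha> J) (f \<epsilon>) z) z)"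
    by (intro sum.cong refl pd_sum[OF fin_E fin_V \<epsilon> P z] finite_multi_indices tau)
  also have "\<dots> = (\<Sum>\<alpha>=1..q. \<Sum>J\<in>multi_indices p n. z (Dep \<alpha> (add_mset l J)) * pd (Dep \<alpha> J) (pd (Par 1) (f \<epsilon>)) z)"
  proof (intro sum.cong refl)
    fix \<alpha> J assume *: "\<alpha> \<in> {1..q}" "J \<in> multi_indices p n"
    have "pd (Par 1) (\<lambda>z. z (Dep \<alpha> (add_mset l J)) * pd (Dep \<alpha> J) (f \<epsilon>) z) z =
        pd (Par 1) (\<lambda>z. z (Dep \<alpha> (add_mset l J))) z * pd (Dep \<alpha> J) (f \<epsilon>) z +
        z (Dep \<alpha> (add_mset l J)) * pd (Par 1) (pd (Dep \<alpha> J) (f \<epsilon>)) z"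
      by (rule pd_mult[OF fin_E fin_V \<epsilon> P z Etau_coord[OF fin_E fin_V mem(1)[OF *]] Etau_pd[OF f mem(2)[OF *]]])
    also have "pd (Par 1) (pd (Dep \<alpha> J) (f \<epsilon>)) z = pd (Dep \<alpha> J) (pd (Par 1) (f \<epsilon>)) z"
      by (rule pd_commute[OF Etau_smooth[OF f \<epsilon>] P mem(2)[OF *] z])
    finally show "pd (Par 1) (\<lambda>z. z (Dep \<alpha> (add_mset l J)) * pd (Dep \<alpha> J) (f \<epsilon>) z) z =
        z (Dep \<alpha> (add_mset l J)) * pd (Dep \<alpha> J) (pd (Par 1) (f \<epsilon>)) z"
      by (simp add: pd_def[of "Par 1" "\<lambda>z. z (Dep \<alpha> (add_mset l J))"])
  qed
  finally show ?thesis by (simp add: fibre_deriv_def)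
qed

text \<open>Differentiation in the parameter commutes with the twisted derivative except for the derivative of the
  twist.\<close>

lemma pd_Par_twisted_deriv:
  assumes f: "f \<in> Etau E V" and j: "j \<in> {1..p}" and \<epsilon>: "\<epsilon> \<in> {0<..1}" and z: "z \<in> coord_space (E \<union> V)"
  shows "pd (Par 1) (twisted_deriv j f \<epsilon>) z = twisted_deriv j (\<lambda>\<epsilon>. pd (Par 1) (f \<epsilon>)) \<epsilon> z +
    (\<Sum>l=1..p. pd (Ind j) (pd (Par 1) (flow_inv l \<epsilon>)) z * fibre_deriv p q n l (f \<epsilon>) z)"
proof -
  have P: "Par 1 \<in> E \<union> V" and I: "Ind j \<in> E \<union> V" using j by simp_all
  have tau: "(\<lambda>\<epsilon>. pd (Ind j) (flow_inv l \<epsilon>)) \<in> Etau E V" "(\<lambda>\<epsilon>. fibre_deriv p q n l (f \<epsilon>)) \<in> Etau E V"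
    if "l \<in> {1..p}" for l
    by (rule Etau_pd[OF flow_at_Etau[OF that] I], rule Etau_fibre_deriv[OF fin_E f that])
  have "pd (Par 1) (twisted_deriv j f \<epsilon>) z = pd (Par 1) (pd (Ind j) (f \<epsilon>)) z +
      pd (Par 1) (\<lambda>z. \<Sum>l=1..p. pd (Ind j) (flow_inv l \<epsilon>) z * fibre_deriv p q n l (f \<epsilon>) z) z"
    unfolding twisted_deriv_def
    by (rule pd_add[OF fin_E fin_V \<epsilon> P z Etau_pd[OF f I]])
       (intro Etau_sum[OF fin_E fin_V] Etau_mult[OF fin_E fin_V] tau)
  also have "pd (Par 1) (\<lambda>z. \<Sum>l=1..p. pd (Ind j) (flow_inv l \<epsilon>) z * fibre_deriv p q n l (f \<epsilon>) z) z =
      (\<Sum>l=1..p. pd (Par 1) (\<lambda>z. pd (Ind j) (flow_inv l \<epsilon>) z * fibre_deriv p q n l (f \<epsilon>) z) z)"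
    by (rule pd_sum[OF fin_E fin_V \<epsilon> P z]) (intro finite_atLeastAtMost Etau_mult[OF fin_E fin_V] tau)+
  also have "\<dots> = (\<Sum>l=1..p. pd (Ind j) (pd (Par 1) (flow_inv l \<epsilon>)) z * fibre_deriv p q n l (f \<epsilon>) z +
      pd (Ind j) (flow_inv l \<epsilon>) z * fibre_deriv p q n l (pd (Par 1) (f \<epsilon>)) z)"
  proof (intro sum.cong refl)
    fix l assume l: "l \<in> {1..p}"
    show "pd (Par 1) (\<lambda>z. pd (Ind j) (flow_inv l \<epsilon>) z * fibre_deriv p q n l (f \<epsilon>) z) z =
      pd (Ind j) (pd (Par 1) (flow_inv l \<epsilon>)) z * fibre_deriv p q n l (f \<epsilon>) z +
      pd (Ind j) (flow_inv l \<epsilon>) z * fibre_deriv p q n l (pd (Par 1) (f \<epsilon>)) z"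
      using pd_mult[OF fin_E fin_V \<epsilon> P z tau(1)[OF l] tau(2)[OF l]]
      by (simp only: pd_commute[OF Etau_smooth[OF flow_at_Etau[OF l] \<epsilon>] P I z] pd_Par_fibre_deriv[OF f l \<epsilon> z])
  qed
  also have "pd (Par 1) (pd (Ind j) (f \<epsilon>)) z = pd (Ind j) (pd (Par 1) (f \<epsilon>)) z"
    by (rule pd_commute[OF Etau_smooth[OF f \<epsilon>] P I z])
  finally show ?thesis by (simp add: twisted_deriv_def sum.distrib)
qed

text \<open>The recursive form of the prolongation formula. The correction of the total derivative comes from the twist,
  whose derivative in \<open>\<eta>\<close> is congruent to the negative Jacobian matrix of \<open>\<xi>\<close>.\<close>

fun recursive_coeff :: "nat \<Rightarrow> nat list \<Rightarrow> net" where
  "recursive_coeff \<alpha> [] = (\<lambda>\<epsilon> z. \<psi> \<alpha> \<epsilon> (proj (jets p q 0) z))"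
| "recursive_coeff \<alpha> (j # js) = (\<lambda>\<epsilon> z. total_deriv p q (length js) j (recursive_coeff \<alpha> js \<epsilon>) z -
     (\<Sum>l=1..p. pd (Ind j) (\<lambda>z. \<xi> l \<epsilon> (proj (base p) z)) z * z (Dep \<alpha> (add_mset l (mset js)))))"

text \<open>The coefficient lives on the jet space of order \<open>|J|\<close>: here one sees that the coordinates of order
  \<open>|J| + 1\<close> cancel in its characteristic form.\<close>

lemma recursive_coeff_proj:
  assumes \<alpha>: "\<alpha> \<in> {1..q}" and "js \<in> lists {1..p}"
  shows "recursive_coeff \<alpha> js \<epsilon> (proj (jets p q (length js)) z) = recursive_coeff \<alpha> js \<epsilon> z"
  using assms(2)
proof (induction js arbitrary: z)
  case Nil
  show ?case by (simp add: proj_proj)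
next
  case (Cons j js)
  then have j: "j \<in> {1..p}" by simp
  let ?U = "jets p q (Suc (length js))"
  have "pd (Ind j) (\<lambda>z. \<xi> l \<epsilon> (proj (base p) z)) (proj ?U z) = pd (Ind j) (\<lambda>z. \<xi> l \<epsilon> (proj (base p) z)) z" for l
    by (rule pd_proj) (simp add: proj_proj[OF base_subset_jets])
  moreover have "proj ?U z (Dep \<alpha> (add_mset l (mset js))) = z (Dep \<alpha> (add_mset l (mset js)))" if "l \<in> {1..p}" for l
    using that \<alpha> Cons.hyps mset_in_multi_indices[of "l # js" "Suc (length js)"] by (auto simp: proj_def)
  ultimately show ?case using total_deriv_proj[OF j] by simp
qed

lemma recursive_coeff_Cons_ambient:
  assumes \<alpha>: "\<alpha> \<in> {1..q}" and js: "js \<in> lists {1..p}" and len: "length js \<le> n"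
  shows "recursive_coeff \<alpha> (j # js) \<epsilon> z = pd (Ind j) (recursive_coeff \<alpha> js \<epsilon>) z + fibre_deriv p q n j (recursive_coeff \<alpha> js \<epsilon>) z -
     (\<Sum>l=1..p. pd (Ind j) (\<lambda>z. \<xi> l \<epsilon> (proj (base p) z)) z * z (Dep \<alpha> (add_mset l (mset js))))"
  using total_deriv_ambient[where f = "recursive_coeff \<alpha> js \<epsilon>" and z = z and i = j, OF recursive_coeff_proj[OF \<alpha> js] len] by simp

lemma psi_net_1:
  assumes \<alpha>: "\<alpha> \<in> {1..q}"
  shows "gen_eq (jets p q 0) (\<lambda>\<epsilon>. pd (Par 1) (psi_net \<alpha> \<epsilon>)) (\<psi> \<alpha>)"
proof (rule gen_eq_cong[OF Psi_1[OF \<alpha>]])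
  fix \<epsilon> :: real and z assume z: "z \<in> coord_space (jets p q 0)"
  have "z (Par 1) = 0" using z Par_notin_jets[of 1 p q 0] by (simp add: coord_space_def)
  then show "pd (Par 1) (psi_net \<alpha> \<epsilon>) z = deriv (\<lambda>\<eta>. \<Psi> \<epsilon> \<eta> z (Dep \<alpha> {#})) 0"
    by (simp add: pd_def psi_net_def proj_upd_notin Par_notin_jets proj_id[OF z])
qed simp

text \<open>Besides \<open>\<partial>\<^sub>\<eta>\<Psi> = \<psi>\<^sub>\<alpha>\<close> the chain rule produces \<open>\<partial>\<^sub>x\<Psi>\<close> times the velocity of the inverse flow; that term is
  negligible since \<open>\<Psi>\<^sub>0\<close> is congruent to \<open>u\<^sup>\<alpha>\<close>.\<close>

lemma transformed_deriv_Nil_1: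
  assumes \<alpha>: "\<alpha> \<in> {1..q}"
  shows "gen_eq V (\<lambda>\<epsilon>. pd (Par 1) (transformed_deriv \<alpha> [] \<epsilon>)) (\<lambda>\<epsilon> z. \<psi> \<alpha> \<epsilon> (proj (jets p q 0) z))"
proof -
  let ?S = "E \<union> jets p q 0"
  let ?d = "\<lambda>\<epsilon> z d. pd d (psi_net \<alpha> \<epsilon>) (source_point \<epsilon> z) * pd (Par 1) (\<lambda>w. source_point \<epsilon> w d) z"
  have "gen_eq V (\<lambda>\<epsilon> z. \<Sum>d\<in>?S. ?d \<epsilon> z d) (\<lambda>\<epsilon> z. \<Sum>d\<in>?S. if d = Par 1 then \<psi> \<alpha> \<epsilon> (proj (jets p q 0) z) else 0)"
  proof (rule gen_eq_sum[OF fin_V])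
    fix d assume "d \<in> ?S"
    then consider "d = Par 1" | "d \<in> jets p q 0" by blast
    then show "gen_eq V (\<lambda>\<epsilon> z. ?d \<epsilon> z d) (\<lambda>\<epsilon> z. if d = Par 1 then \<psi> \<alpha> \<epsilon> (proj (jets p q 0) z) else 0)"
    proof cases
      case 1
      have "pd (Par 1) (\<lambda>w. source_point \<epsilon> w (Par 1)) z = 1" for \<epsilon> z by (simp add: source_point_Par pd_def)
      then show ?thesis using gen_eq_comp_source_point[OF psi_net_1[OF \<alpha>]] 1 by simp
    next
      case 2
      have fst_tau: "(\<lambda>\<epsilon> z. pd d (psi_net \<alpha> \<epsilon>) (source_point \<epsilon> z)) \<in> Etau {} V"
        using Etau_comp[OF fin_E fin_V source_point_map fin_E0 Etau_pd[OF psi_net_Etau[OF \<alpha>], of d]] 2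
        by (intro restrict_EV) simp
      have "(\<lambda>\<epsilon> w. source_point \<epsilon> w d) \<in> Etau E V"
        using source_point_map 2 by (simp add: tempered_map_def)
      then have snd_tau: "(\<lambda>\<epsilon> z. pd (Par 1) (\<lambda>w. source_point \<epsilon> w d) z) \<in> Etau {} V"
        by (intro restrict_EV Etau_pd) simp_all
      from 2 show ?thesis
      proof (cases rule: jets0_cases)
        case (1 i)
        have "gen_eq (jets p q 0) (\<lambda>\<epsilon>. pd d (psi_net \<alpha> \<epsilon>)) (\<lambda>\<epsilon>. pd d (\<lambda>z. z (Dep \<alpha> {#})))"
          by (rule gen_eq_pd[OF finite_jets psi_net_0[OF \<alpha>] 2])
        from gen_eq_mult[OF fin_V gen_eq_comp_source_point[OF this] gen_eq_refl[OF snd_tau]]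
        show ?thesis by (rule gen_eq_cong) (simp_all add: 1 pd_def)
      next
        case (2 \<beta>)
        have "gen_eq V (\<lambda>\<epsilon> z. pd (Par 1) (\<lambda>w. source_point \<epsilon> w d) z) (\<lambda>_ _. 0)"
        proof (rule gen_eq_cong[OF gen_eq_const[OF fin_V, of 0]])
          fix \<epsilon> :: real and z assume "\<epsilon> \<in> {0<..1}"
          then show "pd (Par 1) (\<lambda>w. source_point \<epsilon> w d) z = 0"
            unfolding 2 source_point_Dep[OF \<open>\<epsilon> \<in> {0<..1}\<close> 2(2)] by (simp add: pd_def)
        qed simp
        from gen_eq_mult[OF fin_V gen_eq_refl[OF fst_tau] this]
        show ?thesis by (rule gen_eq_cong) (simp_all add: 2)
      qed
    qed
  qed
  then show ?thesis
  proof (rule gen_eq_cong)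
    fix \<epsilon> :: real and z assume \<epsilon>: "\<epsilon> \<in> {0<..1}" and z: "z \<in> coord_space V"
    have "transformed_deriv \<alpha> [] \<epsilon> = (\<lambda>w. psi_net \<alpha> \<epsilon> (source_point \<epsilon> w))"
      by (rule ext) (rule transformed_deriv_Nil[OF \<epsilon>])
    then show "pd (Par 1) (transformed_deriv \<alpha> [] \<epsilon>) z = (\<Sum>d\<in>?S. ?d \<epsilon> z d)"
      using has_partial_imp_pd[OF has_partial_comp[OF source_point_map fin_E0 psi_net_Etau[OF \<alpha>] \<epsilon> _ V_in_EV[OF z]], of "Par 1"]
      by simp
    show "\<psi> \<alpha> \<epsilon> (proj (jets p q 0) z) = (\<Sum>d\<in>?S. if d = Par 1 then \<psi> \<alpha> \<epsilon> (proj (jets p q 0) z) else 0)"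
      using fin_E0 by simp
  qed
qed

lemma transformed_deriv_1:
  assumes \<alpha>: "\<alpha> \<in> {1..q}" and "js \<in> lists {1..p}" "length js \<le> n + 1"
  shows "gen_eq V (\<lambda>\<epsilon>. pd (Par 1) (transformed_deriv \<alpha> js \<epsilon>)) (recursive_coeff \<alpha> js)"
  using assms(2,3)
proof (induction js)
  case Nil
  show ?case unfolding recursive_coeff.simps by (rule transformed_deriv_Nil_1[OF \<alpha>])
next
  case (Cons j js)
  then have j: "j \<in> {1..p}" and js: "js \<in> lists {1..p}" and len: "length js \<le> n" by auto
  have J: "mset js \<in> multi_indices p n" by (rule mset_in_multi_indices[OF js len])
  have g: "transformed_deriv \<alpha> js \<in> Etau E V" by (rule transformed_deriv_Etau[OF \<alpha> js])
  have IH: "gen_eq V (\<lambda>\<epsilon>. pd (Par 1) (transformed_deriv \<alpha> js \<epsilon>)) (recursive_coeff \<alpha> js)"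
    using Cons.IH len by simp
  have g0: "gen_eq V (transformed_deriv \<alpha> js) (\<lambda>_ z. z (Dep \<alpha> (mset js)))"
    using len by (intro transformed_deriv_0 \<alpha> js) simp
  have "gen_eq V
    (\<lambda>\<epsilon> z. twisted_deriv j (\<lambda>\<epsilon>. pd (Par 1) (transformed_deriv \<alpha> js \<epsilon>)) \<epsilon> z +
      (\<Sum>l=1..p. pd (Ind j) (pd (Par 1) (flow_inv l \<epsilon>)) z * fibre_deriv p q n l (transformed_deriv \<alpha> js \<epsilon>) z))
    (\<lambda>\<epsilon> z. pd (Ind j) (recursive_coeff \<alpha> js \<epsilon>) z + fibre_deriv p q n j (recursive_coeff \<alpha> js \<epsilon>) z +
      (\<Sum>l=1..p. pd (Ind j) (\<lambda>z. - \<xi> l \<epsilon> (proj (base p) z)) z * fibre_deriv p q n l (\<lambda>z. z (Dep \<alpha> (mset js))) z))"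
  proof (intro gen_eq_add[OF fin_V] gen_eq_sum[OF fin_V] gen_eq_mult[OF fin_V])
    show "gen_eq V (twisted_deriv j (\<lambda>\<epsilon>. pd (Par 1) (transformed_deriv \<alpha> js \<epsilon>)))
      (\<lambda>\<epsilon> z. pd (Ind j) (recursive_coeff \<alpha> js \<epsilon>) z + fibre_deriv p q n j (recursive_coeff \<alpha> js \<epsilon>) z)"
      by (rule gen_eq_twisted_deriv[OF IH j])
    fix l assume l: "l \<in> {1..p}"
    show "gen_eq V (\<lambda>\<epsilon>. pd (Ind j) (pd (Par 1) (flow_inv l \<epsilon>))) (\<lambda>\<epsilon>. pd (Ind j) (\<lambda>z. - \<xi> l \<epsilon> (proj (base p) z)))"
      by (rule gen_eq_pd[OF fin_V flow_inv_1[OF l]]) (use j in simp)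
    show "gen_eq V (\<lambda>\<epsilon>. fibre_deriv p q n l (transformed_deriv \<alpha> js \<epsilon>)) (\<lambda>\<epsilon>. fibre_deriv p q n l (\<lambda>z. z (Dep \<alpha> (mset js))))"
      by (rule gen_eq_fibre_deriv[OF g0 l])
  qed
  then show ?case
  proof (rule gen_eq_cong)
    fix \<epsilon> :: real and z assume \<epsilon>: "\<epsilon> \<in> {0<..1}" and z: "z \<in> coord_space V"
    show "pd (Par 1) (transformed_deriv \<alpha> (j # js) \<epsilon>) z =
      twisted_deriv j (\<lambda>\<epsilon>. pd (Par 1) (transformed_deriv \<alpha> js \<epsilon>)) \<epsilon> z +
      (\<Sum>l=1..p. pd (Ind j) (pd (Par 1) (flow_inv l \<epsilon>)) z * fibre_deriv p q n l (transformed_deriv \<alpha> js \<epsilon>) z)"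
      unfolding transformed_deriv.simps by (rule pd_Par_twisted_deriv[OF g j \<epsilon> V_in_EV[OF z]])
    have "pd (Ind j) (\<lambda>z. - \<xi> l \<epsilon> (proj (base p) z)) z = - pd (Ind j) (\<lambda>z. \<xi> l \<epsilon> (proj (base p) z)) z"
      if l: "l \<in> {1..p}" for l
    proof -
      have "has_partial (Ind j) (\<lambda>z. \<xi> l \<epsilon> (proj (base p) z)) (pd (Ind j) (\<lambda>z. \<xi> l \<epsilon> (proj (base p) z))) z"
        using Etau_has_partial[OF xi_Etau[OF l] \<epsilon>, of "Ind j" z] j z by simp
      then have "has_partial (Ind j) (\<lambda>z. - \<xi> l \<epsilon> (proj (base p) z)) (\<lambda>z. - pd (Ind j) (\<lambda>z. \<xi> l \<epsilon> (proj (base p) z)) z) z"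
        unfolding has_partial_def by (rule DERIV_minus)
      then show ?thesis by (rule has_partial_imp_pd)
    qed
    then show "recursive_coeff \<alpha> (j # js) \<epsilon> z = pd (Ind j) (recursive_coeff \<alpha> js \<epsilon>) z + fibre_deriv p q n j (recursive_coeff \<alpha> js \<epsilon>) z +
      (\<Sum>l=1..p. pd (Ind j) (\<lambda>z. - \<xi> l \<epsilon> (proj (base p) z)) z * fibre_deriv p q n l (\<lambda>z. z (Dep \<alpha> (mset js))) z)"
      unfolding recursive_coeff_Cons_ambient[OF \<alpha> js len] by (simp add: fibre_deriv_coord[OF \<alpha> J] sum_negf)
  qed
qed


section \<open>The characteristic form of the coefficients\<close>

lemma total_derivs_proj:
  assumes "\<alpha> \<in> {1..q}" "js \<in> lists {1..p}"
  shows "total_derivs p q 1 js (characteristic p q \<xi> \<psi> \<alpha> \<epsilon>) (proj (jets p q (Suc (length js))) z) =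
    total_derivs p q 1 js (characteristic p q \<xi> \<psi> \<alpha> \<epsilon>) z"
proof (cases js)
  case Nil
  have "proj (jets p q 1) z (Dep \<alpha> {#i#}) = z (Dep \<alpha> {#i#})" if "i \<in> {1..p}" for i
    using that assms(1) by (simp add: proj_def multi_indices_def)
  then show ?thesis
    unfolding Nil by (simp add: characteristic_def proj_proj[OF base_subset_jets] proj_proj[OF jets_mono] flip: One_nat_def)
next
  case (Cons j js')
  then have "j \<in> {1..p}" using assms(2) by simp
  from total_deriv_proj[OF this, where k = "Suc (length js')"] show ?thesis
    by (simp add: Cons plus_1_eq_Suc)
qed

lemma fibre_deriv_cong:
  assumes "\<And>z. z \<in> coord_space V \<Longrightarrow> f z = g z" "z \<in> coord_space V"
  shows "fibre_deriv p q n j f z = fibre_deriv p q n j g z"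
proof -
  have "pd (Dep \<alpha> J) f z = pd (Dep \<alpha> J) g z" if "\<alpha> \<in> {1..q}" "J \<in> multi_indices p n" for \<alpha> J
    using that multi_indices_mono[of n "n + 1" p] by (intro pd_cong[OF assms(1) _ assms(2)]) auto
  then show ?thesis by (simp add: fibre_deriv_def)
qed

text \<open>The total derivative is a derivation, so \<open>D\<^sub>j(\<xi>\<^sub>l u\<^sub>J\<^sub>,\<^sub>l)\<close> consists of the correction term of the
  recursion and of the summand by which the next characteristic form differs from the next coefficient.\<close>

lemma total_derivs_characteristic:
  assumes \<alpha>: "\<alpha> \<in> {1..q}" and "js \<in> lists {1..p}" "length js \<le> n" and \<epsilon>: "\<epsilon> \<in> {0<..1}" and "z \<in> coord_space V"
  shows "total_derivs p q 1 js (characteristic p q \<xi> \<psi> \<alpha> \<epsilon>) z =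
    recursive_coeff \<alpha> js \<epsilon> z - (\<Sum>l=1..p. \<xi> l \<epsilon> (proj (base p) z) * z (Dep \<alpha> (add_mset l (mset js))))"
  using assms(2,3,5)
proof (induction js arbitrary: z)
  case Nil
  show ?case by (simp add: characteristic_def)
next
  case (Cons j js)
  then have j: "j \<in> {1..p}" and js: "js \<in> lists {1..p}" and len: "Suc (length js) \<le> n"
    and z: "z \<in> coord_space V" by auto
  let ?F = "total_derivs p q 1 js (characteristic p q \<xi> \<psi> \<alpha> \<epsilon>)"
  let ?x = "\<lambda>l \<epsilon> z. \<xi> l \<epsilon> (proj (base p) z)"
  let ?u = "\<lambda>l z. z (Dep \<alpha> (add_mset l (mset js)))"
  let ?G = "\<lambda>\<epsilon> z. recursive_coeff \<alpha> js \<epsilon> z + - 1 * (\<Sum>l=1..p. ?x l \<epsilon> z * ?u l z)"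
  have fin: "finite {}" by simp
  have I: "Ind j \<in> {} \<union> V" using j by simp
  have z': "z \<in> coord_space ({} \<union> V)" using z by simp
  have u_in: "add_mset l (mset js) \<in> multi_indices p n" if "l \<in> {1..p}" for l
    using mset_in_multi_indices[of "l # js" n] that js len by simp
  have c_tau: "recursive_coeff \<alpha> js \<in> Etau {} V"
    using transformed_deriv_1[OF \<alpha> js] len by (simp add: gen_eq_def)
  have x_tau: "?x l \<in> Etau {} V" if "l \<in> {1..p}" for l by (rule xi_Etau[OF that])
  have u_tau: "(\<lambda>_. ?u l) \<in> Etau {} V" if "l \<in> {1..p}" for l
    using u_in[OF that] \<alpha> multi_indices_mono[of n "n + 1" p] by (intro Etau_coord[OF fin fin_V]) auto
  have s_tau: "(\<lambda>\<epsilon> z. \<Sum>l\<in>A. ?x l \<epsilon> z * ?u l z) \<in> Etau {} V" if "A \<subseteq> {1..p}" for A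
    using that by (intro Etau_sum[OF fin fin_V] Etau_mult[OF fin fin_V] x_tau u_tau) auto
  have const: "(\<lambda>_ _. - 1) \<in> Etau {} V" by (rule Etau_const[OF fin fin_V])
  have m_tau: "(\<lambda>\<epsilon> z. - 1 * (\<Sum>l=1..p. ?x l \<epsilon> z * ?u l z)) \<in> Etau {} V"
    by (rule Etau_mult[OF fin fin_V const s_tau]) simp
  have fibre0: "fibre_deriv p q n j (\<lambda>_. a) z = 0" for a by (simp add: fibre_deriv_def pd_def)
  define D where "D f = pd (Ind j) f z + fibre_deriv p q n j f z" for f
  have D_add: "D (\<lambda>z. f \<epsilon> z + g \<epsilon> z) = D (f \<epsilon>) + D (g \<epsilon>)" if "f \<in> Etau {} V" "g \<in> Etau {} V" for f g
    using pd_add[OF fin fin_V \<epsilon> I z' that] fibre_deriv_add[OF \<epsilon> z' fin that, of j] by (simp add: D_def)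
  have D_mult: "D (\<lambda>z. f \<epsilon> z * g \<epsilon> z) = D (f \<epsilon>) * g \<epsilon> z + f \<epsilon> z * D (g \<epsilon>)" if "f \<in> Etau {} V" "g \<in> Etau {} V" for f g
    using pd_mult[OF fin fin_V \<epsilon> I z' that] fibre_deriv_mult[OF \<epsilon> z' fin that, of j]
    by (simp add: D_def algebra_simps)
  have D_const: "D (\<lambda>_. a) = 0" for a by (simp add: D_def fibre0 pd_def)
  have D_sum: "D (\<lambda>z. \<Sum>l\<in>A. ?x l \<epsilon> z * ?u l z) = (\<Sum>l\<in>A. D (\<lambda>z. ?x l \<epsilon> z * ?u l z))" if "A \<subseteq> {1..p}" for A
    using finite_subset[OF that finite_atLeastAtMost] that
  proof (induction A rule: finite_induct)
    case empty
    show ?case by (simp add: D_const)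
  next
    case (insert l A)
    then have "(\<lambda>\<epsilon> z. ?x l \<epsilon> z * ?u l z) \<in> Etau {} V"
      by (intro Etau_mult[OF fin fin_V] x_tau u_tau) auto
    from D_add[OF this s_tau[of A]] insert show ?case by simp
  qed
  have D_x: "D (?x l \<epsilon>) = pd (Ind j) (?x l \<epsilon>) z" for l
    by (simp add: D_def fibre_deriv_base proj_proj)
  have D_u: "D (?u l) = z (Dep \<alpha> (add_mset l (mset (j # js))))" if "l \<in> {1..p}" for l
    by (simp add: D_def fibre_deriv_coord[OF \<alpha> u_in[OF that]] add_mset_commute)
       (simp add: pd_def)
  have "total_derivs p q 1 (j # js) (characteristic p q \<xi> \<psi> \<alpha> \<epsilon>) z = D ?F"
    using total_deriv_ambient[where f = ?F and z = z and i = j, OF total_derivs_proj[OF \<alpha> js] len]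
    by (simp add: D_def plus_1_eq_Suc)
  also have "\<dots> = D (?G \<epsilon>)"
  proof -
    have "?F y = ?G \<epsilon> y" if "y \<in> coord_space V" for y
      using Cons.IH[OF _ that] len by simp
    then have "pd (Ind j) ?F z = pd (Ind j) (?G \<epsilon>) z" "fibre_deriv p q n j ?F z = fibre_deriv p q n j (?G \<epsilon>) z"
      using j by (intro pd_cong[of V] fibre_deriv_cong z; simp)+
    then show ?thesis by (simp add: D_def)
  qed
  also have "\<dots> = D (recursive_coeff \<alpha> js \<epsilon>) + D (\<lambda>z. - 1 * (\<Sum>l=1..p. ?x l \<epsilon> z * ?u l z))"
    by (rule D_add[OF c_tau m_tau])
  also have "D (\<lambda>z. - 1 * (\<Sum>l=1..p. ?x l \<epsilon> z * ?u l z)) = - D (\<lambda>z. \<Sum>l=1..p. ?x l \<epsilon> z * ?u l z)"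
    using D_mult[OF const s_tau[of "{1..p}"]] by (simp add: D_const)
  also have "D (\<lambda>z. \<Sum>l=1..p. ?x l \<epsilon> z * ?u l z) = (\<Sum>l=1..p. D (\<lambda>z. ?x l \<epsilon> z * ?u l z))"
    by (rule D_sum) simp
  also have "\<dots> = (\<Sum>l=1..p. pd (Ind j) (?x l \<epsilon>) z * ?u l z + ?x l \<epsilon> z * z (Dep \<alpha> (add_mset l (mset (j # js)))))"
    by (intro sum.cong refl, subst D_mult[OF x_tau u_tau]) (simp_all only: D_x D_u)
  also have "D (recursive_coeff \<alpha> js \<epsilon>) + - \<dots> =
      recursive_coeff \<alpha> (j # js) \<epsilon> z - (\<Sum>l=1..p. ?x l \<epsilon> z * z (Dep \<alpha> (add_mset l (mset (j # js)))))"
    using len by (simp add: D_def recursive_coeff_Cons_ambient[OF \<alpha> js] sum.distrib del: recursive_coeff.simps)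
  finally show ?case .
qed

lemma prolonged_coeff_eq_recursive:
  assumes \<alpha>: "\<alpha> \<in> {1..q}" and J: "J \<in> multi_indices p n" and \<epsilon>: "\<epsilon> \<in> {0<..1}" and z: "z \<in> coord_space V"
  shows "prolonged_coeff p q \<xi> \<psi> \<alpha> J \<epsilon> z = recursive_coeff \<alpha> (sorted_list_of_multiset J) \<epsilon> z"
proof -
  have "sorted_list_of_multiset J \<in> lists {1..p}" "length (sorted_list_of_multiset J) \<le> n"
    using J by (auto simp: multi_indices_def simp flip: size_mset)
  from total_derivs_characteristic[OF \<alpha> this \<epsilon> z] show ?thesis
    by (simp add: prolonged_coeff_def)
qed

end

section \<open>The chain rule for the transformed Taylor polynomial\<close>

text \<open>The derivative \<open>\<partial>\<^sub>K\<close> of the Taylor polynomial with jet \<open>z\<close>.\<close>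

definition taylor_pd :: "nat \<Rightarrow> nat \<Rightarrow> point \<Rightarrow> nat \<Rightarrow> nat multiset \<Rightarrow> point \<Rightarrow> real" where
  "taylor_pd p n z \<beta> K y =
     (\<Sum>L | L \<in> multi_indices p n \<and> K \<subseteq># L. z (Dep \<beta> L) * taylor_monom p z (L - K) y)"

lemma taylor_pd_has_partial:
  assumes l: "l \<in> {1..p}"
  shows "has_partial (Ind l) (taylor_pd p n z \<beta> K) (taylor_pd p n z \<beta> (add_mset l K)) y"
proof -
  let ?A = "{L \<in> multi_indices p n. K \<subseteq># L}"
  let ?B = "{L \<in> multi_indices p n. add_mset l K \<subseteq># L}"
  have fin: "finite ?A" by (simp add: finite_multi_indices)
  have iff: "L \<in> ?B \<longleftrightarrow> L \<in> ?A \<and> l \<in># L - K" for L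
    using subset_mset.le_diff_conv2[of K L "{#l#}"] subset_mset.order_trans[of K "add_mset l K" L] by auto
  have "((\<lambda>t. \<Sum>L\<in>?A. z (Dep \<beta> L) * taylor_monom p z (L - K) (y(Ind l := t))) has_real_derivative
      (\<Sum>L\<in>?A. z (Dep \<beta> L) * (if l \<in># L - K then taylor_monom p z (L - K - {#l#}) y else 0))) (at (y (Ind l)))"
    using l by (intro DERIV_sum DERIV_cmult taylor_monom_deriv)
  also have "(\<Sum>L\<in>?A. z (Dep \<beta> L) * (if l \<in># L - K then taylor_monom p z (L - K - {#l#}) y else 0)) =
      (\<Sum>L\<in>?B. z (Dep \<beta> L) * taylor_monom p z (L - add_mset l K) y)"
    by (rule sum.mono_neutral_cong_right[OF fin]) (use iff in auto)
  finally show ?thesis by (simp add: has_partial_def taylor_pd_def fun_upd_def)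
qed

lemma continuous_on_taylor_pd: "continuous_on S (taylor_pd p n z \<beta> K)"
proof -
  have c: "continuous_on S (\<lambda>y. y (Ind i))" for i :: nat
    by (rule continuous_on_subset[OF continuous_on_product_coordinates]) simp
  have "continuous_on S (taylor_monom p z J)" for J
    unfolding taylor_monom_def[abs_def] divide_inverse
    by (intro continuous_on_prod continuous_on_mult_right continuous_on_power continuous_on_diff c continuous_on_const)
  then show ?thesis
    unfolding taylor_pd_def[abs_def]
    by (intro continuous_on_sum continuous_on_mult_left)
qed

lemma taylor_eq_taylor_pd: "\<beta> \<in> {1..q} \<Longrightarrow> taylor p q n z y (Dep \<beta> {#}) = taylor_pd p n z \<beta> {#} y"
  by (simp add: taylor_def taylor_pd_def)

lemma taylor_pd_top:
  assumes "n < size K"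
  shows "taylor_pd p n z \<beta> K y = 0"
proof -
  have "{L \<in> multi_indices p n. K \<subseteq># L} = {}"
    using assms size_mset_mono[of K] by (force simp: multi_indices_def)
  then show ?thesis unfolding taylor_pd_def by (simp only: sum.empty)
qed

lemma taylor_pd_cong:
  assumes "\<And>L. L \<in> multi_indices p n \<Longrightarrow> z (Dep \<beta> L) = z' (Dep \<beta> L)" "\<And>i. i \<in> {1..p} \<Longrightarrow> z (Ind i) = z' (Ind i)"
  shows "taylor_pd p n z \<beta> K y = taylor_pd p n z' \<beta> K y"
  unfolding taylor_pd_def taylor_monom_def
  by (intro sum.cong prod.cong arg_cong2[where f = "(*)"]) (use assms in auto)

lemma sum_base:
  fixes f :: "coord \<Rightarrow> real"
  shows "(\<Sum>c\<in>base p. f c) = (\<Sum>i=1..p. f (Ind i))"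
  unfolding base_def by (subst sum.reindex) (auto simp: inj_on_def)

context projectable_flow
begin

text \<open>The parameter \<open>\<eta>\<close>, the point \<open>y\<close> and the jet of the Taylor polynomial at \<open>\<Xi>\<^sub>-\<^sub>\<eta>(y)\<close>, as one point of the jet
  space. The coordinates of order \<open>n + 1\<close> are zero, the polynomial being of degree \<open>n\<close>.\<close>

definition jet_point :: "real \<Rightarrow> point \<Rightarrow> real \<Rightarrow> point \<Rightarrow> point" where
  "jet_point \<epsilon> z \<eta> y = (\<lambda>c. case c of Par k \<Rightarrow> if k = 1 then \<eta> else 0 | Ind i \<Rightarrow> y (Ind i)
     | Dep \<beta> K \<Rightarrow> if Dep \<beta> K \<in> V then taylor_pd p n z \<beta> K (\<Xi> \<epsilon> (- \<eta>) y) else 0)"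

lemma jet_point_Par: "jet_point \<epsilon> z \<eta> y (Par 1) = \<eta>"
  by (simp add: jet_point_def)

lemma jet_point_Ind: "jet_point \<epsilon> z \<eta> y (Ind i) = y (Ind i)"
  by (simp add: jet_point_def)

lemma jet_point_Dep: "Dep \<beta> K \<in> V \<Longrightarrow> jet_point \<epsilon> z \<eta> y (Dep \<beta> K) = taylor_pd p n z \<beta> K (\<Xi> \<epsilon> (- \<eta>) y)"
  by (simp add: jet_point_def)

lemma jet_point_in:
  assumes y: "y \<in> coord_space (base p)"
  shows "jet_point \<epsilon> z \<eta> y \<in> coord_space (E \<union> V)"
  unfolding coord_space_def
proof (intro CollectI allI impI)
  fix c assume "c \<notin> E \<union> V"
  then show "jet_point \<epsilon> z \<eta> y c = 0"
    using y by (cases c) (auto simp: jet_point_def coord_space_def)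
qed

lemma proj_base_jet_point:
  assumes y: "y \<in> coord_space (base p)"
  shows "proj (base p) (jet_point \<epsilon> z \<eta> y) = y"
proof
  fix c
  show "proj (base p) (jet_point \<epsilon> z \<eta> y) c = y c"
    using y by (cases c) (auto simp: proj_def jet_point_def coord_space_def)
qed

lemma proj_fibre_jet_point: "proj (fibre q) (jet_point \<epsilon> z \<eta> y) = taylor p q n z (\<Xi> \<epsilon> (- \<eta>) y)"
proof
  fix c
  show "proj (fibre q) (jet_point \<epsilon> z \<eta> y) c = taylor p q n z (\<Xi> \<epsilon> (- \<eta>) y) c"
  proof (cases c)
    case (Dep \<beta> K)
    show ?thesis
    proof (cases "\<beta> \<in> {1..q} \<and> K = {#}")
      case True
      then have "Dep \<beta> {#} \<in> V" by simp
      with True show ?thesis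
        unfolding Dep by (simp add: proj_def jet_point_Dep taylor_eq_taylor_pd)
    qed (auto simp: Dep proj_def taylor_def)
  qed (simp_all add: proj_def taylor_def)
qed

lemma inverse_curve_deriv:
  assumes l: "l \<in> {1..p}" and j: "j \<in> {1..p}" and \<epsilon>: "\<epsilon> \<in> {0<..1}" and y: "y \<in> coord_space (base p)"
  shows "((\<lambda>t. \<Xi> \<epsilon> (- \<eta>) (y(Ind j := t)) (Ind l)) has_real_derivative
     pd (Ind j) (flow_inv l \<epsilon>) (jet_point \<epsilon> z \<eta> y)) (at (y (Ind j)))"
proof -
  have "Ind j \<in> E \<union> V" "Ind j \<in> base p" using j by simp_all
  then have "((\<lambda>t. flow_inv l \<epsilon> ((jet_point \<epsilon> z \<eta> y)(Ind j := t))) has_real_derivative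
     pd (Ind j) (flow_inv l \<epsilon>) (jet_point \<epsilon> z \<eta> y)) (at (jet_point \<epsilon> z \<eta> y (Ind j)))"
    using Etau_has_partial[OF flow_at_Etau[OF l] \<epsilon> _ jet_point_in[OF y], of "Ind j"]
    by (simp add: has_partial_def)
  then show ?thesis
    using \<open>Ind j \<in> base p\<close>
    by (simp add: flow_at_def jet_point_Par jet_point_Ind proj_upd_in proj_base_jet_point[OF y])
qed

lemma jet_point_Dep_deriv:
  assumes \<beta>: "Dep \<beta> K \<in> V" and j: "j \<in> {1..p}" and \<epsilon>: "\<epsilon> \<in> {0<..1}" and y: "y \<in> coord_space (base p)"
  shows "((\<lambda>t. jet_point \<epsilon> z \<eta> (y(Ind j := t)) (Dep \<beta> K)) has_real_derivative
     (if K \<in> multi_indices p n then \<Sum>l=1..p. jet_point \<epsilon> z \<eta> y (Dep \<beta> (add_mset l K)) *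
        pd (Ind j) (flow_inv l \<epsilon>) (jet_point \<epsilon> z \<eta> y) else 0)) (at (y (Ind j)))"
proof (cases "K \<in> multi_indices p n")
  case True
  define F where "F c = (case c of Ind l \<Rightarrow> taylor_pd p n z \<beta> (add_mset l K) | _ \<Rightarrow> (\<lambda>_. 0))" for c
  define u' where "u' c = (case c of Ind l \<Rightarrow> pd (Ind j) (flow_inv l \<epsilon>) (jet_point \<epsilon> z \<eta> y) | _ \<Rightarrow> 0)" for c
  have base_cases: "\<exists>l. c = Ind l \<and> l \<in> {1..p}" if "c \<in> base p" for c
    using that by (auto simp: base_def)
  have "((\<lambda>t. taylor_pd p n z \<beta> K (\<Xi> \<epsilon> (- \<eta>) (y(Ind j := t)))) has_real_derivative
     (\<Sum>c\<in>base p. F c (\<Xi> \<epsilon> (- \<eta>) (y(Ind j := y (Ind j)))) * u' c)) (at (y (Ind j)))"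
  proof (rule chain_rule_curve[OF finite_base])
    fix c assume "c \<in> base p"
    then obtain l where l: "c = Ind l" "l \<in> {1..p}" using base_cases by blast
    show "continuous_on (coord_space (base p)) (F c)"
      unfolding F_def l by (simp add: continuous_on_taylor_pd)
    show "has_partial c (taylor_pd p n z \<beta> K) (F c) x" for x
      unfolding F_def l using taylor_pd_has_partial[OF l(2)] by simp
    show "((\<lambda>t. \<Xi> \<epsilon> (- \<eta>) (y(Ind j := t)) c) has_real_derivative u' c) (at (y (Ind j)))"
      unfolding u'_def l using inverse_curve_deriv[OF l(2) j \<epsilon> y] by simp
  next
    show "\<Xi> \<epsilon> (- \<eta>) (y(Ind j := t)) \<in> coord_space (base p)" for t
      using j by (intro Xi_in[OF \<epsilon>] coord_space_upd[OF y]) simp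
  qed
  moreover have "Dep \<beta> (add_mset l K) \<in> V" if "l \<in> {1..p}" for l
    using that \<beta> True by (auto simp: multi_indices_def)
  ultimately show ?thesis
    using True \<beta> by (simp add: jet_point_Dep sum_base F_def u'_def)
next
  case False
  with \<beta> have "n < size K" by (auto simp: multi_indices_def)
  from taylor_pd_top[OF this] show ?thesis using \<beta> False by (simp add: jet_point_Dep)
qed

text \<open>The coordinates of the jet point satisfy \<open>\<partial>\<^sub>j u\<^sub>K = \<Sum>\<^sub>l u\<^sub>K\<^sub>,\<^sub>l \<partial>\<^sub>j(\<Xi>\<^sub>-\<^sub>\<eta>)\<^sub>l\<close>, which is the twist in the definition of the
  transformed derivatives.\<close>

lemma pds_act:
  assumes \<alpha>: "\<alpha> \<in> {1..q}" and "js \<in> lists {1..p}" and \<epsilon>: "\<epsilon> \<in> {0<..1}" and "y \<in> coord_space (base p)"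
  shows "pds (map Ind js) (\<lambda>y. act \<Xi> \<Psi> \<eta> (\<lambda>_. taylor p q n z) \<epsilon> y (Dep \<alpha> {#})) y =
    transformed_deriv \<alpha> js \<epsilon> (jet_point \<epsilon> z \<eta> y)"
  using assms(2,4)
proof (induction js arbitrary: y)
  case Nil
  then show ?case
    by (simp add: act_def jet_point_Par proj_base_jet_point proj_fibre_jet_point)
next
  case (Cons j js)
  then have j: "j \<in> {1..p}" and js: "js \<in> lists {1..p}" and y: "y \<in> coord_space (base p)" by auto
  let ?g = "transformed_deriv \<alpha> js \<epsilon>" and ?m = "jet_point \<epsilon> z \<eta>"
  let ?T = "\<lambda>\<beta> K. \<Sum>l=1..p. ?m y (Dep \<beta> (add_mset l K)) * pd (Ind j) (flow_inv l \<epsilon>) (?m y)"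
  have g: "transformed_deriv \<alpha> js \<in> Etau E V" by (rule transformed_deriv_Etau[OF \<alpha> js])
  define u' where "u' c = (case c of Par k \<Rightarrow> 0 | Ind i \<Rightarrow> if i = j then 1 else 0
     | Dep \<beta> K \<Rightarrow> if K \<in> multi_indices p n then ?T \<beta> K else 0)" for c
  have "((\<lambda>t. ?g (?m (y(Ind j := t)))) has_real_derivative
     (\<Sum>c\<in>E \<union> V. pd c ?g (?m (y(Ind j := y (Ind j)))) * u' c)) (at (y (Ind j)))"
  proof (rule chain_rule_curve[OF fin_EV])
    fix c assume c: "c \<in> E \<union> V"
    show "continuous_on (coord_space (E \<union> V)) (pd c ?g)"
      by (rule Etau_continuous[OF Etau_pd[OF g c] \<epsilon>])
    show "has_partial c ?g (pd c ?g) w" if "w \<in> coord_space (E \<union> V)" for w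
      by (rule Etau_has_partial[OF g \<epsilon> c that])
    show "((\<lambda>t. ?m (y(Ind j := t)) c) has_real_derivative u' c) (at (y (Ind j)))"
    proof (cases c)
      case (Par k)
      then show ?thesis by (simp add: u'_def jet_point_def)
    next
      case (Ind i)
      then show ?thesis by (simp add: u'_def jet_point_Ind)
    next
      case (Dep \<beta> K)
      then have "Dep \<beta> K \<in> V" using c by simp
      from jet_point_Dep_deriv[OF this j \<epsilon> y] show ?thesis by (simp add: u'_def Dep)
    qed
  next
    show "?m (y(Ind j := t)) \<in> coord_space (E \<union> V)" for t
      using j by (intro jet_point_in coord_space_upd[OF y]) simp
  qed
  then have "has_partial (Ind j) (\<lambda>y. ?g (?m y)) (\<lambda>_. \<Sum>c\<in>E \<union> V. pd c ?g (?m y) * u' c) y"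
    by (simp add: has_partial_def)
  note deriv = has_partial_imp_pd[OF this]
  have "pds (map Ind (j # js)) (\<lambda>y. act \<Xi> \<Psi> \<eta> (\<lambda>_. taylor p q n z) \<epsilon> y (Dep \<alpha> {#})) y =
      pd (Ind j) (\<lambda>y. ?g (?m y)) y"
    using j by (simp, intro pd_cong[of "base p", OF Cons.IH[OF _] _ y]) simp_all
  also have "\<dots> = (\<Sum>c\<in>E. pd c ?g (?m y) * u' c) + (\<Sum>c\<in>V. pd c ?g (?m y) * u' c)"
    unfolding deriv using E_disj by (intro sum.union_disjoint fin_V) auto
  also have "(\<Sum>c\<in>E. pd c ?g (?m y) * u' c) = 0" by (simp add: u'_def)
  also have "(\<Sum>c\<in>V. pd c ?g (?m y) * u' c) = (\<Sum>i=1..p. pd (Ind i) ?g (?m y) * u' (Ind i)) +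
      (\<Sum>\<beta>=1..q. \<Sum>K\<in>multi_indices p (n + 1). pd (Dep \<beta> K) ?g (?m y) * u' (Dep \<beta> K))"
    by (rule sum_jets)
  also have "(\<Sum>i=1..p. pd (Ind i) ?g (?m y) * u' (Ind i)) = (\<Sum>i=1..p. if i = j then pd (Ind i) ?g (?m y) else 0)"
    by (rule sum.cong) (auto simp: u'_def)
  also have "\<dots> = pd (Ind j) ?g (?m y)" using j by simp
  also have "(\<Sum>\<beta>=1..q. \<Sum>K\<in>multi_indices p (n + 1). pd (Dep \<beta> K) ?g (?m y) * u' (Dep \<beta> K)) =
      (\<Sum>\<beta>=1..q. \<Sum>K\<in>multi_indices p n. pd (Dep \<beta> K) ?g (?m y) * ?T \<beta> K)"
    using multi_indices_mono[of n "n + 1" p] finite_multi_indices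
    by (intro sum.cong refl sum.mono_neutral_cong_right) (auto simp: u'_def)
  also have "\<dots> = (\<Sum>\<beta>=1..q. \<Sum>K\<in>multi_indices p n. \<Sum>l=1..p.
      pd (Ind j) (flow_inv l \<epsilon>) (?m y) * (?m y (Dep \<beta> (add_mset l K)) * pd (Dep \<beta> K) ?g (?m y)))"
    by (simp add: sum_distrib_left mult_ac)
  also have "\<dots> = (\<Sum>\<beta>=1..q. \<Sum>l=1..p. \<Sum>K\<in>multi_indices p n.
      pd (Ind j) (flow_inv l \<epsilon>) (?m y) * (?m y (Dep \<beta> (add_mset l K)) * pd (Dep \<beta> K) ?g (?m y)))"
    by (intro sum.cong refl sum.swap)
  also have "\<dots> = (\<Sum>l=1..p. \<Sum>\<beta>=1..q. \<Sum>K\<in>multi_indices p n.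
      pd (Ind j) (flow_inv l \<epsilon>) (?m y) * (?m y (Dep \<beta> (add_mset l K)) * pd (Dep \<beta> K) ?g (?m y)))"
    by (rule sum.swap)
  also have "\<dots> = (\<Sum>l=1..p. pd (Ind j) (flow_inv l \<epsilon>) (?m y) * fibre_deriv p q n l ?g (?m y))"
    by (simp add: fibre_deriv_def sum_distrib_left)
  finally show ?case by (simp add: twisted_deriv_def)
qed


section \<open>The prolonged action to first order\<close>

text \<open>The chain rule for differentiation in the parameter, at parameter zero and up to negligible nets. Each
  product of an outer and an inner derivative is replaced as a whole, since often only one of its factors is
  known.\<close>

lemma gen_eq_pd_Par_comp:
  assumes m: "tempered_map E V E V m" and f: "f \<in> Etau E V"
    and Par: "\<And>\<epsilon> w. \<epsilon> \<in> {0<..1} \<Longrightarrow> m \<epsilon> w (Par 1) = w (Par 1)"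
    and a: "gen_eq V (\<lambda>\<epsilon> z. pd (Par 1) (f \<epsilon>) (m \<epsilon> z)) a"
    and b: "\<And>d. d \<in> V \<Longrightarrow> gen_eq V (\<lambda>\<epsilon> z. pd d (f \<epsilon>) (m \<epsilon> z) * pd (Par 1) (\<lambda>w. m \<epsilon> w d) z) (b d)"
  shows "gen_eq V (\<lambda>\<epsilon>. pd (Par 1) (\<lambda>w. f \<epsilon> (m \<epsilon> w))) (\<lambda>\<epsilon> z. a \<epsilon> z + (\<Sum>d\<in>V. b d \<epsilon> z))"
proof (rule gen_eq_cong[OF gen_eq_add[OF fin_V a gen_eq_sum[OF fin_V b]]])
  fix \<epsilon> :: real and z assume \<epsilon>: "\<epsilon> \<in> {0<..1}" and z: "z \<in> coord_space V"
  have "(\<lambda>w. m \<epsilon> w (Par 1)) = (\<lambda>w. w (Par 1))" using Par[OF \<epsilon>] by blast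
  then have one: "pd (Par 1) (\<lambda>w. m \<epsilon> w (Par 1)) z = 1" by (simp add: pd_def)
  have "pd (Par 1) (\<lambda>w. f \<epsilon> (m \<epsilon> w)) z = (\<Sum>d\<in>E \<union> V. pd d (f \<epsilon>) (m \<epsilon> z) * pd (Par 1) (\<lambda>w. m \<epsilon> w d) z)"
    using has_partial_imp_pd[OF has_partial_comp[OF m fin_EV f \<epsilon> _ V_in_EV[OF z], of "Par 1"]] by simp
  also have "\<dots> = (\<Sum>d\<in>E. pd d (f \<epsilon>) (m \<epsilon> z) * pd (Par 1) (\<lambda>w. m \<epsilon> w d) z) +
      (\<Sum>d\<in>V. pd d (f \<epsilon>) (m \<epsilon> z) * pd (Par 1) (\<lambda>w. m \<epsilon> w d) z)"
    using E_disj by (intro sum.union_disjoint fin_V) auto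
  finally show "pd (Par 1) (\<lambda>w. f \<epsilon> (m \<epsilon> w)) z = pd (Par 1) (f \<epsilon>) (m \<epsilon> z) +
      (\<Sum>d\<in>V. pd d (f \<epsilon>) (m \<epsilon> z) * pd (Par 1) (\<lambda>w. m \<epsilon> w d) z)"
    using one by simp
qed simp_all

lemma pd_comp_factors_Etau:
  assumes m: "tempered_map E V E V m" and f: "f \<in> Etau E V" and d: "d \<in> V"
  shows "(\<lambda>\<epsilon> z. pd d (f \<epsilon>) (m \<epsilon> z)) \<in> Etau {} V" "(\<lambda>\<epsilon> z. pd (Par 1) (\<lambda>w. m \<epsilon> w d) z) \<in> Etau {} V"
proof -
  have d': "d \<in> E \<union> V" using d by blast
  show "(\<lambda>\<epsilon> z. pd d (f \<epsilon>) (m \<epsilon> z)) \<in> Etau {} V"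
    by (rule restrict_EV[OF Etau_comp[OF fin_E fin_V m fin_EV Etau_pd[OF f d']]])
  have "(\<lambda>\<epsilon> w. m \<epsilon> w d) \<in> Etau E V" using m d by (simp add: tempered_map_def)
  then show "(\<lambda>\<epsilon> z. pd (Par 1) (\<lambda>w. m \<epsilon> w d) z) \<in> Etau {} V"
    by (intro restrict_EV Etau_pd) simp_all
qed

lemma V_cases:
  assumes "c \<in> V"
  obtains i where "c = Ind i" "i \<in> {1..p}" | \<beta> K where "c = Dep \<beta> K" "\<beta> \<in> {1..q}" "K \<in> multi_indices p (n + 1)"
  using assms by (cases c) (auto simp: Par_notin_jets)

lemma proj_map:
  assumes "U \<subseteq> V"
  shows "tempered_map {} V {} V (\<lambda>\<epsilon>. proj U)"
proof (rule tempered_map_plain)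
  show "proj U z \<in> coord_space V" for z
    using coord_space_mono[OF assms] proj_in[of U z] by blast
  fix c assume "c \<in> V"
  then have "(\<lambda>_ z. z c) \<in> Etau {} V" by (intro Etau_coord[OF _ fin_V]) simp_all
  then show "(\<lambda>\<epsilon> z. proj U z c) \<in> Etau {} V"
    using Etau_const[OF _ fin_V, of "{}" 0] by (cases "c \<in> U") (simp_all add: proj_def)
qed

definition flow_point :: vnet where
  "flow_point = (\<lambda>\<epsilon> w c. if c = Par 1 then w c else \<Xi> \<epsilon> (w (Par 1)) (proj (base p) w) c)"

lemma flow_point_Par: "flow_point \<epsilon> w (Par 1) = w (Par 1)"
  by (simp add: flow_point_def)

lemma flow_point_Ind: "flow_point \<epsilon> w (Ind i) = flow i \<epsilon> w"
  by (simp add: flow_point_def flow_at_def)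

lemma flow_point_Dep: "\<epsilon> \<in> {0<..1} \<Longrightarrow> flow_point \<epsilon> w (Dep \<beta> K) = 0"
  using Xi_in[OF _ proj_in, of \<epsilon> "w (Par 1)" w] by (simp add: flow_point_def coord_space_def)

lemma proj_base_flow_point:
  assumes "\<epsilon> \<in> {0<..1}"
  shows "proj (base p) (flow_point \<epsilon> w) = \<Xi> \<epsilon> (w (Par 1)) (proj (base p) w)"
proof
  fix c
  show "proj (base p) (flow_point \<epsilon> w) c = \<Xi> \<epsilon> (w (Par 1)) (proj (base p) w) c"
    using Xi_in[OF assms proj_in, of "w (Par 1)" w] Par_notin_base[of 1 p]
    by (auto simp: proj_def flow_point_def coord_space_def)
qed

lemma flow_point_map: "tempered_map E V E V flow_point"
proof (rule tempered_map_param[OF fin_V, where \<sigma> = 1])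
  fix \<epsilon> :: real and z assume "\<epsilon> \<in> {0<..1}"
  then have "\<Xi> \<epsilon> (z (Par 1)) (proj (base p) z) \<in> coord_space V"
    using Xi_in[OF _ proj_in] coord_space_mono[OF base_sub] by blast
  then show "flow_point \<epsilon> z \<in> coord_space (E \<union> V)"
    by (simp add: coord_space_def flow_point_def)
next
  fix c assume "c \<in> V"
  then show "(\<lambda>\<epsilon> w. flow_point \<epsilon> w c) \<in> Etau E V"
  proof (cases rule: V_cases)
    case (1 i)
    then show ?thesis by (simp add: flow_point_Ind flow_at_Etau)
  next
    case (2 \<beta> K)
    show ?thesis unfolding 2
      by (rule Etau_cong[OF Etau_const[OF fin_E fin_V, of 0]]) (rule flow_point_Dep)
  qed
qed (simp add: flow_point_Par)

lemma flow_point_map_0: "tempered_map {} V {} V flow_point"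
  by (rule tempered_map_restrict[OF flow_point_map]) (simp_all add: Par_notin_jets flow_point_Par Par_zero)

lemma flow_point_0:
  assumes "c \<in> V"
  shows "gen_eq V (\<lambda>\<epsilon> z. flow_point \<epsilon> z c) (\<lambda>\<epsilon> z. proj (base p) z c)"
  using assms
proof (cases rule: V_cases)
  case (1 i)
  show ?thesis
    by (rule gen_eq_cong[OF flow_at_0[OF 1(2), of 1]]) (use 1 in \<open>simp_all add: flow_point_Ind proj_def\<close>)
next
  case (2 \<beta> K)
  show ?thesis unfolding 2
    by (rule gen_eq_cong[OF gen_eq_const[OF fin_V, of 0]]) (simp only: flow_point_Dep, simp add: proj_def)
qed

text \<open>The deviation of \<open>\<Xi>\<^sub>-\<^sub>\<eta> \<circ> \<Xi>\<^sub>\<eta>\<close> from the identity.\<close>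

definition displacement :: "nat \<Rightarrow> net" where
  "displacement i = (\<lambda>\<epsilon> w. flow_inv i \<epsilon> (flow_point \<epsilon> w) - w (Ind i))"

text \<open>Congruence to a constant to first order in the parameter. Such nets form an algebra.\<close>

definition stationary :: "net \<Rightarrow> real \<Rightarrow> bool" where
  "stationary u a \<longleftrightarrow> u \<in> Etau E V \<and> gen_eq V u (\<lambda>_ _. a) \<and> gen_eq V (\<lambda>\<epsilon>. pd (Par 1) (u \<epsilon>)) (\<lambda>_ _. 0)"

lemma stationary_const: "stationary (\<lambda>_ _. a) a"
  unfolding stationary_def
  using Etau_const[OF fin_E fin_V] gen_eq_const[OF fin_V] by (simp add: pd_def[abs_def])

lemma pd_Par_mult:
  assumes "u \<in> Etau E V" "v \<in> Etau E V" "\<epsilon> \<in> {0<..1}" "z \<in> coord_space V"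
  shows "pd (Par 1) (\<lambda>z. u \<epsilon> z * v \<epsilon> z) z = pd (Par 1) (u \<epsilon>) z * v \<epsilon> z + u \<epsilon> z * pd (Par 1) (v \<epsilon>) z"
  using assms by (intro pd_mult[OF fin_E fin_V] V_in_EV) simp_all

lemma stationary_mult:
  assumes u: "stationary u a" and v: "stationary v b"
  shows "stationary (\<lambda>\<epsilon> z. u \<epsilon> z * v \<epsilon> z) (a * b)"
proof -
  have tau: "u \<in> Etau E V" "v \<in> Etau E V" using u v by (simp_all add: stationary_def)
  have "gen_eq V (\<lambda>\<epsilon> z. pd (Par 1) (u \<epsilon>) z * v \<epsilon> z + u \<epsilon> z * pd (Par 1) (v \<epsilon>) z) (\<lambda>\<epsilon> z. 0 * b + a * 0)"
    using u v by (intro gen_eq_add[OF fin_V] gen_eq_mult[OF fin_V]) (simp_all add: stationary_def)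
  then have "gen_eq V (\<lambda>\<epsilon>. pd (Par 1) (\<lambda>z. u \<epsilon> z * v \<epsilon> z)) (\<lambda>_ _. 0)"
    by (rule gen_eq_cong) (simp_all add: pd_Par_mult[OF tau])
  then show ?thesis
    using u v Etau_mult[OF fin_E fin_V tau] gen_eq_mult[OF fin_V, of u _ v] by (simp add: stationary_def)
qed

lemma stationary_power: "stationary u a \<Longrightarrow> stationary (\<lambda>\<epsilon> z. u \<epsilon> z ^ k) (a ^ k)"
  by (induction k) (simp_all add: stationary_const stationary_mult)

lemma stationary_prod:
  "(\<And>i. i \<in> A \<Longrightarrow> stationary (u i) (a i)) \<Longrightarrow> stationary (\<lambda>\<epsilon> z. \<Prod>i\<in>A. u i \<epsilon> z) (\<Prod>i\<in>A. a i)"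
  by (induction A rule: infinite_finite_induct) (simp_all add: stationary_const stationary_mult)

text \<open>The velocities of the flow and of the inverse flow at parameter zero are congruent to \<open>\<xi>\<close> and \<open>-\<xi>\<close>; they cancel.\<close>

lemma stationary_displacement:
  assumes i: "i \<in> {1..p}"
  shows "stationary (displacement i) 0"
proof -
  have Ind_V: "Ind i \<in> V" using i by simp
  have coord: "(\<lambda>_ w. w (Ind i)) \<in> Etau E V" using i by (intro Etau_coord[OF fin_E fin_V]) simp
  have inv: "flow_inv i \<in> Etau E V" by (rule flow_at_Etau[OF i])
  have comp: "(\<lambda>\<epsilon> w. flow_inv i \<epsilon> (flow_point \<epsilon> w)) \<in> Etau E V"
    by (rule Etau_comp[OF fin_E fin_V flow_point_map fin_EV inv])
  have tau: "displacement i \<in> Etau E V"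
    unfolding displacement_def by (rule Etau_diff[OF fin_E fin_V comp coord])
  have pmap: "tempered_map {} V {} V (\<lambda>\<epsilon>. proj (base p))" by (rule proj_map[OF base_sub])
  have "gen_eq V (\<lambda>\<epsilon> z. flow_inv i \<epsilon> (flow_point \<epsilon> z)) (\<lambda>\<epsilon> z. proj (base p) z (Ind i))"
    by (rule gen_eq_comp[OF fin_V fin_V flow_at_0[OF i] flow_point_map_0 pmap flow_point_0])
  from gen_eq_add[OF fin_V this gen_eq_uminus[OF fin_V gen_eq_coord[OF fin_V Ind_V]]]
  have 0: "gen_eq V (displacement i) (\<lambda>_ _. 0)"
    by (rule gen_eq_cong) (use i in \<open>simp_all add: displacement_def proj_def\<close>)
  have "gen_eq V (\<lambda>\<epsilon>. pd (Par 1) (\<lambda>w. flow_inv i \<epsilon> (flow_point \<epsilon> w)))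
     (\<lambda>\<epsilon> z. - \<xi> i \<epsilon> (proj (base p) (proj (base p) z)) + (\<Sum>d\<in>V. if d = Ind i then \<xi> i \<epsilon> (proj (base p) z) else 0))"
  proof (rule gen_eq_pd_Par_comp[OF flow_point_map inv flow_point_Par])
    show "gen_eq V (\<lambda>\<epsilon> z. pd (Par 1) (flow_inv i \<epsilon>) (flow_point \<epsilon> z)) (\<lambda>\<epsilon> z. - \<xi> i \<epsilon> (proj (base p) (proj (base p) z)))"
      by (rule gen_eq_comp[OF fin_V fin_V flow_inv_1[OF i] flow_point_map_0 pmap flow_point_0])
    fix d assume d: "d \<in> V"
    from d show "gen_eq V (\<lambda>\<epsilon> z. pd d (flow_inv i \<epsilon>) (flow_point \<epsilon> z) * pd (Par 1) (\<lambda>w. flow_point \<epsilon> w d) z)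
        (\<lambda>\<epsilon> z. if d = Ind i then \<xi> i \<epsilon> (proj (base p) z) else 0)"
    proof (cases rule: V_cases)
      case (1 l)
      have "gen_eq V (\<lambda>\<epsilon>. pd d (flow_inv i \<epsilon>)) (\<lambda>_. pd d (\<lambda>z. z (Ind i)))"
        by (rule gen_eq_pd[OF fin_V flow_at_0[OF i] d])
      from gen_eq_comp[OF fin_V fin_V this flow_point_map_0 pmap flow_point_0]
      have "gen_eq V (\<lambda>\<epsilon> z. pd d (flow_inv i \<epsilon>) (flow_point \<epsilon> z)) (\<lambda>\<epsilon> z. pd d (\<lambda>z. z (Ind i)) (proj (base p) z))" .
      from gen_eq_mult[OF fin_V this flow_1[OF 1(2)]]
      show ?thesis by (rule gen_eq_cong) (auto simp: 1 flow_point_Ind pd_def)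
    next
      case (2 \<beta> K)
      have "gen_eq V (\<lambda>\<epsilon> z. pd d (flow_inv i \<epsilon>) (flow_point \<epsilon> z) * 0) (\<lambda>_ _. 0)"
        using gen_eq_const[OF fin_V, of 0] by simp
      then show ?thesis
      proof (rule gen_eq_cong)
        fix \<epsilon> :: real and z assume "\<epsilon> \<in> {0<..1}"
        then have "(\<lambda>w. flow_point \<epsilon> w d) = (\<lambda>_. 0)" unfolding 2 by (intro ext flow_point_Dep)
        then show "pd d (flow_inv i \<epsilon>) (flow_point \<epsilon> z) * pd (Par 1) (\<lambda>w. flow_point \<epsilon> w d) z =
            pd d (flow_inv i \<epsilon>) (flow_point \<epsilon> z) * 0" by (simp add: pd_def)
      qed (simp add: 2)
    qed
  qed
  then have "gen_eq V (\<lambda>\<epsilon>. pd (Par 1) (displacement i \<epsilon>)) (\<lambda>_ _. 0)"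
  proof (rule gen_eq_cong)
    fix \<epsilon> :: real and z assume \<epsilon>: "\<epsilon> \<in> {0<..1}" and z: "z \<in> coord_space V"
    have "has_partial (Par 1) (\<lambda>w. flow_inv i \<epsilon> (flow_point \<epsilon> w)) (pd (Par 1) (\<lambda>w. flow_inv i \<epsilon> (flow_point \<epsilon> w))) z"
      using Etau_has_partial[OF comp \<epsilon> _ V_in_EV[OF z], of "Par 1"] by simp
    then have "has_partial (Par 1) (displacement i \<epsilon>) (pd (Par 1) (\<lambda>w. flow_inv i \<epsilon> (flow_point \<epsilon> w))) z"
      unfolding has_partial_def displacement_def by (auto intro!: derivative_eq_intros)
    then show "pd (Par 1) (displacement i \<epsilon>) z = pd (Par 1) (\<lambda>w. flow_inv i \<epsilon> (flow_point \<epsilon> w)) z"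
      by (rule has_partial_imp_pd)
    show "0 = - \<xi> i \<epsilon> (proj (base p) (proj (base p) z)) + (\<Sum>d\<in>V. if d = Ind i then \<xi> i \<epsilon> (proj (base p) z) else 0)"
      using Ind_V fin_V by (simp add: proj_proj)
  qed
  with tau 0 show ?thesis by (simp add: stationary_def)
qed

definition displacement_monom :: "nat multiset \<Rightarrow> net" where
  "displacement_monom J = (\<lambda>\<epsilon> w. \<Prod>i=1..p. displacement i \<epsilon> w ^ count J i * inverse (fact (count J i)))"

lemma stationary_displacement_monom:
  assumes J: "set_mset J \<subseteq> {1..p}"
  shows "stationary (displacement_monom J) (if J = {#} then 1 else 0)"
proof -
  have "stationary (displacement_monom J) (\<Prod>i=1..p. 0 ^ count J i * inverse (fact (count J i)))"
    unfolding displacement_monom_def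
    by (intro stationary_prod stationary_mult stationary_power stationary_displacement stationary_const)
  moreover have "(\<Prod>i=1..p. 0 ^ count J i * inverse (fact (count J i))) = (if J = {#} then 1 else 0 :: real)"
  proof (cases "J = {#}")
    case False
    then obtain i where "i \<in># J" by (meson multiset_nonemptyE)
    then have "(0::real) ^ count J i * inverse (fact (count J i)) = 0" "i \<in> {1..p}"
      using J by (auto simp: zero_power)
    then have "(\<Prod>i=1..p. 0 ^ count J i * inverse (fact (count J i)) :: real) = 0"
      by (intro prod_zero) auto
    with False show ?thesis by simp
  qed simp
  ultimately show ?thesis by simp
qed

text \<open>The point at which the transformed derivative is evaluated in the prolonged action.\<close>

definition prolong_point :: vnet where
  "prolong_point = (\<lambda>\<epsilon> w. jet_point \<epsilon> w (w (Par 1)) (\<Xi> \<epsilon> (w (Par 1)) (proj (base p) w)))"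

lemma prolong_point_Par: "prolong_point \<epsilon> w (Par 1) = w (Par 1)"
  by (simp add: prolong_point_def jet_point_Par)

lemma prolong_point_Ind: "prolong_point \<epsilon> w (Ind i) = flow i \<epsilon> w"
  by (simp add: prolong_point_def jet_point_Ind flow_at_def)

lemma prolong_point_Dep:
  assumes "\<epsilon> \<in> {0<..1}" "Dep \<beta> K \<in> V"
  shows "prolong_point \<epsilon> w (Dep \<beta> K) =
    (\<Sum>L | L \<in> multi_indices p n \<and> K \<subseteq># L. w (Dep \<beta> L) * displacement_monom (L - K) \<epsilon> w)"
proof -
  have "displacement i \<epsilon> w = \<Xi> \<epsilon> (- w (Par 1)) (\<Xi> \<epsilon> (w (Par 1)) (proj (base p) w)) (Ind i) - w (Ind i)" for i
    by (simp add: displacement_def flow_at_def flow_point_Par proj_base_flow_point[OF assms(1)])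
  then show ?thesis using assms(2)
    by (simp add: prolong_point_def jet_point_Dep taylor_pd_def taylor_monom_def displacement_monom_def divide_inverse)
qed

text \<open>By Taylor's formula the jet at \<open>\<Xi>\<^sub>-\<^sub>\<eta>(\<Xi>\<^sub>\<eta>(x))\<close> depends on \<open>\<eta>\<close> through monomials in the displacement, all of which are
  stationary. At \<open>\<eta> = 0\<close> all of them except the empty monomial are negligible.\<close>

lemma prolong_point_Dep_expansion:
  assumes \<beta>: "\<beta> \<in> {1..q}" and K: "K \<in> multi_indices p (n + 1)"
  shows "(\<lambda>\<epsilon> w. prolong_point \<epsilon> w (Dep \<beta> K)) \<in> Etau E V"
    "gen_eq V (\<lambda>\<epsilon> z. prolong_point \<epsilon> z (Dep \<beta> K)) (\<lambda>\<epsilon> z. proj (jets p q n) z (Dep \<beta> K))"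
    "gen_eq V (\<lambda>\<epsilon>. pd (Par 1) (\<lambda>w. prolong_point \<epsilon> w (Dep \<beta> K))) (\<lambda>_ _. 0)"
proof -
  let ?A = "{L \<in> multi_indices p n. K \<subseteq># L}"
  let ?s = "\<lambda>\<epsilon> w. \<Sum>L\<in>?A. w (Dep \<beta> L) * displacement_monom (L - K) \<epsilon> w"
  have DV: "Dep \<beta> K \<in> V" using \<beta> K by simp
  have fin: "finite ?A" by (simp add: finite_multi_indices)
  have sub: "L - K = {#} \<longleftrightarrow> L = K" if "L \<in> ?A" for L
    using that by (auto simp: Diff_eq_empty_iff_mset subset_mset.antisym)
  have stat: "stationary (displacement_monom (L - K)) (if L = K then 1 else 0)" if "L \<in> ?A" for L
  proof -
    have "set_mset (L - K) \<subseteq> {1..p}" using that by (auto simp: multi_indices_def dest: in_diffD)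
    from stationary_displacement_monom[OF this] show ?thesis by (simp only: sub[OF that])
  qed
  have L_V: "Dep \<beta> L \<in> V" if "L \<in> ?A" for L
    using that \<beta> multi_indices_mono[of n "n + 1" p] by auto
  have coord: "(\<lambda>_ w. w (Dep \<beta> L)) \<in> Etau E V" if "L \<in> ?A" for L
    using L_V[OF that] by (intro Etau_coord[OF fin_E fin_V]) simp
  have monom: "displacement_monom (L - K) \<in> Etau E V" if "L \<in> ?A" for L
    using stat[OF that] by (simp add: stationary_def)
  have summand: "(\<lambda>\<epsilon> w. w (Dep \<beta> L) * displacement_monom (L - K) \<epsilon> w) \<in> Etau E V" if "L \<in> ?A" for L
    by (rule Etau_mult[OF fin_E fin_V coord[OF that] monom[OF that]])
  have s_tau: "?s \<in> Etau E V" by (rule Etau_sum[OF fin_E fin_V summand])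
  then show "(\<lambda>\<epsilon> w. prolong_point \<epsilon> w (Dep \<beta> K)) \<in> Etau E V"
    by (rule Etau_cong) (simp only: prolong_point_Dep[OF _ DV])
  have "gen_eq V ?s (\<lambda>\<epsilon> z. \<Sum>L\<in>?A. z (Dep \<beta> L) * (if L = K then 1 else 0))"
    using stat L_V by (intro gen_eq_sum[OF fin_V] gen_eq_mult[OF fin_V] gen_eq_coord[OF fin_V])
      (simp_all add: stationary_def)
  then show "gen_eq V (\<lambda>\<epsilon> z. prolong_point \<epsilon> z (Dep \<beta> K)) (\<lambda>\<epsilon> z. proj (jets p q n) z (Dep \<beta> K))"
  proof (rule gen_eq_cong)
    fix \<epsilon> :: real and z :: point
    have "(\<Sum>L\<in>?A. z (Dep \<beta> L) * (if L = K then 1 else 0)) = (\<Sum>L\<in>?A. if L = K then z (Dep \<beta> L) else 0)"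
      by (rule sum.cong) auto
    then show "proj (jets p q n) z (Dep \<beta> K) = (\<Sum>L\<in>?A. z (Dep \<beta> L) * (if L = K then 1 else 0))"
      using fin \<beta> by (simp add: proj_def)
  qed (simp only: prolong_point_Dep[OF _ DV])
  have "gen_eq V (\<lambda>\<epsilon> z. \<Sum>L\<in>?A. z (Dep \<beta> L) * pd (Par 1) (displacement_monom (L - K) \<epsilon>) z) (\<lambda>\<epsilon> z. \<Sum>L\<in>?A. z (Dep \<beta> L) * 0)"
    using stat L_V by (intro gen_eq_sum[OF fin_V] gen_eq_mult[OF fin_V] gen_eq_coord[OF fin_V])
      (simp_all add: stationary_def)
  then show "gen_eq V (\<lambda>\<epsilon>. pd (Par 1) (\<lambda>w. prolong_point \<epsilon> w (Dep \<beta> K))) (\<lambda>_ _. 0)"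
  proof (rule gen_eq_cong)
    fix \<epsilon> :: real and z assume \<epsilon>: "\<epsilon> \<in> {0<..1}" and z: "z \<in> coord_space V"
    have P: "Par 1 \<in> E \<union> V" by simp
    have "(\<lambda>w. prolong_point \<epsilon> w (Dep \<beta> K)) = ?s \<epsilon>"
      using prolong_point_Dep[OF \<epsilon> DV] by blast
    then have "pd (Par 1) (\<lambda>w. prolong_point \<epsilon> w (Dep \<beta> K)) z =
        (\<Sum>L\<in>?A. pd (Par 1) (\<lambda>w. w (Dep \<beta> L) * displacement_monom (L - K) \<epsilon> w) z)"
      using pd_sum[OF fin_E fin_V \<epsilon> P V_in_EV[OF z] fin summand] by simp
    also have "\<dots> = (\<Sum>L\<in>?A. z (Dep \<beta> L) * pd (Par 1) (displacement_monom (L - K) \<epsilon>) z)"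
      by (intro sum.cong refl, subst pd_Par_mult[OF coord monom \<epsilon> z]) (simp_all add: pd_def)
    finally show "pd (Par 1) (\<lambda>w. prolong_point \<epsilon> w (Dep \<beta> K)) z =
        (\<Sum>L\<in>?A. z (Dep \<beta> L) * pd (Par 1) (displacement_monom (L - K) \<epsilon>) z)" .
  qed simp
qed

lemma prolong_point_map: "tempered_map E V E V prolong_point"
proof (rule tempered_map_param[OF fin_V, where \<sigma> = 1])
  fix \<epsilon> :: real and z assume "\<epsilon> \<in> {0<..1}"
  then show "prolong_point \<epsilon> z \<in> coord_space (E \<union> V)"
    unfolding prolong_point_def by (intro jet_point_in Xi_in proj_in)
next
  fix c assume "c \<in> V"
  then show "(\<lambda>\<epsilon> w. prolong_point \<epsilon> w c) \<in> Etau E V"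
  proof (cases rule: V_cases)
    case (1 i)
    then show ?thesis by (simp add: prolong_point_Ind flow_at_Etau)
  next
    case (2 \<beta> K)
    then show ?thesis using prolong_point_Dep_expansion(1) by simp
  qed
qed (simp add: prolong_point_Par)

lemma prolong_point_map_0: "tempered_map {} V {} V prolong_point"
  by (rule tempered_map_restrict[OF prolong_point_map]) (simp_all add: Par_notin_jets prolong_point_Par Par_zero)

lemma prolong_point_0:
  assumes "c \<in> V"
  shows "gen_eq V (\<lambda>\<epsilon> z. prolong_point \<epsilon> z c) (\<lambda>\<epsilon> z. proj (jets p q n) z c)"
  using assms
proof (cases rule: V_cases)
  case (1 i)
  show ?thesis
    by (rule gen_eq_cong[OF flow_at_0[OF 1(2), of 1]]) (use 1 in \<open>simp_all add: prolong_point_Ind proj_def\<close>)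
next
  case (2 \<beta> K)
  then show ?thesis using prolong_point_Dep_expansion(2) by simp
qed

lemma jets_n_map: "tempered_map {} V {} V (\<lambda>\<epsilon>. proj (jets p q n))"
  by (rule proj_map) (simp add: jets_mono)

text \<open>Of the terms of the chain rule only the derivative in the parameter remains. The base point moves with
  velocity \<open>\<xi>\<close>, but the transformed derivative is congruent to \<open>u\<^sub>J\<close>, which does not depend on it; and the jet
  coordinates do not move to first order.\<close>

lemma prolonged_derivative:
  assumes \<alpha>: "\<alpha> \<in> {1..q}" and js: "js \<in> lists {1..p}" and len: "length js \<le> n"
  shows "gen_eq V (\<lambda>\<epsilon>. pd (Par 1) (\<lambda>w. transformed_deriv \<alpha> js \<epsilon> (prolong_point \<epsilon> w))) (recursive_coeff \<alpha> js)"
proof -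
  have g: "transformed_deriv \<alpha> js \<in> Etau E V" by (rule transformed_deriv_Etau[OF \<alpha> js])
  have g0: "gen_eq V (transformed_deriv \<alpha> js) (\<lambda>_ z. z (Dep \<alpha> (mset js)))"
    using len by (intro transformed_deriv_0 \<alpha> js) simp
  have g1: "gen_eq V (\<lambda>\<epsilon>. pd (Par 1) (transformed_deriv \<alpha> js \<epsilon>)) (recursive_coeff \<alpha> js)"
    using len by (intro transformed_deriv_1 \<alpha> js) simp
  have "gen_eq V (\<lambda>\<epsilon>. pd (Par 1) (\<lambda>w. transformed_deriv \<alpha> js \<epsilon> (prolong_point \<epsilon> w)))
     (\<lambda>\<epsilon> z. recursive_coeff \<alpha> js \<epsilon> (proj (jets p q n) z) + (\<Sum>d\<in>V. 0))"
  proof (rule gen_eq_pd_Par_comp[OF prolong_point_map g prolong_point_Par])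
    show "gen_eq V (\<lambda>\<epsilon> z. pd (Par 1) (transformed_deriv \<alpha> js \<epsilon>) (prolong_point \<epsilon> z))
        (\<lambda>\<epsilon> z. recursive_coeff \<alpha> js \<epsilon> (proj (jets p q n) z))"
      by (rule gen_eq_comp[OF fin_V fin_V g1 prolong_point_map_0 jets_n_map prolong_point_0])
    fix d assume d: "d \<in> V"
    note tau = pd_comp_factors_Etau[OF prolong_point_map g d]
    from d show "gen_eq V (\<lambda>\<epsilon> z. pd d (transformed_deriv \<alpha> js \<epsilon>) (prolong_point \<epsilon> z) *
        pd (Par 1) (\<lambda>w. prolong_point \<epsilon> w d) z) (\<lambda>_ _. 0)"
    proof (cases rule: V_cases)
      case (1 i)
      have "gen_eq V (\<lambda>\<epsilon> z. pd d (transformed_deriv \<alpha> js \<epsilon>) (prolong_point \<epsilon> z))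
          (\<lambda>\<epsilon> z. pd d (\<lambda>z. z (Dep \<alpha> (mset js))) (proj (jets p q n) z))"
        by (rule gen_eq_comp[OF fin_V fin_V gen_eq_pd[OF fin_V g0 d] prolong_point_map_0 jets_n_map prolong_point_0])
      from gen_eq_mult[OF fin_V this gen_eq_refl[OF tau(2)]]
      show ?thesis by (rule gen_eq_cong) (simp_all add: 1 pd_def)
    next
      case (2 \<beta> K)
      from gen_eq_mult[OF fin_V gen_eq_refl[OF tau(1)], OF prolong_point_Dep_expansion(3)[OF 2(2,3)]]
      show ?thesis unfolding 2 by simp
    qed
  qed
  then show ?thesis
  proof (rule gen_eq_cong)
    fix \<epsilon> :: real and z
    have "proj (jets p q (length js)) (proj (jets p q n) z) = proj (jets p q (length js)) z"
      by (rule proj_proj[OF jets_mono[OF len]])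
    then have "recursive_coeff \<alpha> js \<epsilon> (proj (jets p q n) z) = recursive_coeff \<alpha> js \<epsilon> z"
      using recursive_coeff_proj[OF \<alpha> js, of \<epsilon> "proj (jets p q n) z"] recursive_coeff_proj[OF \<alpha> js, of \<epsilon> z] by simp
    then show "recursive_coeff \<alpha> js \<epsilon> z = recursive_coeff \<alpha> js \<epsilon> (proj (jets p q n) z) + (\<Sum>d\<in>V. 0)" by simp
  qed simp
qed


section \<open>The generator of the prolonged action\<close>

lemma prolong_Ind: "prolong p q n \<Xi> \<Psi> \<epsilon> \<eta> z (Ind i) = \<Xi> \<epsilon> \<eta> (proj (base p) z) (Ind i)"
  by (simp add: prolong_def Let_def pair_def pr_fun_def)

lemma prolong_Dep:
  assumes \<epsilon>: "\<epsilon> \<in> {0<..1}" and \<alpha>: "\<alpha> \<in> {1..q}" and J: "J \<in> multi_indices p n"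
  shows "prolong p q n \<Xi> \<Psi> \<epsilon> \<eta> z (Dep \<alpha> J) =
    transformed_deriv \<alpha> (sorted_list_of_multiset J) \<epsilon> (jet_point \<epsilon> z \<eta> (\<Xi> \<epsilon> \<eta> (proj (base p) z)))"
proof -
  let ?x = "\<Xi> \<epsilon> \<eta> (proj (base p) z)"
  have x: "?x \<in> coord_space (base p)" by (rule Xi_in[OF \<epsilon> proj_in])
  have js: "sorted_list_of_multiset J \<in> lists {1..p}" using J by (auto simp: multi_indices_def)
  have "?x (Dep \<alpha> J) = 0" using x by (simp add: coord_space_def)
  then show ?thesis
    using pds_act[OF \<alpha> js \<epsilon> x, of \<eta> z] \<alpha> J by (simp add: prolong_def Let_def pair_def pr_fun_def)
qed

lemma generator_Ind:
  assumes i: "i \<in> {1..p}"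
  shows "gen_eq V (\<lambda>\<epsilon> z. generator (prolong p q n \<Xi> \<Psi>) \<epsilon> (proj (jets p q n) z) (Ind i)) (\<lambda>\<epsilon> z. \<xi> i \<epsilon> (proj (base p) z))"
proof (rule gen_eq_cong[OF flow_1[OF i]])
  fix \<epsilon> :: real and z assume "\<epsilon> \<in> {0<..1}" "z \<in> coord_space V"
  from DERIV_imp_deriv[OF flow_has_derivative[OF i this]]
  show "generator (prolong p q n \<Xi> \<Psi>) \<epsilon> (proj (jets p q n) z) (Ind i) = pd (Par 1) (flow i \<epsilon>) z"
    by (simp add: generator_def prolong_Ind proj_proj[OF base_subset_jets])
qed simp

lemma jet_point_cong:
  assumes "\<And>\<alpha> J. \<alpha> \<in> {1..q} \<Longrightarrow> J \<in> multi_indices p n \<Longrightarrow> z (Dep \<alpha> J) = z' (Dep \<alpha> J)"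
    "\<And>i. i \<in> {1..p} \<Longrightarrow> z (Ind i) = z' (Ind i)"
  shows "jet_point \<epsilon> z \<eta> y = jet_point \<epsilon> z' \<eta> y"
proof
  fix c
  show "jet_point \<epsilon> z \<eta> y c = jet_point \<epsilon> z' \<eta> y c"
  proof (cases c)
    case (Dep \<beta> K)
    show ?thesis
    proof (cases "Dep \<beta> K \<in> V")
      case True
      then have "\<beta> \<in> {1..q}" by simp
      then show ?thesis using taylor_pd_cong[of p n z \<beta> z' K] assms True
        unfolding Dep by (simp add: jet_point_Dep)
    next
      case False
      then show ?thesis by (simp only: Dep jet_point_def coord.case if_False)
    qed
  qed (simp_all add: jet_point_def)
qed

lemma generator_Dep:
  assumes \<alpha>: "\<alpha> \<in> {1..q}" and J: "J \<in> multi_indices p n"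
  shows "gen_eq V (\<lambda>\<epsilon> z. generator (prolong p q n \<Xi> \<Psi>) \<epsilon> (proj (jets p q n) z) (Dep \<alpha> J))
    (recursive_coeff \<alpha> (sorted_list_of_multiset J))"
proof -
  let ?js = "sorted_list_of_multiset J"
  have js: "?js \<in> lists {1..p}" "length ?js \<le> n"
    using J by (auto simp: multi_indices_def simp flip: size_mset)
  show ?thesis
  proof (rule gen_eq_cong[OF prolonged_derivative[OF \<alpha> js]])
    fix \<epsilon> :: real and z assume \<epsilon>: "\<epsilon> \<in> {0<..1}" and z: "z \<in> coord_space V"
    let ?z = "proj (jets p q n) z"
    have base: "proj (base p) ?z = proj (base p) z" by (rule proj_proj[OF base_subset_jets])
    have jp: "jet_point \<epsilon> ?z \<eta> y = jet_point \<epsilon> (z(Par 1 := \<eta>)) \<eta> y" for \<eta> y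
      by (rule jet_point_cong) (simp_all add: proj_def)
    have "generator (prolong p q n \<Xi> \<Psi>) \<epsilon> ?z (Dep \<alpha> J) =
        deriv (\<lambda>\<eta>. transformed_deriv \<alpha> ?js \<epsilon> (jet_point \<epsilon> (z(Par 1 := \<eta>)) \<eta> (\<Xi> \<epsilon> \<eta> (proj (base p) z)))) 0"
      by (simp add: generator_def prolong_Dep[OF \<epsilon> \<alpha> J] base jp)
    also have "\<dots> = pd (Par 1) (\<lambda>w. transformed_deriv \<alpha> ?js \<epsilon> (prolong_point \<epsilon> w)) z"
      by (simp add: pd_def prolong_point_def Par_zero[OF z] proj_upd_notin)
    finally show "generator (prolong p q n \<Xi> \<Psi>) \<epsilon> ?z (Dep \<alpha> J) =
      pd (Par 1) (\<lambda>w. transformed_deriv \<alpha> ?js \<epsilon> (prolong_point \<epsilon> w)) z" .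
  qed simp
qed

end

lemma Ntau_imp_Etau:
  assumes "u \<in> Ntau W V"
  shows "u \<in> Etau W V"
proof -
  have "mod_on V Z f" if neg: "neg_on V Z f" for Z f
  proof -
    obtain r where "\<forall>\<^sub>F \<epsilon> in at_right 0. \<forall>z\<in>Z. \<bar>f \<epsilon> z\<bar> \<le> scale V \<epsilon> z ^ r * \<epsilon> ^ (0::nat)"
      using neg unfolding neg_on_def by blast
    then show ?thesis unfolding mod_on_def by auto
  qed
  then show ?thesis
    using assms unfolding Ntau_def Etau_def neg_on_iff_wbound mod_on_iff_wbound by blast
qed

lemma Ntau_imp_gen_eq:
  assumes V: "finite V" and u: "u \<in> Etau {} V" and n: "(\<lambda>\<epsilon> z. u \<epsilon> z - v \<epsilon> z) \<in> Ntau {} V"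
  shows "gen_eq V u v"
proof -
  have "(\<lambda>\<epsilon> z. u \<epsilon> z - (u \<epsilon> z - v \<epsilon> z)) \<in> Etau {} V"
    by (rule Etau_diff[OF _ V u Ntau_imp_Etau[OF n]]) simp
  moreover have "negligible V (\<lambda>\<epsilon> z. u \<epsilon> z - v \<epsilon> z)"
    using Ntau_imp_negligible_pds[OF n, of "[]"] by simp
  ultimately show ?thesis using u by (simp add: gen_eq_def)
qed

text \<open>A congruence on the space with parameters may be differentiated in a parameter before the parameters are
  set to zero.\<close>

lemma Ntau_imp_gen_eq_restrict:
  assumes W: "finite W" and V: "finite V" and disj: "W \<inter> V = {}" and c: "c \<in> W"
    and u: "u \<in> Etau W V" and n: "(\<lambda>\<epsilon> z. u \<epsilon> z - v \<epsilon> z) \<in> Ntau W V"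
  shows "gen_eq V u v" "gen_eq V (\<lambda>\<epsilon>. pd c (u \<epsilon>)) (\<lambda>\<epsilon>. pd c (v \<epsilon>))"
proof -
  have "(\<lambda>\<epsilon> z. u \<epsilon> z - (u \<epsilon> z - v \<epsilon> z)) \<in> Etau W V"
    by (rule Etau_diff[OF W V u Ntau_imp_Etau[OF n]])
  then have v: "v \<in> Etau W V" by simp
  have cWV: "c \<in> W \<union> V" using c by simp
  show "gen_eq V u v"
    using Ntau_imp_negligible_pds[OF n disj, of "[]"] Etau_restrict[OF u disj] Etau_restrict[OF v disj]
    by (simp add: gen_eq_def)
  have "negligible V (\<lambda>\<epsilon>. pd c (\<lambda>z. u \<epsilon> z - v \<epsilon> z))"
    using Ntau_imp_negligible_pds[OF n disj, of "[c]"] c by simp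
  then have "negligible V (\<lambda>\<epsilon> z. pd c (u \<epsilon>) z - pd c (v \<epsilon>) z)"
    unfolding negligible_def
  proof (rule neg_on_cong)
    fix \<epsilon> :: real and z assume \<epsilon>: "\<epsilon> \<in> {0<..1}" and "z \<in> coord_space V"
    then have "z \<in> coord_space (W \<union> V)" using coord_space_mono[of V "W \<union> V"] by blast
    then have "has_partial c (\<lambda>z. u \<epsilon> z - v \<epsilon> z) (\<lambda>z. pd c (u \<epsilon>) z - pd c (v \<epsilon>) z) z"
      using Etau_has_partial[OF u \<epsilon> cWV] Etau_has_partial[OF v \<epsilon> cWV]
      unfolding has_partial_def by (intro DERIV_diff)
    then show "pd c (u \<epsilon>) z - pd c (v \<epsilon>) z = pd c (\<lambda>z. u \<epsilon> z - v \<epsilon> z) z"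
      by (simp add: has_partial_imp_pd)
  qed
  then show "gen_eq V (\<lambda>\<epsilon>. pd c (u \<epsilon>)) (\<lambda>\<epsilon>. pd c (v \<epsilon>))"
    using Etau_restrict[OF Etau_pd[OF u cWV] disj] Etau_restrict[OF Etau_pd[OF v cWV] disj]
    by (simp add: gen_eq_def)
qed

lemma vector_field_Ind: "i \<in> {1..p} \<Longrightarrow> vector_field p q \<xi> \<psi> \<epsilon> z (Ind i) = \<xi> i \<epsilon> (proj (base p) z)"
  by (simp add: vector_field_def coord_field_def if_distrib cong: if_cong)

lemma vector_field_Dep:
  "\<alpha> \<in> {1..q} \<Longrightarrow> vector_field p q \<xi> \<psi> \<epsilon> z (Dep \<alpha> J) = (if J = {#} then \<psi> \<alpha> \<epsilon> (proj (jets p q 0) z) else 0)"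
  by (simp add: vector_field_def coord_field_def if_distrib cong: if_cong)

text \<open>The congruence between \<open>\<Phi>\<close> and \<open>(\<Xi>, \<Psi>)\<close> transfers the value and the velocity of \<open>\<Phi>\<close> at parameter zero to the
  components.\<close>

lemma projectable_flow_of_action:
  assumes xi: "\<And>i. i \<in> {1..p} \<Longrightarrow> \<xi> i \<in> Etau {} (base p)"
    and psi: "\<And>\<alpha>. \<alpha> \<in> {1..q} \<Longrightarrow> \<psi> \<alpha> \<in> Etau {} (jets p q 0)"
    and complete: "G_n_complete p q n (vector_field p q \<xi> \<psi>) \<Phi> \<Xi> \<Psi>"
  shows "projectable_flow p q \<xi> \<psi> \<Xi> \<Psi>"
proof -
  let ?V = "jets p q 0" and ?E = "{Par 1}"
  let ?H = "\<lambda>\<epsilon> \<eta> z. pair (\<Xi> \<epsilon> \<eta> (proj (base p) z)) (\<Psi> \<epsilon> \<eta> z)"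
  have fin: "finite ?V" by (rule finite_jets)
  have disj: "?E \<inter> ?V = {}" using Par_notin_jets by auto
  have Phi_tau: "(\<lambda>\<epsilon> w. uncurried ?V \<Phi> \<epsilon> w c) \<in> Etau ?E ?V" if "c \<in> ?V" for c
    using complete that by (simp add: G_n_complete_def group_action_def moderate_action_def)
  have Xi: "moderate_action (base p) (base p) \<Xi>" and Psi: "moderate_action ?V (fibre q) \<Psi>"
    using complete by (simp_all add: G_n_complete_def projectable_def)
  have PhiH: "(\<lambda>\<epsilon> w. uncurried ?V \<Phi> \<epsilon> w c - uncurried ?V ?H \<epsilon> w c) \<in> Ntau ?E ?V" if "c \<in> ?V" for c
    using complete that by (simp add: G_n_complete_def projectable_def tau_eq_def)
  have congr: "gen_eq ?V (\<lambda>\<epsilon> w. uncurried ?V \<Phi> \<epsilon> w c) (\<lambda>\<epsilon> w. uncurried ?V ?H \<epsilon> w c)"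
    "gen_eq ?V (\<lambda>\<epsilon>. pd (Par 1) (\<lambda>w. uncurried ?V \<Phi> \<epsilon> w c)) (\<lambda>\<epsilon>. pd (Par 1) (\<lambda>w. uncurried ?V ?H \<epsilon> w c))"
    if "c \<in> ?V" for c
    by (rule Ntau_imp_gen_eq_restrict[OF _ fin disj _ Phi_tau[OF that] PhiH[OF that]]; simp)+
  have Par0: "z (Par 1) = 0" if "z \<in> coord_space ?V" for z
    using that Par_notin_jets[of 1 p q 0] by (simp add: coord_space_def)
  have 0: "gen_eq ?V (\<lambda>\<epsilon> z. ?H \<epsilon> 0 z c) (\<lambda>_ z. z c)" if c: "c \<in> ?V" for c
  proof -
    have coord: "(\<lambda>_ z. z c) \<in> Etau {} ?V" using c by (intro Etau_coord[OF _ fin]) simp_all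
    have n: "(\<lambda>\<epsilon> z. \<Phi> \<epsilon> 0 z c - z c) \<in> Ntau {} ?V"
      using complete c by (simp add: G_n_complete_def group_action_def tau_eq_def)
    have "(\<lambda>\<epsilon> z. (\<Phi> \<epsilon> 0 z c - z c) + z c) \<in> Etau {} ?V"
      by (rule Etau_add[OF _ fin Ntau_imp_Etau[OF n] coord]) simp
    then have "gen_eq ?V (\<lambda>\<epsilon> z. \<Phi> \<epsilon> 0 z c) (\<lambda>_ z. z c)"
      by (intro Ntau_imp_gen_eq[OF fin _ n]) simp
    moreover have "gen_eq ?V (\<lambda>\<epsilon> z. ?H \<epsilon> 0 z c) (\<lambda>\<epsilon> z. \<Phi> \<epsilon> 0 z c)"
      by (rule gen_eq_cong[OF gen_eq_sym[OF congr(1)]]) (use c in \<open>simp_all add: uncurried_def Par0 proj_id\<close>)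
    ultimately show ?thesis by (rule gen_eq_trans[rotated])
  qed
  have 1: "gen_eq ?V (\<lambda>\<epsilon> z. deriv (\<lambda>\<eta>. ?H \<epsilon> \<eta> z c) 0) (\<lambda>\<epsilon> z. vector_field p q \<xi> \<psi> \<epsilon> z c)" if c: "c \<in> ?V" for c
  proof -
    have pd_at: "pd (Par 1) (\<lambda>w. uncurried ?V F \<epsilon> w c) z = deriv (\<lambda>\<eta>. F \<epsilon> \<eta> z c) 0"
      if "z \<in> coord_space ?V" for F \<epsilon> z
      using that Par_notin_jets[of 1 p q 0] by (simp add: pd_def uncurried_def Par0 proj_id proj_upd_notin)
    have Phi1: "(\<lambda>\<epsilon> z. deriv (\<lambda>\<eta>. \<Phi> \<epsilon> \<eta> z c) 0) \<in> Etau {} ?V"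
      by (rule Etau_cong[OF Etau_restrict[OF Etau_pd[OF Phi_tau[OF c]] disj], of "Par 1"])
         (simp_all add: pd_at)
    have n: "(\<lambda>\<epsilon> z. vector_field p q \<xi> \<psi> \<epsilon> z c - generator \<Phi> \<epsilon> z c) \<in> Ntau {} ?V"
      using complete c by (simp add: G_n_complete_def infinitesimal_generator_def tau_eq_def)
    have "(\<lambda>\<epsilon> z. (vector_field p q \<xi> \<psi> \<epsilon> z c - generator \<Phi> \<epsilon> z c) + deriv (\<lambda>\<eta>. \<Phi> \<epsilon> \<eta> z c) 0) \<in> Etau {} ?V"
      by (rule Etau_add[OF _ fin Ntau_imp_Etau[OF n] Phi1]) simp
    then have "gen_eq ?V (\<lambda>\<epsilon> z. vector_field p q \<xi> \<psi> \<epsilon> z c) (\<lambda>\<epsilon> z. generator \<Phi> \<epsilon> z c)"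
      by (intro Ntau_imp_gen_eq[OF fin _ n]) (simp add: generator_def)
    moreover have "gen_eq ?V (\<lambda>\<epsilon> z. deriv (\<lambda>\<eta>. ?H \<epsilon> \<eta> z c) 0) (\<lambda>\<epsilon> z. generator \<Phi> \<epsilon> z c)"
    proof (rule gen_eq_cong[OF gen_eq_sym[OF congr(2)[OF c]]])
      fix \<epsilon> :: real and z assume z: "z \<in> coord_space ?V"
      show "deriv (\<lambda>\<eta>. ?H \<epsilon> \<eta> z c) 0 = pd (Par 1) (\<lambda>w. uncurried ?V ?H \<epsilon> w c) z"
        "generator \<Phi> \<epsilon> z c = pd (Par 1) (\<lambda>w. uncurried ?V \<Phi> \<epsilon> w c) z"
        unfolding generator_def by (rule pd_at[OF z, symmetric])+
    qed
    ultimately show ?thesis by (blast intro: gen_eq_trans gen_eq_sym)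
  qed
  have H_Ind: "?H \<epsilon> \<eta> z (Ind i) = \<Xi> \<epsilon> \<eta> (proj (base p) z) (Ind i)" if "\<epsilon> \<in> {0<..1}" "z \<in> coord_space ?V" for \<epsilon> \<eta> z i
    using Psi that by (simp add: moderate_action_def coord_space_def pair_def)
  have H_Dep: "?H \<epsilon> \<eta> z (Dep \<alpha> {#}) = \<Psi> \<epsilon> \<eta> z (Dep \<alpha> {#})" if "\<epsilon> \<in> {0<..1}" "z \<in> coord_space ?V" for \<epsilon> \<eta> z \<alpha>
    using Xi that proj_in[of "base p" z] by (simp add: moderate_action_def coord_space_def pair_def)
  show ?thesis
  proof
    fix i assume i: "i \<in> {1..p}"
    then have "Ind i \<in> ?V" by simp
    from gen_eq_cong[OF 0[OF this]] show "gen_eq ?V (\<lambda>\<epsilon> z. \<Xi> \<epsilon> 0 (proj (base p) z) (Ind i)) (\<lambda>_ z. z (Ind i))"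
      by (simp add: H_Ind)
    from gen_eq_cong[OF 1[OF \<open>Ind i \<in> ?V\<close>]]
    show "gen_eq ?V (\<lambda>\<epsilon> z. deriv (\<lambda>\<eta>. \<Xi> \<epsilon> \<eta> (proj (base p) z) (Ind i)) 0) (\<lambda>\<epsilon> z. \<xi> i \<epsilon> (proj (base p) z))"
      using i by (simp add: H_Ind vector_field_Ind)
  next
    fix \<alpha> assume \<alpha>: "\<alpha> \<in> {1..q}"
    then have D: "Dep \<alpha> {#} \<in> ?V" by simp
    from gen_eq_cong[OF 0[OF D]] show "gen_eq ?V (\<lambda>\<epsilon> z. \<Psi> \<epsilon> 0 z (Dep \<alpha> {#})) (\<lambda>_ z. z (Dep \<alpha> {#}))"
      by (simp add: H_Dep)
    from gen_eq_cong[OF 1[OF D]] show "gen_eq ?V (\<lambda>\<epsilon> z. deriv (\<lambda>\<eta>. \<Psi> \<epsilon> \<eta> z (Dep \<alpha> {#})) 0) (\<psi> \<alpha>)"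
      using \<alpha> by (simp add: H_Dep vector_field_Dep proj_id)
  qed (use xi psi Xi Psi in simp_all)
qed

theorem theorem4p17:
  fixes p q n :: nat
    and \<xi> \<psi> :: "nat \<Rightarrow> net"
    and X :: vnet
    and \<Phi> \<Xi> \<Psi> :: action
  assumes "\<And>i. i \<in> {1..p} \<Longrightarrow> \<xi> i \<in> Etau {} (base p)"
    and "\<And>\<alpha>. \<alpha> \<in> {1..q} \<Longrightarrow> \<psi> \<alpha> \<in> Etau {} (jets p q 0)"
    and "X = vector_field p q \<xi> \<psi>"
    and "G_n_complete p q n X \<Phi> \<Xi> \<Psi>"
  shows "tau_eq {} (jets p q (n + 1)) (jets p q n)
           (\<lambda>\<epsilon> z. generator (prolong p q n \<Xi> \<Psi>) \<epsilon> (proj (jets p q n) z))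
           (\<lambda>\<epsilon> z c. X \<epsilon> (proj (jets p q 0) z) c +
              (\<Sum>\<alpha>=1..q. \<Sum>J | J \<in> multi_indices p n \<and> 1 \<le> size J.
                 prolonged_coeff p q \<xi> \<psi> \<alpha> J \<epsilon> z * coord_field (Dep \<alpha> J) c))"
proof -
  interpret projectable_flow p q n \<xi> \<psi> \<Xi> \<Psi>
    using projectable_flow_of_action[OF assms(1,2)] assms(3,4) by simp
  let ?L = "\<lambda>\<epsilon> z. generator (prolong p q n \<Xi> \<Psi>) \<epsilon> (proj (jets p q n) z)"
  let ?S = "\<lambda>\<epsilon> z c. \<Sum>\<alpha>=1..q. \<Sum>J | J \<in> multi_indices p n \<and> 1 \<le> size J.
     prolonged_coeff p q \<xi> \<psi> \<alpha> J \<epsilon> z * coord_field (Dep \<alpha> J) c"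
  have "gen_eq V (\<lambda>\<epsilon> z. ?L \<epsilon> z c) (\<lambda>\<epsilon> z. X \<epsilon> (proj (jets p q 0) z) c + ?S \<epsilon> z c)" if "c \<in> jets p q n" for c
  proof (cases c)
    case (Par k)
    then show ?thesis using that by (simp add: Par_notin_jets)
  next
    case (Ind i)
    then have i: "i \<in> {1..p}" using that by simp
    show ?thesis
      by (rule gen_eq_cong[OF generator_Ind[OF i]])
         (use i in \<open>simp_all add: Ind assms(3) vector_field_Ind coord_field_def proj_base_jets0\<close>)
  next
    case (Dep \<alpha> J)
    then have \<alpha>: "\<alpha> \<in> {1..q}" and J: "J \<in> multi_indices p n" using that by simp_all
    have S: "?S \<epsilon> z c = (if J = {#} then 0 else prolonged_coeff p q \<xi> \<psi> \<alpha> J \<epsilon> z)" for \<epsilon> z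
    proof -
      let ?M = "{J \<in> multi_indices p n. 1 \<le> size J}"
      have "(\<Sum>K\<in>?M. prolonged_coeff p q \<xi> \<psi> \<beta> K \<epsilon> z * coord_field (Dep \<beta> K) c) =
          (if \<beta> = \<alpha> then if J = {#} then 0 else prolonged_coeff p q \<xi> \<psi> \<alpha> J \<epsilon> z else 0)" for \<beta>
      proof -
        have "(\<Sum>K\<in>?M. prolonged_coeff p q \<xi> \<psi> \<beta> K \<epsilon> z * coord_field (Dep \<beta> K) c) =
            (\<Sum>K\<in>?M. if K = J then if \<beta> = \<alpha> then prolonged_coeff p q \<xi> \<psi> \<alpha> J \<epsilon> z else 0 else 0)"
          by (rule sum.cong) (auto simp: Dep coord_field_def)
        moreover have "1 \<le> size J \<longleftrightarrow> J \<noteq> {#}"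
          by (cases "size J") auto
        ultimately show ?thesis
          using J finite_multi_indices[of p n] by simp
      qed
      then have "?S \<epsilon> z c = (\<Sum>\<beta>=1..q. if \<beta> = \<alpha> then if J = {#} then 0 else prolonged_coeff p q \<xi> \<psi> \<alpha> J \<epsilon> z else 0)"
        by simp
      then show ?thesis using \<alpha> by simp
    qed
    show ?thesis
    proof (rule gen_eq_cong[OF generator_Dep[OF \<alpha> J]])
      fix \<epsilon> :: real and z assume \<epsilon>: "\<epsilon> \<in> {0<..1}" and z: "z \<in> coord_space V"
      show "X \<epsilon> (proj (jets p q 0) z) c + ?S \<epsilon> z c = recursive_coeff \<alpha> (sorted_list_of_multiset J) \<epsilon> z"
        using \<alpha> prolonged_coeff_eq_recursive[OF \<alpha> J \<epsilon> z]
        unfolding S by (simp add: Dep assms(3) vector_field_Dep proj_proj)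
    qed (simp add: Dep)
  qed
  then have "(\<lambda>\<epsilon> z. ?L \<epsilon> z c - (X \<epsilon> (proj (jets p q 0) z) c + ?S \<epsilon> z c)) \<in> Ntau {} V" if "c \<in> jets p q n" for c
    using that Etau_diff[OF _ fin_V, of "{}"] by (intro negligible_imp_Ntau[OF fin_V]) (simp_all add: gen_eq_def)
  then show ?thesis unfolding tau_eq_def by blast
qed

end
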